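(* Let $E$ be a Banach space with cotype $q$, where $2<q<\infty$, and let $q'$ be given by $\frac1q+\frac1{q'}=1$. Then for every Banach space $F$, every natural number $n$ and every $r$ with $1<r<q'$, $$\mathcal{P}_{[as,r]}(^{n}E;F)=\mathcal{P}_{[as,1]}(^{n}E;F)\quad\text{and}\quad \mathcal{P}_{d,r}(^{n}E;F)=\mathcal{P}_{d,1}(^{n}E;F).$$
   Context: Banach spaces are over $\mathbb{K}=\mathbb{R}$ or $\mathbb{C}$; $E'$ is the dual of $E$ and $B_{E'}$ its closed unit ball with the weak* topology. $\mathcal{P}(^{n}E;F)$ is the space of continuous $n$-homogeneous polynomials $E\to F$, and $\overset{\vee}{P}$ is the unique symmetric continuous $n$-linear mapping associated to $P$. $\mathcal{L}(^{k}E;F)$ is the space of continuous $k$-linear mappings $E\times\dots\times E\to F$. For $0<p<\infty$, a continuous linear operator $u:E\to F$ is absolutely $p$-summing ($u\in\mathcal{L}_{as,p}(E;F)$) if there is $C\ge 0$ with $\left(\sum_{j=1}^k\|u(x_j)\|^p\right)^{1/p}\le C\sup_{\varphi\in B_{E'}}\left(\sum_{j=1}^k|\varphi(x_j)|^p\right)^{1/p}$ for all $k$ and $x_1,\dots,x_k\in E$. $P\in\mathcal{P}_{[as,p]}(^{n}E;F)$ means: $P\in\mathcal{P}(^nE;F)$ and for every $i=1,\dots,n$ the linear operator $E\to\mathcal{L}(^{n-1}E;F)$ sending $x_i$ to $\big((x_j)_{j\ne i}\mapsto \overset{\vee}{P}(x_1,\dots,x_n)\big)$ is absolutely $p$-summing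 (for $n=1$: $P$ itself is absolutely $p$-summing). $P\in\mathcal{P}_{d,p}(^{n}E;F)$ ($P$ is $p$-dominated) means: $P\in\mathcal{P}(^nE;F)$ and there exist $C\ge0$ and a regular Borel probability measure $\mu$ on $B_{E'}$ such that $\|P(x)\|\le C\left[\int_{B_{E'}}|\varphi(x)|^p\,d\mu(\varphi)\right]^{n/p}$ for all $x\in E$. *)

theory Defs
  imports "HOL-Probability.Probability" "HOL-Library.Function_Algebras"
    "HOL-Combinatorics.Permutations"
begin

text \<open>The scalar field is the real or the complex numbers: up to the isometric field embedding
  \<^term>\<open>to_complex\<close> a type of this class is one of the two.\<close>

class real_or_complex = real_normed_field +
  fixes to_complex :: "'a \<Rightarrow> complex"
  assumes to_complex_add: "to_complex (x + y) = to_complex x + to_complex y"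
    and to_complex_mult: "to_complex (x * y) = to_complex x * to_complex y"
    and norm_to_complex: "norm (to_complex x) = norm x"
    and range_to_complex: "range to_complex = \<real> \<or> range to_complex = UNIV"

instantiation real :: real_or_complex
begin
definition to_complex_real :: "real \<Rightarrow> complex" where "to_complex_real = complex_of_real"
instance
  by standard (auto simp: to_complex_real_def Reals_def)
end

instantiation complex :: real_or_complex
begin
definition to_complex_complex :: "complex \<Rightarrow> complex" where "to_complex_complex = id"
instance
  by standard (auto simp: to_complex_complex_def)
end

text \<open>A Banach space over the scalar field is a type of class \<^class>\<open>banach\<close> together with a scalar
  multiplication extending the real one.\<close>

locale banach_over = vector_space sE
  for sE :: "'k::real_or_complex \<Rightarrow> 'a::banach \<Rightarrow> 'a" +
  assumes norm_scale: "norm (sE c x) = norm c * norm x"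
    and scale_of_real: "sE (of_real a) x = a *\<^sub>R x"

definition rademacher :: "nat \<Rightarrow> real \<Rightarrow> real"
  where "rademacher j t = sgn (sin (2 ^ j * pi * t))"

definition has_cotype :: "'a::banach itself \<Rightarrow> real \<Rightarrow> bool"
  where "has_cotype E q \<longleftrightarrow> (\<exists>C\<ge>0. \<forall>(k::nat) (x::nat \<Rightarrow> 'a).
    (\<Sum>j=1..k. norm (x j) powr q) powr (1 / q) \<le>
      C * sqrt (LINT t:{0..1}|lborel. (norm (\<Sum>j=1..k. rademacher j t *\<^sub>R x j))\<^sup>2))"

definition dual_ball :: "('k::real_or_complex \<Rightarrow> 'a::banach \<Rightarrow> 'a) \<Rightarrow> ('a \<Rightarrow> 'k) set"
  where "dual_ball sE =
    {\<phi>. Vector_Spaces.linear sE (*) \<phi> \<and> bounded_linear \<phi> \<and> onorm \<phi> \<le> 1}"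

text \<open>The weak* topology is the topology of pointwise convergence.\<close>

definition weak_star_ball :: "('k::real_or_complex \<Rightarrow> 'a::banach \<Rightarrow> 'a) \<Rightarrow> ('a \<Rightarrow> 'k) topology"
  where "weak_star_ball sE =
    subtopology (product_topology (\<lambda>_. euclidean) UNIV) (dual_ball sE)"

definition regular_borel_prob :: "'b topology \<Rightarrow> 'b measure \<Rightarrow> bool"
  where "regular_borel_prob X \<mu> \<longleftrightarrow>
    prob_space \<mu> \<and> sets \<mu> = sigma_sets (topspace X) {U. openin X U} \<and>
    (\<forall>A\<in>sets \<mu>.
      emeasure \<mu> A = (INF U\<in>{U. openin X U \<and> A \<subseteq> U}. emeasure \<mu> U) \<and>
      emeasure \<mu> A = (SUP K\<in>{K. compactin X K \<and> K \<subseteq> A}. emeasure \<mu> K))"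

text \<open>A mapping on the \<open>n\<close>-fold product is a function of a sequence that depends on its entries
  \<open>0, \<dots>, n - 1\<close> only; for such functions continuity on the \<open>n\<close>-fold product is continuity with
  respect to the product topology on sequences.\<close>

definition multilinear_map ::
    "('k::real_or_complex \<Rightarrow> 'a::banach \<Rightarrow> 'a) \<Rightarrow> ('k \<Rightarrow> 'b::banach \<Rightarrow> 'b) \<Rightarrow> nat \<Rightarrow>
      ((nat \<Rightarrow> 'a) \<Rightarrow> 'b) \<Rightarrow> bool"
  where "multilinear_map sE sF n A \<longleftrightarrow>
    (\<forall>x y. (\<forall>i<n. x i = y i) \<longrightarrow> A x = A y) \<and>
    (\<forall>i<n. \<forall>x. Vector_Spaces.linear sE sF (\<lambda>t. A (x(i := t))))"

definition multilinear_norm :: "nat \<Rightarrow> ((nat \<Rightarrow> 'a::banach) \<Rightarrow> 'b::banach) \<Rightarrow> real"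
  where "multilinear_norm n A = (SUP x\<in>{x. \<forall>i<n. norm (x i) \<le> 1}. norm (A x))"

definition cont_hom_polys ::
    "('k::real_or_complex \<Rightarrow> 'a::banach \<Rightarrow> 'a) \<Rightarrow> ('k \<Rightarrow> 'b::banach \<Rightarrow> 'b) \<Rightarrow> nat \<Rightarrow> ('a \<Rightarrow> 'b) set"
  where "cont_hom_polys sE sF n =
    {P. (\<exists>A. multilinear_map sE sF n A \<and> (\<forall>x. P x = A (\<lambda>_. x))) \<and> continuous_on UNIV P}"

definition polar_form ::
    "('k::real_or_complex \<Rightarrow> 'a::banach \<Rightarrow> 'a) \<Rightarrow> ('k \<Rightarrow> 'b::banach \<Rightarrow> 'b) \<Rightarrow> nat \<Rightarrow> ('a \<Rightarrow> 'b) \<Rightarrow>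
      (nat \<Rightarrow> 'a) \<Rightarrow> 'b"
  where "polar_form sE sF n P = (THE A.
    multilinear_map sE sF n A \<and> continuous_on UNIV A \<and>
    (\<forall>\<sigma> x. \<sigma> permutes {..<n} \<longrightarrow> A (x \<circ> \<sigma>) = A x) \<and>
    (\<forall>x. P x = A (\<lambda>_. x)))"

text \<open>The codomain is given by its scalar multiplication \<open>sG\<close> and its norm \<open>N\<close>, since spaces of
  multilinear mappings are not types.\<close>

definition abs_summing ::
    "('k::real_or_complex \<Rightarrow> 'a::banach \<Rightarrow> 'a) \<Rightarrow> ('k \<Rightarrow> 'g::ab_group_add \<Rightarrow> 'g) \<Rightarrow> ('g \<Rightarrow> real) \<Rightarrow>
      real \<Rightarrow> ('a \<Rightarrow> 'g) \<Rightarrow> bool"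
  where "abs_summing sE sG N p u \<longleftrightarrow>
    Vector_Spaces.linear sE sG u \<and> (\<exists>B. \<forall>x. N (u x) \<le> B * norm x) \<and>
    (\<exists>C\<ge>0. \<forall>(k::nat) (x::nat \<Rightarrow> 'a).
      (\<Sum>j=1..k. N (u (x j)) powr p) powr (1 / p) \<le>
        C * (SUP \<phi>\<in>dual_ball sE. (\<Sum>j=1..k. norm (\<phi> (x j)) powr p) powr (1 / p)))"

definition insert_arg :: "nat \<Rightarrow> 'a \<Rightarrow> (nat \<Rightarrow> 'a) \<Rightarrow> nat \<Rightarrow> 'a"
  where "insert_arg i t y = (\<lambda>j. if j < i then y j else if j = i then t else y (j - 1))"

definition summing_polys ::
    "('k::real_or_complex \<Rightarrow> 'a::banach \<Rightarrow> 'a) \<Rightarrow> ('k \<Rightarrow> 'b::banach \<Rightarrow> 'b) \<Rightarrow> real \<Rightarrow> nat \<Rightarrow>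
      ('a \<Rightarrow> 'b) set"
  where "summing_polys sE sF p n = {P \<in> cont_hom_polys sE sF n.
    if n = 1 then abs_summing sE sF norm p P
    else \<forall>i<n. abs_summing sE (\<lambda>c A y. sF c (A y)) (multilinear_norm (n - 1)) p
      (\<lambda>t y. polar_form sE sF n P (insert_arg i t y))}"

definition dominated_polys ::
    "('k::real_or_complex \<Rightarrow> 'a::banach \<Rightarrow> 'a) \<Rightarrow> ('k \<Rightarrow> 'b::banach \<Rightarrow> 'b) \<Rightarrow> real \<Rightarrow> nat \<Rightarrow>
      ('a \<Rightarrow> 'b) set"
  where "dominated_polys sE sF p n = {P \<in> cont_hom_polys sE sF n.
    \<exists>C\<ge>0. \<exists>\<mu>. regular_borel_prob (weak_star_ball sE) \<mu> \<and>
      (\<forall>x. norm (P x) \<le> C * (LINT \<phi>|\<mu>. norm (\<phi> x) powr p) powr (real n / p))}"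

end

theory Submission
  imports Defs
begin

text \<open>Both identities come from one fact about a space \<open>E\<close> of cotype \<open>q > 2\<close>, with
  \<open>1 / r + 1 / s = 1\<close> and hence \<open>s > q\<close>: every finite weakly summable family \<open>x\<^sub>j\<close> in \<open>E\<close> can be
  written as \<open>x\<^sub>j = c\<^sub>j y\<^sub>j\<close> with \<open>\<Sum> c\<^sub>j powr s\<close> bounded and \<open>y\<^sub>j\<close> weakly \<open>r\<close>-summable, uniformly. By
  Hoelder's inequality an \<open>r\<close>-summing homogeneous map is then \<open>1\<close>-summing.

  For the factorization, cotype makes \<open>v : \<ell>\<^sub>\<infinity>\<^sup>k \<rightarrow> E\<close>, \<open>e\<^sub>j \<mapsto> x\<^sub>j\<close>, a \<open>(q,1)\<close>-summing operator, Pisier's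
  argument bounds \<open>\<parallel>v f\<parallel> powr q\<close> by \<open>\<mu>(A)\<close> when \<open>\<bar>f\<bar> \<le> 1\<^sub>A\<close> for a measure \<open>\<mu>\<close> on the coordinates, and
  cutting into dyadic blocks bounds \<open>v\<close> on \<open>L\<^sub>s(\<mu>)\<close>; the \<open>y\<^sub>j\<close> are the \<open>x\<^sub>j\<close> divided by \<open>\<mu>\<^sub>j powr (1 / s)\<close>.

  A dominating measure \<open>\<mu>\<close> gives the \<open>r\<close>-summing seminorm \<open>x \<mapsto> (\<integral> \<bar>\<phi> x\<bar> powr r d\<mu>) powr (1 / r)\<close>, which
  is therefore \<open>1\<close>-summing, and Pietsch's domination theorem replaces \<open>\<mu>\<close> by a measure for the
  exponent \<open>1\<close>.\<close>

section \<open>The Hahn-Banach theorem\<close>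

text \<open>The estimate that cotype yields is tested on functions bounded by an indicator, so it is
  a bound on the Lorentz space L(q,1) of \<mu> rather than on L_q(\<mu>). Passing to L_s(\<mu>)
  costs a geometric series of ratio 2^(1 - s/q), which converges exactly when s > q; this is where r
  < q' enters. The converse inclusions, from exponent 1 to r, come from Hoelder's inequality: for
  operators by rescaling the test vectors, for dominated polynomials with the measure unchanged. The
  dual ball need not be metrizable, so regularity of the Pietsch measure is not automatic. The
  measure is therefore built together with its regularity, from the outer measure that a positive
  functional on continuous functions induces. Real and complex scalars are treated at once: the
  estimates are made for real functionals, which are complexified, or recovered as real and
  imaginary parts, when scalars enter.\<close>

definition sublinear_fun :: "('a::real_vector \<Rightarrow> real) \<Rightarrow> bool"
  where "sublinear_fun p \<longleftrightarrow>
    (\<forall>x y. p (x + y) \<le> p x + p y) \<and> (\<forall>t>0. \<forall>x. p (t *\<^sub>R x) \<le> t * p x)"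

lemma sublinear_funI:
  assumes "\<And>x y. p (x + y) \<le> p x + p y" "\<And>t x. t > 0 \<Longrightarrow> p (t *\<^sub>R x) \<le> t * p x"
  shows "sublinear_fun p"
  using assms by (simp add: sublinear_fun_def)

lemma sublinear_fun_add: "sublinear_fun p \<Longrightarrow> p (x + y) \<le> p x + p y"
  by (simp add: sublinear_fun_def)

text \<open>The definition asks for an inequality at t > 0 only, the form that infima preserve;
  using it for t and for 1 / t gives equality.\<close>

lemma sublinear_fun_scale:
  assumes "sublinear_fun p" "t > 0"
  shows "p (t *\<^sub>R x) = t * p x"
proof (rule antisym)
  show "p (t *\<^sub>R x) \<le> t * p x" using assms by (simp add: sublinear_fun_def)
  have "p (inverse t *\<^sub>R (t *\<^sub>R x)) \<le> inverse t * p (t *\<^sub>R x)"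
    using assms unfolding sublinear_fun_def by (metis positive_imp_inverse_positive)
  then show "t * p x \<le> p (t *\<^sub>R x)" using assms(2) by (simp add: field_simps)
qed

lemma sublinear_fun_zero: "sublinear_fun p \<Longrightarrow> p 0 = 0"
  using sublinear_fun_scale[of p 2 0] by simp

lemma sublinear_fun_lower: "sublinear_fun p \<Longrightarrow> - p (- x) \<le> p x"
  using sublinear_fun_add[of p x "- x"] sublinear_fun_zero[of p] by simp

text \<open>The new functional stays below \<open>p\<close> but is at most \<open>- p x\<close> at
  \<open>- x\<close>, so every linear functional below it takes the value \<open>p x\<close> at
  \<open>x\<close>. This one construction yields both the additivity of a minimal functional and a
  norming functional.\<close>

lemma sublinear_fun_shift:
  fixes x :: "'a::real_vector"
  assumes p: "sublinear_fun p"
  defines "q \<equiv> \<lambda>y. INF t\<in>{0..}. p (y + t *\<^sub>R x) - t * p x"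
  shows "sublinear_fun q" "q y \<le> p y" "q y \<le> p (y + x) - p x"
proof -
  have lower: "- p (- y) \<le> p (y + t *\<^sub>R x) - t * p x" if "t \<ge> 0" for y t
  proof (cases "t = 0")
    case True
    then show ?thesis using sublinear_fun_lower[OF p] by simp
  next
    case False
    with that have "p (t *\<^sub>R x) = t * p x" using sublinear_fun_scale[OF p] by simp
    then show ?thesis using sublinear_fun_add[OF p, of "y + t *\<^sub>R x" "- y"] by simp
  qed
  have bdd: "bdd_below ((\<lambda>t. p (y + t *\<^sub>R x) - t * p x) ` {0..})" for y
    using lower[of _ y] by (intro bdd_belowI[of _ "- p (- y)"]) auto
  have le: "q y \<le> p (y + t *\<^sub>R x) - t * p x" if "t \<ge> 0" for y t
    unfolding q_def by (rule cINF_lower[OF bdd]) (use that in auto)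
  show "q y \<le> p y" using le[of 0 y] by simp
  show "q y \<le> p (y + x) - p x" using le[of 1 y] by simp
  show "sublinear_fun q"
  proof (rule sublinear_funI)
    fix y z
    \<comment> \<open>The two infima are taken one after the other; the parameter for y + z is s +
      t.\<close>
    have *: "q (y + z) - (p (y + s *\<^sub>R x) - s * p x) \<le> p (z + t *\<^sub>R x) - t * p x"
      if "s \<ge> 0" "t \<ge> 0" for s t
      using le[of "s + t" "y + z"] that
        sublinear_fun_add[OF p, of "y + s *\<^sub>R x" "z + t *\<^sub>R x"]
      by (simp add: algebra_simps)
    have "q (y + z) - (p (y + s *\<^sub>R x) - s * p x) \<le> q z" if "s \<ge> 0" for s
      unfolding q_def by (rule cINF_greatest) (use *[unfolded q_def] that in auto)
    then have "q (y + z) - q z \<le> p (y + s *\<^sub>R x) - s * p x" if "s \<ge> 0" for s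
      using that by (simp add: algebra_simps)
    then have "q (y + z) - q z \<le> q y"
      unfolding q_def by (intro cINF_greatest) auto
    then show "q (y + z) \<le> q y + q z" by simp
  next
    fix s :: real and y assume s: "s > 0"
    have "q (s *\<^sub>R y) / s \<le> p (y + t *\<^sub>R x) - t * p x" if "t \<ge> 0" for t
    proof -
      have "q (s *\<^sub>R y) \<le> p (s *\<^sub>R y + (s * t) *\<^sub>R x) - (s * t) * p x"
        using le[of "s * t"] that s by simp
      also have "s *\<^sub>R y + (s * t) *\<^sub>R x = s *\<^sub>R (y + t *\<^sub>R x)" by (simp add: algebra_simps)
      also have "p \<dots> = s * p (y + t *\<^sub>R x)" using sublinear_fun_scale[OF p s] .
      finally show ?thesis using s by (simp add: field_simps)
    qed
    then have "q (s *\<^sub>R y) / s \<le> q y" unfolding q_def by (intro cINF_greatest) auto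
    then show "q (s *\<^sub>R y) \<le> s * q y" using s by (simp add: field_simps)
  qed
qed

text \<open>A sublinear functional that is minimal for the pointwise order is linear.\<close>

theorem hahn_banach_sublinear:
  fixes p :: "'a::real_vector \<Rightarrow> real"
  assumes p: "sublinear_fun p"
  obtains l where "linear l" "\<And>x. l x \<le> p x"
proof -
  define A where "A = {f. sublinear_fun f \<and> f \<le> p}"
  have po: "partial_order_on A (relation_of (\<ge>) A)"
    by (rule partial_order_on_relation_ofI) auto
  have ub: "\<exists>u\<in>A. \<forall>a\<in>C. a \<ge> u" if C: "C \<in> Chains (relation_of (\<ge>) A)" for C
  proof (cases "C = {}")
    case True
    then show ?thesis using p by (auto simp: A_def)
  next
    case False
    have CA: "C \<subseteq> A" and ch: "\<And>f g. f \<in> C \<Longrightarrow> g \<in> C \<Longrightarrow> f \<le> g \<or> g \<le> f"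
      using C unfolding Chains_def relation_of_def by auto
    define g where "g x = (INF f\<in>C. f x)" for x
    \<comment> \<open>The bound f \<le> p at \<open>- x\<close> keeps every f x above a number that
      does not depend on f, so the infimum over the chain is finite.\<close>
    have lower: "- p (- x) \<le> f x" if "f \<in> C" for f x
    proof -
      have "sublinear_fun f" "f \<le> p" using that CA by (auto simp: A_def)
      then show ?thesis using sublinear_fun_lower[of f x] by (force simp: le_fun_def dest: spec[of _ "- x"])
    qed
    have bdd: "bdd_below ((\<lambda>f. f x) ` C)" for x
      using lower by (intro bdd_belowI[of _ "- p (- x)"]) auto
    have gle: "g x \<le> f x" if "f \<in> C" for f x
      unfolding g_def by (rule cINF_lower[OF bdd that])
    have "sublinear_fun g"
    proof (rule sublinear_funI)
      fix x y
      have *: "g (x + y) \<le> f x + h y" if fh: "f \<in> C" "h \<in> C" for f h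
      proof -
        \<comment> \<open>Two members of a chain are comparable, so the smaller one bounds both
          terms. For an arbitrary family the pointwise infimum need not be subadditive.\<close>
        from ch[OF fh] obtain k where k: "k \<in> C" "k \<le> f" "k \<le> h" using fh by auto
        have "g (x + y) \<le> k (x + y)" using gle k by auto
        also have "\<dots> \<le> k x + k y" using k CA by (auto simp: A_def sublinear_fun_def)
        also have "\<dots> \<le> f x + h y" using k by (auto simp: le_fun_def intro: add_mono)
        finally show ?thesis .
      qed
      have "g (x + y) - f x \<le> g y" if "f \<in> C" for f
        unfolding g_def[of y] using False *[OF that] by (intro cINF_greatest) (auto simp: algebra_simps)
      then have "g (x + y) - g y \<le> f x" if "f \<in> C" for f
        using that by (simp add: algebra_simps)
      then have "g (x + y) - g y \<le> g x"
        unfolding g_def[of x] using False by (intro cINF_greatest) auto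
      then show "g (x + y) \<le> g x + g y" by simp
    next
      fix t :: real and x :: 'a assume t: "t > 0"
      have "g (t *\<^sub>R x) / t \<le> f x" if "f \<in> C" for f
      proof -
        have "sublinear_fun f" using that CA by (auto simp: A_def)
        then show ?thesis using gle[OF that, of "t *\<^sub>R x"] sublinear_fun_scale[of f t x] t
          by (simp add: field_simps)
      qed
      then have "g (t *\<^sub>R x) / t \<le> g x"
        unfolding g_def[of x] using False by (intro cINF_greatest) auto
      then show "g (t *\<^sub>R x) \<le> t * g x" using t by (simp add: field_simps)
    qed
    moreover have "g \<le> p"
    proof -
      obtain f where f: "f \<in> C" using False by auto
      then have "f \<le> p" using CA by (auto simp: A_def)
      then show ?thesis using gle[OF f] by (auto simp: le_fun_def intro: order_trans)
    qed
    ultimately show ?thesis using gle by (auto simp: A_def le_fun_def)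
  qed
  obtain m where m: "m \<in> A" and min: "\<And>a. a \<in> A \<Longrightarrow> a \<le> m \<Longrightarrow> a = m"
    using predicate_Zorn[OF po] ub by (auto 4 4)
  have sm: "sublinear_fun m" and mp: "m \<le> p" using m by (auto simp: A_def)
  have add: "m (y + x) = m y + m x" for x y
  proof (rule antisym)
    define q where "q = (\<lambda>y. INF t\<in>{0..}. m (y + t *\<^sub>R x) - t * m x)"
    have q: "sublinear_fun q" "\<And>y. q y \<le> m y" "\<And>y. q y \<le> m (y + x) - m x"
      using sublinear_fun_shift[OF sm, where x = x] unfolding q_def by auto
    \<comment> \<open>Minimality identifies q with m, and the third property of q becomes
      superadditivity of m.\<close>
    then have "q = m" using mp by (intro min) (auto simp: A_def le_fun_def intro: order_trans)
    then show "m y + m x \<le> m (y + x)" using q(3)[of y] by simp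
  qed (rule sublinear_fun_add[OF sm])
  have neg: "m (- x) = - m x" for x using add[of x "- x"] sublinear_fun_zero[OF sm] by simp
  have "m (t *\<^sub>R x) = t * m x" for t x
  proof (cases t "0::real" rule: linorder_cases)
    case less
    then show ?thesis using sublinear_fun_scale[OF sm, of "- t" x] neg[of "t *\<^sub>R x"] by simp
  next
    case equal
    then show ?thesis using sublinear_fun_zero[OF sm] by simp
  next
    case greater
    then show ?thesis using sublinear_fun_scale[OF sm] by simp
  qed
  then have "linear m" using add by (intro linearI) auto
  then show ?thesis using that mp by (auto simp: le_fun_def)
qed

text \<open>Applying Hahn-Banach to the shifted norm forces \<open>l (- x) \<le> - norm x\<close>,
  which prescribes the value at \<open>x\<close> along with the domination by the norm.\<close>

lemma norming_functional_real:
  fixes x :: "'a::real_normed_vector"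
  obtains l where "linear l" "\<And>y. \<bar>l y\<bar> \<le> norm y" "l x = norm x"
proof -
  have sn: "sublinear_fun (norm :: 'a \<Rightarrow> real)"
    by (rule sublinear_funI) (auto intro: norm_triangle_ineq)
  obtain l where l: "linear l" "\<And>y. l y \<le> (INF t\<in>{0..}. norm (y + t *\<^sub>R x) - t * norm x)"
    using hahn_banach_sublinear[OF sublinear_fun_shift(1)[OF sn]] by blast
  have ln: "l y \<le> norm y" for y
    using l(2)[of y] sublinear_fun_shift(2)[OF sn, where x = x and y = y] by (rule order_trans)
  moreover have "l (- x) \<le> norm (- x + x) - norm x"
    using l(2)[of "- x"] sublinear_fun_shift(3)[OF sn, where x = x and y = "- x"] by (rule order_trans)
  moreover have "- l y \<le> norm y" for y using ln[of "- y"] l(1) by (simp add: linear_neg)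
  ultimately show ?thesis using l(1) ln[of x] by (intro that[of l]) (auto simp: linear_neg abs_le_iff)
qed

section \<open>The scalar field inside the complex numbers\<close>

lemma to_complex_zero: "to_complex (0::'k::real_or_complex) = 0"
  using to_complex_add[of "0::'k" 0] by simp

lemma to_complex_minus: "to_complex (- x) = - to_complex (x::'k::real_or_complex)"
  using to_complex_add[of x "- x"] by (simp add: to_complex_zero eq_neg_iff_add_eq_0 add.commute)

lemma to_complex_diff: "to_complex (x - y) = to_complex x - to_complex (y::'k::real_or_complex)"
  using to_complex_add[of x "- y"] by (simp add: to_complex_minus)

lemma inj_to_complex: "inj (to_complex :: 'k::real_or_complex \<Rightarrow> complex)"
proof (rule injI)
  fix x y :: 'k assume "to_complex x = to_complex y"
  then have "norm (x - y) = 0" by (metis norm_to_complex to_complex_diff cancel_comm_monoid_add_class.diff_cancel norm_zero)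
  then show "x = y" by simp
qed

lemma to_complex_one: "to_complex (1::'k::real_or_complex) = 1"
proof -
  have "to_complex (1::'k) * to_complex (1::'k) = to_complex (1::'k)"
    using to_complex_mult[of "1::'k" 1] by simp
  moreover have "to_complex (1::'k) \<noteq> 0"
    using norm_to_complex[of "1::'k"] by auto
  ultimately show ?thesis by simp
qed

text \<open>A complex number is determined by its distances to \<open>0\<close>, \<open>1\<close> and \<open>-1\<close> up to conjugation.\<close>

lemma to_complex_of_real: "to_complex (of_real a :: 'k::real_or_complex) = of_real a"
proof -
  define z where "z = to_complex (of_real a :: 'k)"
  have "norm (z - 1) = norm (of_real (a - 1) :: 'k)" "norm (z + 1) = norm (of_real (a + 1) :: 'k)"
    "norm z = norm (of_real a :: 'k)"
    using norm_to_complex[of "of_real (a - 1) :: 'k"] norm_to_complex[of "of_real (a + 1) :: 'k"]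
      norm_to_complex[of "of_real a :: 'k"]
    by (simp_all add: z_def to_complex_diff to_complex_add to_complex_one del: norm_of_real)
  then have "(norm (z - 1))\<^sup>2 = (a - 1)\<^sup>2" "(norm (z + 1))\<^sup>2 = (a + 1)\<^sup>2" "(norm z)\<^sup>2 = a\<^sup>2"
    by (simp_all add: norm_of_real del: of_real_diff of_real_add)
  then have "(Re z - 1)\<^sup>2 + (Im z)\<^sup>2 = (a - 1)\<^sup>2" "(Re z + 1)\<^sup>2 + (Im z)\<^sup>2 = (a + 1)\<^sup>2"
    "(Re z)\<^sup>2 + (Im z)\<^sup>2 = a\<^sup>2"
    by (simp_all add: cmod_power2)
  then have "Re z = a" "(Im z)\<^sup>2 = 0" unfolding power2_eq_square by algebra+
  then show ?thesis unfolding z_def[symmetric] by (simp add: complex_eq_iff)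
qed

lemma to_complex_scaleR: "to_complex (a *\<^sub>R (x::'k::real_or_complex)) = a *\<^sub>R to_complex x"
  by (simp add: scaleR_conv_of_real to_complex_mult to_complex_of_real)

lemma scalar_eq_of_real:
  fixes c :: "'k::real_or_complex"
  assumes "range (to_complex :: 'k \<Rightarrow> complex) = \<real>"
  shows "\<exists>a. c = of_real a"
proof -
  have "to_complex c \<in> \<real>" using assms by auto
  then obtain a where "to_complex c = of_real a" by (auto elim: Reals_cases)
  then have "to_complex c = to_complex (of_real a :: 'k)" by (simp add: to_complex_of_real)
  then show ?thesis using inj_to_complex by (auto dest: injD)
qed

section \<open>The dual unit ball and norming functionals\<close>

context banach_over
begin

text \<open>Membership becomes a family of pointwise conditions, each preserved by pointwise
  convergence; the compactness proof rests on this form.\<close>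

lemma dual_ball_iff:
  "\<phi> \<in> dual_ball sE \<longleftrightarrow> (\<forall>x y. \<phi> (x + y) = \<phi> x + \<phi> y) \<and> (\<forall>c x. \<phi> (sE c x) = c * \<phi> x) \<and>
    (\<forall>x. norm (\<phi> x) \<le> norm x)"
proof
  assume "\<phi> \<in> dual_ball sE"
  then have lin: "Vector_Spaces.linear sE (*) \<phi>" and bl: "bounded_linear \<phi>" and on: "onorm \<phi> \<le> 1"
    by (auto simp: dual_ball_def)
  have "norm (\<phi> x) \<le> norm x" for x
    using onorm[OF bl, of x] mult_right_mono[OF on, of "norm x"] by simp
  moreover have hom: "module_hom sE (*) \<phi>" using lin by (simp add: Vector_Spaces.linear_def)
  ultimately show "(\<forall>x y. \<phi> (x + y) = \<phi> x + \<phi> y) \<and> (\<forall>c x. \<phi> (sE c x) = c * \<phi> x) \<and>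
    (\<forall>x. norm (\<phi> x) \<le> norm x)"
    using module_hom.add[OF hom] module_hom.scale[OF hom] by auto
next
  assume *: "(\<forall>x y. \<phi> (x + y) = \<phi> x + \<phi> y) \<and> (\<forall>c x. \<phi> (sE c x) = c * \<phi> x) \<and>
    (\<forall>x. norm (\<phi> x) \<le> norm x)"
  have vs: "vector_space ((*) :: 'k \<Rightarrow> 'k \<Rightarrow> 'k)"
    by unfold_locales (auto simp: algebra_simps)
  have "Vector_Spaces.linear sE (*) \<phi>"
    using * vs vector_space_axioms
    by (auto simp: Vector_Spaces.linear_def module_hom_def module_hom_axioms_def module_iff_vector_space)
  moreover have "bounded_linear \<phi>"
  proof (rule bounded_linear_intro[where K = 1])
    fix r :: real and x
    show "\<phi> (r *\<^sub>R x) = r *\<^sub>R \<phi> x"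
      using * by (metis scale_of_real scaleR_conv_of_real)
  qed (use * in auto)
  moreover have "onorm \<phi> \<le> 1" using * by (intro onorm_bound) auto
  ultimately show "\<phi> \<in> dual_ball sE" by (simp add: dual_ball_def)
qed

lemma dual_ball_bounded_linear: "\<phi> \<in> dual_ball sE \<Longrightarrow> bounded_linear \<phi>"
  by (simp add: dual_ball_def)

lemma dual_ball_norm_le: "\<phi> \<in> dual_ball sE \<Longrightarrow> norm (\<phi> x) \<le> norm x"
  by (simp add: dual_ball_iff)

lemma zero_in_dual_ball: "(\<lambda>_. 0) \<in> dual_ball sE"
  by (simp add: dual_ball_iff)

text \<open>A real norming functional \<open>l\<close> is complexified in the usual way: l(y) - i
  l(i y) is the scalar-linear functional with real part \<open>l\<close>. With real scalars
  \<open>l\<close> itself serves.\<close>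

lemma dual_ball_norming:
  obtains \<phi> where "\<phi> \<in> dual_ball sE" "norm (\<phi> x) = norm x"
proof -
  obtain l where l: "linear l" "\<And>y. \<bar>l y\<bar> \<le> norm y" "l x = norm x"
    using norming_functional_real[of x] by blast
  show ?thesis
  proof (cases "range (to_complex :: 'k \<Rightarrow> complex) = \<real>")
    case True
    define \<phi> where "\<phi> y = (of_real (l y) :: 'k)" for y
    have "\<phi> (sE c y) = c * \<phi> y" for c y
    proof -
      obtain a where "c = of_real a" using scalar_eq_of_real[OF True] by blast
      then show ?thesis using l(1) by (simp add: \<phi>_def scale_of_real linear_scale)
    qed
    then have "\<phi> \<in> dual_ball sE"
      using l by (auto simp: dual_ball_iff \<phi>_def linear_add)
    then show ?thesis using l(3) by (intro that) (auto simp: \<phi>_def)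
  next
    case False
    then have ran: "range (to_complex :: 'k \<Rightarrow> complex) = UNIV" using range_to_complex by blast
    then obtain i :: 'k where i: "to_complex i = \<i>" by (metis UNIV_I imageE)
    have ii: "i * i = - 1"
      by (rule injD[OF inj_to_complex]) (simp add: to_complex_mult i to_complex_minus to_complex_one)
    \<comment> \<open>Splitting scalars into real and imaginary parts reduces homogeneity to real
      multiples and to \<open>i\<close>.\<close>
    have dec: "c = of_real (Re (to_complex c)) + of_real (Im (to_complex c)) * i" for c :: 'k
      by (rule injD[OF inj_to_complex])
        (simp add: to_complex_mult to_complex_add i to_complex_of_real complex_eq_iff)
    define \<phi> where "\<phi> y = (of_real (l y) - i * of_real (l (sE i y)) :: 'k)" for y
    have add: "\<phi> (y + z) = \<phi> y + \<phi> z" for y z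
      using l(1) by (simp add: \<phi>_def linear_add scale_right_distrib algebra_simps)
    have real: "\<phi> (sE (of_real a) y) = of_real a * \<phi> y" for a y
    proof -
      have "sE i (sE (of_real a) y) = a *\<^sub>R sE i y"
        by (metis scale_of_real scale_left_commute)
      then show ?thesis using l(1) by (simp add: \<phi>_def scale_of_real linear_scale algebra_simps)
    qed
    have im: "\<phi> (sE i y) = i * \<phi> y" for y
    proof -
      have "sE i (sE i y) = - y" by (simp add: ii)
      then have "\<phi> (sE i y) = of_real (l (sE i y)) + i * of_real (l y)"
        using l(1) by (simp add: \<phi>_def linear_neg)
      also have "\<dots> = i * \<phi> y" by (simp add: \<phi>_def algebra_simps mult.assoc[symmetric] ii)
      finally show ?thesis .
    qed
    have scale: "\<phi> (sE c y) = c * \<phi> y" for c y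
    proof -
      have "sE c y = sE (of_real (Re (to_complex c))) y + sE (of_real (Im (to_complex c))) (sE i y)"
        by (subst (1) dec[of c]) (simp add: scale_left_distrib)
      then have "\<phi> (sE c y) = of_real (Re (to_complex c)) * \<phi> y + of_real (Im (to_complex c)) * (i * \<phi> y)"
        by (simp add: add real im del: scale_scale)
      also have "\<dots> = c * \<phi> y" by (subst (3) dec[of c]) (simp add: algebra_simps)
      finally show ?thesis .
    qed
    have re: "Re (to_complex (\<phi> y)) = l y" for y
      by (simp add: \<phi>_def to_complex_diff to_complex_mult to_complex_of_real i)
    have nle: "norm (\<phi> y) \<le> norm y" for y
    proof (cases "\<phi> y = 0")
      case False
      \<comment> \<open>Rotating \<open>y\<close> by a scalar of modulus 1 makes the value of \<phi>
        real and nonnegative, hence equal to that of \<open>l\<close>, which the norm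
        bounds.\<close>
      define c where "c = of_real (norm (\<phi> y)) / \<phi> y"
      have nc: "norm c = 1" using False by (simp add: c_def norm_divide)
      have "to_complex (\<phi> (sE c y)) = of_real (norm (\<phi> y))"
        using False unfolding scale c_def by (simp add: to_complex_of_real)
      then have "norm (\<phi> y) = l (sE c y)" using re[of "sE c y"] by simp
      also have "\<dots> \<le> norm (sE c y)" using l(2)[of "sE c y"] by simp
      finally show ?thesis using nc by (simp add: norm_scale)
    qed simp
    have "norm x \<le> norm (\<phi> x)"
      using abs_Re_le_cmod[of "to_complex (\<phi> x)"] by (simp add: norm_to_complex re l(3))
    then show ?thesis using nle add scale by (intro that[of \<phi>]) (auto simp: dual_ball_iff intro: antisym)
  qed
qed

end

section \<open>Factorization of weakly summable families\<close>

text \<open>The graph of t^q lies above its tangent at b. In this form it is Young's inequality with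
  exponents q / (q - 1) and q.\<close>

lemma powr_tangent_le:
  fixes b w q :: real
  assumes "q > 1" "b \<ge> 0" "w \<ge> 0"
  shows "q * (b powr (q - 1) * w) \<le> (q - 1) * b powr q + w powr q"
proof -
  have "(b powr (q - 1)) * w \<le> (b powr (q - 1)) powr (q / (q - 1)) / (q / (q - 1)) + w powr q / q"
    using assms by (intro Youngs_inequality) (auto simp: field_simps)
  also have "(b powr (q - 1)) powr (q / (q - 1)) = b powr q" using assms by (simp add: powr_powr)
  finally show ?thesis using assms by (simp add: field_simps)
qed

lemma sum_Holder:
  fixes a b :: "'i \<Rightarrow> real"
  assumes rs: "r > 1" "s > 1" "1 / r + 1 / s = 1"
    and nn: "\<And>j. j \<in> J \<Longrightarrow> a j \<ge> 0" "\<And>j. j \<in> J \<Longrightarrow> b j \<ge> 0" and J: "finite J"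
  shows "(\<Sum>j\<in>J. a j * b j) \<le> (\<Sum>j\<in>J. a j powr r) powr (1 / r) * (\<Sum>j\<in>J. b j powr s) powr (1 / s)"
proof -
  define A where "A = (\<Sum>j\<in>J. a j powr r)"
  define B where "B = (\<Sum>j\<in>J. b j powr s)"
  have AB: "A \<ge> 0" "B \<ge> 0" unfolding A_def B_def by (auto intro: sum_nonneg)
  show ?thesis
  proof (cases "A = 0 \<or> B = 0")
    case True
    then have "\<forall>j\<in>J. a j * b j = 0"
      using J by (auto simp: A_def B_def sum_nonneg_eq_0_iff)
    then show ?thesis by (simp add: sum.neutral)
  next
    case False
    then have pos: "A > 0" "B > 0" using AB by auto
    define \<alpha> where "\<alpha> = A powr (1 / r)"
    define \<beta> where "\<beta> = B powr (1 / s)"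
    have ab: "\<alpha> > 0" "\<beta> > 0" "\<alpha> powr r = A" "\<beta> powr s = B"
      using pos rs by (auto simp: \<alpha>_def \<beta>_def powr_powr)
    have "(\<Sum>j\<in>J. (a j / \<alpha>) * (b j / \<beta>)) \<le> (\<Sum>j\<in>J. (a j / \<alpha>) powr r / r + (b j / \<beta>) powr s / s)"
      using nn ab rs by (intro sum_mono Youngs_inequality) auto
    also have "\<dots> = (\<Sum>j\<in>J. a j powr r / (A * r)) + (\<Sum>j\<in>J. b j powr s / (B * s))"
      unfolding sum.distrib using nn ab by (intro arg_cong2[where f = "(+)"] sum.cong) (auto simp: powr_divide)
    also have "\<dots> = 1"
      using rs(3) pos by (simp add: sum_divide_distrib[symmetric] A_def[symmetric] B_def[symmetric])
    finally have "(\<Sum>j\<in>J. a j * b j) / (\<alpha> * \<beta>) \<le> 1"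
      by (simp add: sum_divide_distrib)
    then show ?thesis using ab by (simp add: A_def B_def \<alpha>_def \<beta>_def field_simps)
  qed
qed

text \<open>If the system \<open>a\<^sub>1, \<dots>, a\<^sub>m\<close> is nearly extremal for the \<open>(q,1)\<close>-summing norm, adjoining \<open>f\<close> and
  replacing \<open>a\<^sub>i\<close> by \<open>(1 - \<bar>f\<bar>) a\<^sub>i\<close> gains almost nothing. The first-order expansion of the
  loss is an additive function of \<open>\<bar>f\<bar>\<close>, and it bounds \<open>\<parallel>v f\<parallel> powr q\<close>. The near extremality defect
  is absorbed by adding a constant to every weight.\<close>

lemma pisier_weights:
  fixes x :: "'i \<Rightarrow> 'a::real_normed_vector" and D q :: real
  assumes J: "finite J" and q: "q > 1"
    and summing: "\<And>(m::nat) (a::nat \<Rightarrow> 'i \<Rightarrow> real). (\<And>j. j \<in> J \<Longrightarrow> (\<Sum>i<m. \<bar>a i j\<bar>) \<le> 1) \<Longrightarrow>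
      (\<Sum>i<m. norm (\<Sum>j\<in>J. a i j *\<^sub>R x j) powr q) \<le> D"
  obtains \<mu> :: "'i \<Rightarrow> real" where "\<And>j. j \<in> J \<Longrightarrow> \<mu> j > 0" "sum \<mu> J \<le> q * D + 1"
    "\<And>f A. A \<subseteq> J \<Longrightarrow> (\<And>j. j \<in> A \<Longrightarrow> \<bar>f j\<bar> \<le> 1) \<Longrightarrow>
      norm (\<Sum>j\<in>A. f j *\<^sub>R x j) powr q \<le> sum \<mu> A"
proof -
  define v where "v f = (\<Sum>j\<in>J. f j *\<^sub>R x j)" for f :: "'i \<Rightarrow> real"
  have v_diff: "v (\<lambda>j. f j - g j) = v f - v g" for f g
    by (simp add: v_def scaleR_diff_left sum_subtractf)
  define adm where "adm = {(m::nat, a::nat \<Rightarrow> 'i \<Rightarrow> real). \<forall>j\<in>J. (\<Sum>i<m. \<bar>a i j\<bar>) \<le> 1}"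
  define S where "S = (\<lambda>(m::nat, a::nat \<Rightarrow> 'i \<Rightarrow> real). \<Sum>i<m. norm (v (a i)) powr q)"
  define T where "T = (SUP z\<in>adm. S z)"
  have S_le: "S z \<le> D" if "z \<in> adm" for z
    using that summing[where m = "fst z" and a = "snd z"] by (auto simp: adm_def S_def v_def split: prod.splits)
  have bdd: "bdd_above (S ` adm)" using S_le by (auto intro!: bdd_aboveI[of _ D])
  have ST: "S z \<le> T" if "z \<in> adm" for z
    unfolding T_def by (rule cSUP_upper[OF that bdd])
  have ne: "(0, \<lambda>_ _. 0) \<in> adm" by (simp add: adm_def)
  have TD: "T \<le> D" unfolding T_def using ne S_le by (intro cSUP_least) auto
  have D0: "D \<ge> 0" using S_le[OF ne] by (simp add: S_def)
  \<comment> \<open>Small enough that \<open>card J\<close> copies add at most 1 to the total mass,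
    while each nonempty block still receives one full \<epsilon>, which pays for the defect in
    \<open>near\<close>.\<close>
  define \<epsilon> where "\<epsilon> = inverse (real (card J) + 1)"
  have \<epsilon>: "\<epsilon> > 0" by (simp add: \<epsilon>_def)
  have "\<exists>z\<in>adm. T - \<epsilon> < S z"
    unfolding T_def using less_cSUP_iff[OF _ bdd, of "T - \<epsilon>"] ne \<epsilon> by (auto simp: T_def)
  then obtain m a where ma: "(m, a) \<in> adm" and near: "T - \<epsilon> < (\<Sum>i<m. norm (v (a i)) powr q)"
    by (auto simp: S_def)
  have "\<forall>i. \<exists>l. linear l \<and> (\<forall>y. \<bar>l y\<bar> \<le> norm y) \<and> l (v (a i)) = norm (v (a i))"
    by (metis norming_functional_real)
  then obtain l where l: "\<And>i. linear (l i)" "\<And>i y. \<bar>l i y\<bar> \<le> norm y"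
    "\<And>i. l i (v (a i)) = norm (v (a i))" by metis
  define c where "c i = norm (v (a i)) powr (q - 1)" for i
  have c0: "c i \<ge> 0" for i by (simp add: c_def)
  \<comment> \<open>Up to the factor q this is the first-order loss in the extremal sum when
    coordinate j of every \<open>a i\<close> is scaled down: \<open>c i\<close> comes from
    differentiating t^q, and \<open>l i\<close> stands for the derivative of the norm at
    \<open>v (a i)\<close>.\<close>
  define \<nu> where "\<nu> j = (\<Sum>i<m. c i * (a i j * l i (x j)))" for j
  have \<nu>: "(\<Sum>j\<in>J. g j * \<nu> j) = (\<Sum>i<m. c i * l i (v (\<lambda>j. a i j * g j)))" for g
  proof -
    have "(\<Sum>j\<in>J. g j * \<nu> j) = (\<Sum>i<m. \<Sum>j\<in>J. c i * ((a i j * g j) * l i (x j)))"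
      unfolding \<nu>_def sum_distrib_left by (subst sum.swap) (simp add: mult_ac)
    also have "\<dots> = (\<Sum>i<m. c i * l i (v (\<lambda>j. a i j * g j)))"
      using l(1) by (simp add: v_def linear_sum linear_scale sum_distrib_left)
    finally show ?thesis .
  qed
  have key: "norm (v f) powr q \<le> \<epsilon> + q * (\<Sum>j\<in>J. \<bar>f j\<bar> * \<nu> j)" if f: "\<And>j. j \<in> J \<Longrightarrow> \<bar>f j\<bar> \<le> 1" for f
  proof -
    \<comment> \<open>At coordinate j the new total is at most (1 - |f j|) + |f j|, so the enlarged
      system is again admissible.\<close>
    define b where "b i = (if i < m then (\<lambda>j. a i j - a i j * \<bar>f j\<bar>) else f)" for i
    have "(Suc m, b) \<in> adm"
    proof -
      have "(\<Sum>i<Suc m. \<bar>b i j\<bar>) \<le> 1" if j: "j \<in> J" for j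
      proof -
        have "(\<Sum>i<Suc m. \<bar>b i j\<bar>) = (\<Sum>i<m. \<bar>a i j\<bar> * (1 - \<bar>f j\<bar>)) + \<bar>f j\<bar>"
        proof -
          have "\<bar>a i j - a i j * \<bar>f j\<bar>\<bar> = \<bar>a i j\<bar> * (1 - \<bar>f j\<bar>)" for i
          proof -
            have "a i j - a i j * \<bar>f j\<bar> = a i j * (1 - \<bar>f j\<bar>)" by (simp add: algebra_simps)
            then show ?thesis using f[OF j] by (simp add: abs_mult)
          qed
          then show ?thesis by (simp add: b_def)
        qed
        also have "\<dots> = (\<Sum>i<m. \<bar>a i j\<bar>) * (1 - \<bar>f j\<bar>) + \<bar>f j\<bar>" by (simp add: sum_distrib_right)
        also have "\<dots> \<le> 1 * (1 - \<bar>f j\<bar>) + \<bar>f j\<bar>"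
          using ma j f[OF j] by (intro add_right_mono mult_right_mono) (auto simp: adm_def)
        finally show ?thesis by simp
      qed
      then show ?thesis by (simp add: adm_def)
    qed
    from ST[OF this] have "(\<Sum>i<m. norm (v (b i)) powr q) + norm (v f) powr q \<le> T"
      by (simp add: S_def b_def)
    moreover have "norm (v (a i)) powr q - q * (c i * l i (v (\<lambda>j. a i j * \<bar>f j\<bar>))) \<le> norm (v (b i)) powr q"
      if "i < m" for i
    proof -
      define B where "B = norm (v (a i))"
      define w where "w = norm (v (b i))"
      have "v (b i) = v (a i) - v (\<lambda>j. a i j * \<bar>f j\<bar>)" using that by (simp add: b_def v_diff)
      then have "B - l i (v (\<lambda>j. a i j * \<bar>f j\<bar>)) \<le> w"
        using l(2)[of i "v (b i)"] l(3)[of i] l(1)[of i] by (simp add: B_def w_def linear_diff)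
      then have "c i * B - c i * l i (v (\<lambda>j. a i j * \<bar>f j\<bar>)) \<le> c i * w"
        using mult_left_mono[OF _ c0[of i]] by (fastforce simp: right_diff_distrib)
      moreover have "c i * B = B powr q"
        using q powr_add[of B "q - 1" 1] by (auto simp: c_def B_def)
      ultimately have "q * (B powr q - c i * l i (v (\<lambda>j. a i j * \<bar>f j\<bar>))) \<le> q * (c i * w)"
        using q by simp
      also have "\<dots> \<le> (q - 1) * B powr q + w powr q"
        using powr_tangent_le[of q B w] q by (simp add: c_def B_def w_def)
      finally show ?thesis by (simp add: B_def w_def algebra_simps)
    qed
    then have "(\<Sum>i<m. norm (v (a i)) powr q - q * (c i * l i (v (\<lambda>j. a i j * \<bar>f j\<bar>))))
        \<le> (\<Sum>i<m. norm (v (b i)) powr q)"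
      by (intro sum_mono) auto
    ultimately show ?thesis
      using near unfolding \<nu> by (simp add: sum_subtractf sum_distrib_left)
  qed
  \<comment> \<open>Inserting the signs of \<nu> keeps the system admissible; the tangent inequality
    then bounds q times the total variation of \<nu> by (q - 1) D + D.\<close>
  have tot: "(\<Sum>j\<in>J. \<bar>\<nu> j\<bar>) \<le> D"
  proof -
    define g where "g j = sgn (\<nu> j)" for j
    have g: "\<bar>g j\<bar> \<le> 1" for j by (simp add: g_def abs_sgn_eq)
    have ag: "(m, \<lambda>i j. a i j * g j) \<in> adm"
    proof -
      have "(\<Sum>i<m. \<bar>a i j * g j\<bar>) \<le> 1" if "j \<in> J" for j
      proof -
        have "(\<Sum>i<m. \<bar>a i j * g j\<bar>) \<le> (\<Sum>i<m. \<bar>a i j\<bar>)"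
          using g[of j] by (intro sum_mono) (simp add: abs_mult mult_left_le)
        also have "\<dots> \<le> 1" using ma that by (simp add: adm_def)
        finally show ?thesis .
      qed
      then show ?thesis by (simp add: adm_def)
    qed
    have "(\<Sum>j\<in>J. \<bar>\<nu> j\<bar>) = (\<Sum>j\<in>J. g j * \<nu> j)" by (simp add: g_def abs_sgn mult.commute)
    also have "\<dots> = (\<Sum>i<m. c i * l i (v (\<lambda>j. a i j * g j)))" by (rule \<nu>)
    also have "\<dots> \<le> (\<Sum>i<m. c i * norm (v (\<lambda>j. a i j * g j)))"
      using l(2) c0 by (intro sum_mono mult_left_mono) (auto simp: abs_le_iff)
    finally have "q * (\<Sum>j\<in>J. \<bar>\<nu> j\<bar>) \<le> q * (\<Sum>i<m. c i * norm (v (\<lambda>j. a i j * g j)))"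
      using q by (intro mult_left_mono) auto
    also have "\<dots> = (\<Sum>i<m. q * (c i * norm (v (\<lambda>j. a i j * g j))))" by (rule sum_distrib_left)
    also have "\<dots> \<le> (\<Sum>i<m. (q - 1) * norm (v (a i)) powr q + norm (v (\<lambda>j. a i j * g j)) powr q)"
      unfolding c_def using q by (intro sum_mono powr_tangent_le) auto
    also have "\<dots> = (q - 1) * S (m, a) + S (m, \<lambda>i j. a i j * g j)"
      by (simp add: S_def sum.distrib sum_distrib_left)
    also have "\<dots> \<le> (q - 1) * D + D"
      using q S_le[OF ma] S_le[OF ag] by (intro add_mono mult_left_mono) auto
    finally have "q * (\<Sum>j\<in>J. \<bar>\<nu> j\<bar>) \<le> q * D" by (simp add: algebra_simps)
    then show ?thesis using q by simp
  qed
  show ?thesis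
  \<comment> \<open>The absolute value and \<epsilon> make all weights strictly positive, so that
    one can later divide by powers of them.\<close>
  proof (rule that[of "\<lambda>j. q * \<bar>\<nu> j\<bar> + \<epsilon>"])
    show "q * \<bar>\<nu> j\<bar> + \<epsilon> > 0" for j using q \<epsilon> by (simp add: add_nonneg_pos)
    have "real (card J) * \<epsilon> \<le> 1" by (simp add: \<epsilon>_def field_simps)
    then show "(\<Sum>j\<in>J. q * \<bar>\<nu> j\<bar> + \<epsilon>) \<le> q * D + 1"
      using tot q by (simp add: sum.distrib sum_distrib_left[symmetric] add_mono)
    fix f :: "'i \<Rightarrow> real" and A assume A: "A \<subseteq> J" and f: "\<And>j. j \<in> A \<Longrightarrow> \<bar>f j\<bar> \<le> 1"
    have fin: "finite A" using A J by (rule finite_subset)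
    show "norm (\<Sum>j\<in>A. f j *\<^sub>R x j) powr q \<le> (\<Sum>j\<in>A. q * \<bar>\<nu> j\<bar> + \<epsilon>)"
    proof (cases "A = {}")
      case False
      define h where "h j = (if j \<in> A then f j else 0)" for j
      have "v h = (\<Sum>j\<in>J. if j \<in> A then f j *\<^sub>R x j else 0)"
        unfolding v_def h_def by (intro sum.cong) auto
      also have "\<dots> = (\<Sum>j\<in>A. f j *\<^sub>R x j)"
        using A J by (simp add: sum.inter_restrict[symmetric] Int_absorb1)
      finally have vh: "v h = (\<Sum>j\<in>A. f j *\<^sub>R x j)" .
      have "(\<Sum>j\<in>J. \<bar>h j\<bar> * \<nu> j) = (\<Sum>j\<in>J. if j \<in> A then \<bar>f j\<bar> * \<nu> j else 0)"
        unfolding h_def by (intro sum.cong) auto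
      also have "\<dots> = (\<Sum>j\<in>A. \<bar>f j\<bar> * \<nu> j)"
        using A J by (simp add: sum.inter_restrict[symmetric] Int_absorb1)
      also have "\<dots> \<le> (\<Sum>j\<in>A. \<bar>\<nu> j\<bar>)"
      proof (rule sum_mono)
        fix j assume "j \<in> A"
        have "\<bar>f j\<bar> * \<nu> j \<le> \<bar>f j\<bar> * \<bar>\<nu> j\<bar>" by (simp add: mult_left_mono)
        also have "\<dots> \<le> 1 * \<bar>\<nu> j\<bar>" using f[OF \<open>j \<in> A\<close>] by (intro mult_right_mono) auto
        finally show "\<bar>f j\<bar> * \<nu> j \<le> \<bar>\<nu> j\<bar>" by simp
      qed
      finally have "q * (\<Sum>j\<in>J. \<bar>h j\<bar> * \<nu> j) \<le> q * (\<Sum>j\<in>A. \<bar>\<nu> j\<bar>)" using q by simp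
      moreover have "\<epsilon> \<le> real (card A) * \<epsilon>"
        using False fin \<epsilon> by (simp add: card_gt_0_iff Suc_leI)
      moreover have "norm (v h) powr q \<le> \<epsilon> + q * (\<Sum>j\<in>J. \<bar>h j\<bar> * \<nu> j)"
        using f by (intro key) (auto simp: h_def)
      ultimately show ?thesis by (simp add: vh sum.distrib sum_distrib_left)
    qed simp
  qed
qed

text \<open>The contributions of the dyadic blocks of \<open>a\<close> are dominated by a geometric series since \<open>s > q\<close>.\<close>

lemma lorentz_to_Ls:
  fixes x :: "'i \<Rightarrow> 'a::real_normed_vector" and q s L :: real
  assumes J: "finite J" and q: "0 < q" "q < s"
    and \<mu>: "\<And>j. j \<in> J \<Longrightarrow> \<mu> j > 0" "sum \<mu> J \<le> L"
    and block: "\<And>f A. A \<subseteq> J \<Longrightarrow> (\<And>j. j \<in> A \<Longrightarrow> \<bar>f j\<bar> \<le> 1) \<Longrightarrow>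
      norm (\<Sum>j\<in>A. f j *\<^sub>R x j) powr q \<le> sum \<mu> A"
    and a: "(\<Sum>j\<in>J. \<mu> j * \<bar>a j\<bar> powr s) \<le> 1"
  shows "norm (\<Sum>j\<in>J. a j *\<^sub>R x j) \<le> L powr (1 / q) + 2 / (1 - 2 powr (1 - s / q))"
proof -
  define \<rho> :: real where "\<rho> = 2 powr (1 - s / q)"
  have \<rho>: "0 < \<rho>" "\<rho> < 1"
    using q by (auto simp: \<rho>_def intro: powr_less_one)
  have block': "norm (\<Sum>j\<in>A. f j *\<^sub>R x j) \<le> (sum \<mu> A) powr (1 / q)"
    if "A \<subseteq> J" "\<And>j. j \<in> A \<Longrightarrow> \<bar>f j\<bar> \<le> 1" for f A
  proof -
    have "(norm (\<Sum>j\<in>A. f j *\<^sub>R x j) powr q) powr (1 / q) \<le> (sum \<mu> A) powr (1 / q)"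
      using block[OF that] q by (intro powr_mono2) auto
    then show ?thesis using q by (simp add: powr_powr)
  qed
  \<comment> \<open>Induction on M peels off the set where |a| exceeds half of its current bound;
    the base case |a| \<le> 1 contributes \<open>L powr (1 / q)\<close>.\<close>
  have ind: "norm (\<Sum>j\<in>A. a j *\<^sub>R x j) \<le> L powr (1 / q) + (\<Sum>m<M. 2 * \<rho> ^ m)"
    if "A \<subseteq> J" "\<And>j. j \<in> A \<Longrightarrow> \<bar>a j\<bar> \<le> 2 ^ M" for A M
    using that
  proof (induction M arbitrary: A)
    case 0
    have "norm (\<Sum>j\<in>A. a j *\<^sub>R x j) \<le> (sum \<mu> A) powr (1 / q)" using 0 by (intro block') auto
    also have "\<dots> \<le> L powr (1 / q)"
    proof (rule powr_mono2)
      have "sum \<mu> A \<le> sum \<mu> J" using 0 J \<mu>(1) by (intro sum_mono2) (auto intro: less_imp_le)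
      then show "sum \<mu> A \<le> L" using \<mu>(2) by simp
      show "0 \<le> sum \<mu> A" using 0 \<mu>(1) by (intro sum_nonneg) (auto intro: less_imp_le)
    qed (use q in auto)
    finally show ?case by simp
  next
    case (Suc M)
    define H where "H = {j\<in>A. \<bar>a j\<bar> > 2 ^ M}"
    have finA: "finite A" using Suc.prems(1) J by (rule finite_subset)
    have HJ: "H \<subseteq> J" using Suc.prems(1) by (auto simp: H_def)
    have "(\<Sum>j\<in>A. a j *\<^sub>R x j) = (\<Sum>j\<in>H. a j *\<^sub>R x j) + (\<Sum>j\<in>A - H. a j *\<^sub>R x j)"
      using finA by (subst sum.subset_diff[of H]) (auto simp: H_def)
    then have "norm (\<Sum>j\<in>A. a j *\<^sub>R x j) \<le> norm (\<Sum>j\<in>H. a j *\<^sub>R x j) + norm (\<Sum>j\<in>A - H. a j *\<^sub>R x j)"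
      by (simp add: norm_triangle_ineq)
    also have "norm (\<Sum>j\<in>A - H. a j *\<^sub>R x j) \<le> L powr (1 / q) + (\<Sum>m<M. 2 * \<rho> ^ m)"
      using Suc.prems by (intro Suc.IH) (auto simp: H_def not_less)
    also have "norm (\<Sum>j\<in>H. a j *\<^sub>R x j) \<le> 2 * \<rho> ^ M"
    proof -
      \<comment> \<open>Chebyshev's inequality for the top level set. Its mass is at most 2^(-M s),
        so the block contributes at most 2^(M+1) 2^(-M s/q), that is, 2 \<rho>^M.\<close>
      have "(\<Sum>j\<in>H. \<mu> j) * 2 powr (real M * s) \<le> (\<Sum>j\<in>H. \<mu> j * \<bar>a j\<bar> powr s)"
        unfolding sum_distrib_right
      proof (intro sum_mono mult_left_mono)
        fix j assume j: "j \<in> H"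
        have "2 powr (real M * s) = (2 ^ M) powr s" by (simp add: powr_realpow[symmetric] powr_powr)
        also have "\<dots> \<le> \<bar>a j\<bar> powr s" using j q by (intro powr_mono2) (auto simp: H_def)
        finally show "2 powr (real M * s) \<le> \<bar>a j\<bar> powr s" .
        show "\<mu> j \<ge> 0" using \<mu>(1) j HJ by (auto intro: less_imp_le)
      qed
      also have "\<dots> \<le> (\<Sum>j\<in>J. \<mu> j * \<bar>a j\<bar> powr s)"
        using HJ J \<mu>(1) by (intro sum_mono2) (auto intro!: mult_nonneg_nonneg intro: less_imp_le)
      also have "\<dots> \<le> 1" by (rule a)
      finally have "sum \<mu> H \<le> 2 powr (- (real M * s))"
        by (simp add: powr_minus field_simps)
      then have "(sum \<mu> H) powr (1 / q) \<le> (2 powr (- (real M * s))) powr (1 / q)"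
        using q HJ \<mu>(1) by (intro powr_mono2 sum_nonneg) (auto intro: less_imp_le)
      also have "\<dots> = 2 powr (- (real M * s / q))" by (simp add: powr_powr)
      finally have le: "(sum \<mu> H) powr (1 / q) \<le> 2 powr (- (real M * s / q))" .
      have "(\<Sum>j\<in>H. a j *\<^sub>R x j) = 2 ^ Suc M *\<^sub>R (\<Sum>j\<in>H. (a j / 2 ^ Suc M) *\<^sub>R x j)"
        by (simp add: scaleR_sum_right)
      then have "norm (\<Sum>j\<in>H. a j *\<^sub>R x j) = 2 ^ Suc M * norm (\<Sum>j\<in>H. (a j / 2 ^ Suc M) *\<^sub>R x j)"
        by simp
      also have "\<dots> \<le> 2 ^ Suc M * (sum \<mu> H) powr (1 / q)"
        using HJ Suc.prems(2) by (intro mult_left_mono block') (auto simp: H_def)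
      also have "\<dots> \<le> 2 ^ Suc M * 2 powr (- (real M * s / q))" using le by simp
      also have "\<dots> = 2 * (2 powr real M * 2 powr (- (real M * s / q)))" by (simp add: powr_realpow)
      also have "\<dots> = 2 * 2 powr (real M * (1 - s / q))"
        by (simp add: powr_add[symmetric] algebra_simps)
      also have "\<dots> = 2 * \<rho> ^ M"
        by (simp add: \<rho>_def powr_realpow[symmetric] powr_powr mult.commute)
      finally show ?thesis .
    qed
    finally show ?case by simp
  qed
  obtain M :: nat where M: "\<And>j. j \<in> J \<Longrightarrow> \<bar>a j\<bar> \<le> 2 ^ M"
  proof -
    obtain M where "Max (insert 0 ((\<lambda>j. \<bar>a j\<bar>) ` J)) < 2 ^ M"
      using real_arch_pow[of 2] by auto
    then have "\<And>j. j \<in> J \<Longrightarrow> \<bar>a j\<bar> \<le> 2 ^ M" using J by (simp add: Max_less_iff less_imp_le)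
    then show ?thesis by (rule that)
  qed
  have "(\<Sum>m<M. 2 * \<rho> ^ m) = 2 * ((1 - \<rho> ^ M) / (1 - \<rho>))"
    using \<rho> by (simp add: sum_distrib_left[symmetric] sum_gp_strict)
  also have "\<dots> \<le> 2 / (1 - \<rho>)" using \<rho> by (simp add: divide_right_mono)
  finally show ?thesis using ind[of J M] M unfolding \<rho>_def by fastforce
qed

text \<open>Duality of L_s and L_r: composing \<psi> with the operator gives a functional on
  L_s(\<mu>) with density \<psi> (x j) / \<mu> j. Since r / s = r - 1, dividing \<open>x j\<close>
  by \<open>\<mu> j powr (1 / s)\<close> turns the L_r(\<mu>) norm of this density into an
  unweighted r-sum.\<close>

lemma Ls_bound_dual:
  fixes x :: "'i \<Rightarrow> 'a::real_normed_vector" and r s C :: real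
  assumes J: "finite J" and rs: "r > 1" "s > 1" "1 / r + 1 / s = 1" and C: "C \<ge> 0"
    and \<mu>: "\<And>j. j \<in> J \<Longrightarrow> \<mu> j > 0"
    and bound: "\<And>a. (\<Sum>j\<in>J. \<mu> j * \<bar>a j\<bar> powr s) \<le> 1 \<Longrightarrow> norm (\<Sum>j\<in>J. a j *\<^sub>R x j) \<le> C"
    and \<psi>: "linear \<psi>" "\<And>y. \<bar>\<psi> y\<bar> \<le> norm y"
  shows "(\<Sum>j\<in>J. \<bar>\<psi> (\<mu> j powr (- 1 / s) *\<^sub>R x j)\<bar> powr r) \<le> C powr r"
proof -
  define y where "y j = \<psi> (\<mu> j powr (- 1 / s) *\<^sub>R x j)" for j
  define T where "T = (\<Sum>j\<in>J. \<bar>y j\<bar> powr r)"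
  have "T \<ge> 0" by (auto simp: T_def intro: sum_nonneg)
  have srr: "(r - 1) * s = r" using rs by (auto simp: field_simps)
  show ?thesis
  proof (cases "T = 0")
    case True
    then show ?thesis by (simp add: T_def y_def)
  next
    case False
    with \<open>T \<ge> 0\<close> have T: "T > 0" by simp
    \<comment> \<open>The extremal function for Hoelder's inequality; the power of T normalizes it
      to norm 1 in L_s(\<mu>).\<close>
    define a where "a j = sgn (y j) * \<bar>y j\<bar> powr (r - 1) * \<mu> j powr (- 1 / s) * T powr (- 1 / s)" for j
    have "\<mu> j * \<bar>a j\<bar> powr s = \<bar>y j\<bar> powr r / T" if "j \<in> J" for j
    proof (cases "y j = 0")
      case False
      have "\<bar>a j\<bar> = \<bar>y j\<bar> powr (r - 1) * \<mu> j powr (- 1 / s) * T powr (- 1 / s)"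
        using False by (simp add: a_def abs_mult abs_sgn_eq)
      then have "\<bar>a j\<bar> powr s = (\<bar>y j\<bar> powr (r - 1)) powr s * (\<mu> j powr (- 1 / s)) powr s * (T powr (- 1 / s)) powr s"
        by (simp add: powr_mult)
      also have "\<dots> = \<bar>y j\<bar> powr r * (1 / \<mu> j) * (1 / T)"
      proof -
        have "(t powr (- 1 / s)) powr s = 1 / t" if "t > 0" for t
        proof -
          have "(t powr (- 1 / s)) powr s = t powr (- 1)"
            unfolding powr_powr using rs by (intro arg_cong2[where f = "(powr)"]) auto
          then show ?thesis using that by (simp add: powr_minus_divide)
        qed
        moreover have "(\<bar>y j\<bar> powr (r - 1)) powr s = \<bar>y j\<bar> powr r"
          by (simp only: powr_powr srr)
        ultimately show ?thesis using \<mu>[OF that] T by (simp only:)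
      qed
      finally show ?thesis using \<mu>[OF that] by simp
    qed (simp add: a_def)
    then have "(\<Sum>j\<in>J. \<mu> j * \<bar>a j\<bar> powr s) = 1"
      using T by (simp add: sum_divide_distrib[symmetric] T_def[symmetric])
    then have "norm (\<Sum>j\<in>J. a j *\<^sub>R x j) \<le> C" by (intro bound) simp
    then have "\<psi> (\<Sum>j\<in>J. a j *\<^sub>R x j) \<le> C" using \<psi>(2)[of "\<Sum>j\<in>J. a j *\<^sub>R x j"] by simp
    moreover have "\<psi> (\<Sum>j\<in>J. a j *\<^sub>R x j) = (\<Sum>j\<in>J. \<bar>y j\<bar> powr r * T powr (- 1 / s))"
    proof -
      have "a j * \<psi> (x j) = \<bar>y j\<bar> powr r * T powr (- 1 / s)" if "j \<in> J" for j
      proof (cases "y j = 0")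
        case False
        have "a j * \<psi> (x j) = (sgn (y j) * y j) * \<bar>y j\<bar> powr (r - 1) * T powr (- 1 / s)"
          using \<psi>(1) by (simp add: a_def y_def linear_scale)
        also have "sgn (y j) * y j = \<bar>y j\<bar> powr 1" using False by (simp add: sgn_if)
        also have "\<bar>y j\<bar> powr 1 * \<bar>y j\<bar> powr (r - 1) = \<bar>y j\<bar> powr r"
          by (simp only: powr_add[symmetric]) simp
        finally show ?thesis .
      qed (simp add: a_def)
      then show ?thesis using \<psi>(1) by (simp add: linear_sum linear_scale)
    qed
    moreover have "(\<Sum>j\<in>J. \<bar>y j\<bar> powr r * T powr (- 1 / s)) = T powr (1 / r)"
    proof -
      have "(\<Sum>j\<in>J. \<bar>y j\<bar> powr r * T powr (- 1 / s)) = T powr 1 * T powr (- 1 / s)"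
        using T by (simp add: T_def sum_distrib_right)
      also have "\<dots> = T powr (1 + - 1 / s)" by (rule powr_add[symmetric])
      also have "1 + - 1 / s = 1 / r" using rs(3) by simp
      finally show ?thesis .
    qed
    ultimately have "T powr (1 / r) \<le> C" by simp
    then have "(T powr (1 / r)) powr r \<le> C powr r" using rs by (intro powr_mono2) auto
    then show ?thesis using T rs by (simp add: powr_powr T_def y_def)
  qed
qed

text \<open>If the |a i| sum to at most 1 at each coordinate, every signed sum of the
  \<open>a i\<close> has sup norm at most 1. Its image then has norm at most 1 for each t, and so
  the Rademacher average in the cotype inequality is at most 1.\<close>

lemma cotype_summing:
  fixes x :: "nat \<Rightarrow> 'a::banach" and q C :: real and a :: "nat \<Rightarrow> nat \<Rightarrow> real"
  assumes q: "q > 0" and C: "C \<ge> 0"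
    and cotype: "\<And>(k::nat) (x::nat \<Rightarrow> 'a).
      (\<Sum>j=1..k. norm (x j) powr q) powr (1 / q) \<le>
      C * sqrt (LINT t:{0..1}|lborel. (norm (\<Sum>j=1..k. rademacher j t *\<^sub>R x j))\<^sup>2)"
    and bound: "\<And>f. (\<And>j. j \<in> J \<Longrightarrow> \<bar>f j\<bar> \<le> 1) \<Longrightarrow> norm (\<Sum>j\<in>J. f j *\<^sub>R x j) \<le> 1"
    and a: "\<And>j. j \<in> J \<Longrightarrow> (\<Sum>i<m. \<bar>a i j\<bar>) \<le> 1"
  shows "(\<Sum>i<m. norm (\<Sum>j\<in>J. a i j *\<^sub>R x j) powr q) \<le> C powr q"
proof -
  define v where "v f = (\<Sum>j\<in>J. f j *\<^sub>R x j)" for f :: "nat \<Rightarrow> real"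
  \<comment> \<open>The cotype inequality numbers its vectors from 1, the system \<open>a\<close>
    from 0.\<close>
  define z where "z i = v (a (i - 1))" for i
  have le1: "norm (\<Sum>i=1..m. rademacher i t *\<^sub>R z i) \<le> 1" for t
  proof -
    have "(\<Sum>i=1..m. rademacher i t *\<^sub>R z i) = (\<Sum>i<m. rademacher (Suc i) t *\<^sub>R v (a i))"
      by (simp add: sum.atLeast1_atMost_eq z_def)
    also have "\<dots> = v (\<lambda>j. \<Sum>i<m. rademacher (Suc i) t * a i j)"
      by (simp add: v_def scaleR_sum_right scaleR_sum_left sum.swap[of _ J])
    also have "norm \<dots> \<le> 1"
      unfolding v_def
    proof (rule bound)
      fix j assume j: "j \<in> J"
      have "\<bar>\<Sum>i<m. rademacher (Suc i) t * a i j\<bar> \<le> (\<Sum>i<m. \<bar>rademacher (Suc i) t * a i j\<bar>)" by (rule sum_abs)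
      also have "\<dots> \<le> (\<Sum>i<m. \<bar>a i j\<bar>)"
        by (intro sum_mono) (auto simp: abs_mult rademacher_def abs_sgn_eq)
      also have "\<dots> \<le> 1" by (rule a[OF j])
      finally show "\<bar>\<Sum>i<m. rademacher (Suc i) t * a i j\<bar> \<le> 1" .
    qed
    finally show ?thesis .
  qed
  have "(LINT t:{0..1}|lborel. (norm (\<Sum>i=1..m. rademacher i t *\<^sub>R z i))\<^sup>2) \<le> (LINT t:{0..1::real}|lborel. 1)"
    unfolding set_lebesgue_integral_def
  \<comment> \<open>Integrability is asked of the upper function: a non-integrable integrand has
    integral 0 by convention, which a nonnegative bound also dominates.\<close>
  proof (rule integral_mono')
    show "integrable lborel (\<lambda>t. indicator {0..1::real} t *\<^sub>R (1::real))" by simp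
    show "indicator {0..1} t *\<^sub>R (norm (\<Sum>i=1..m. rademacher i t *\<^sub>R z i))\<^sup>2 \<le> indicator {0..1::real} t *\<^sub>R (1::real)" for t
      using le1[of t] by (auto simp: indicator_def power_le_one)
    show "0 \<le> indicator {0..1::real} t *\<^sub>R (1::real)" for t by simp
  qed
  also have "\<dots> = 1" by (simp add: set_lebesgue_integral_def)
  finally have "sqrt (LINT t:{0..1}|lborel. (norm (\<Sum>i=1..m. rademacher i t *\<^sub>R z i))\<^sup>2) \<le> 1" by simp
  then have "(\<Sum>i=1..m. norm (z i) powr q) powr (1 / q) \<le> C * 1"
    by (intro order_trans[OF cotype] mult_left_mono C)
  then have "((\<Sum>i=1..m. norm (z i) powr q) powr (1 / q)) powr q \<le> C powr q"
    using q by (intro powr_mono2) auto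
  then show ?thesis
    using q by (simp add: powr_powr sum_nonneg sum.atLeast1_atMost_eq z_def v_def)
qed

context banach_over
begin

text \<open>The duality estimate concerns real functionals, so \<phi> is split into real and
  imaginary parts, both real-linear contractions. The factor \<open>2 powr r\<close> comes from t +
  u \<le> 2 max(t, u), the other 2 from the two parts.\<close>

lemma dual_ball_sum_powr_le:
  assumes r: "r > 1" and C: "C \<ge> 0"
    and real: "\<And>\<psi>. linear \<psi> \<Longrightarrow> (\<And>y. \<bar>\<psi> y\<bar> \<le> norm y) \<Longrightarrow> (\<Sum>j\<in>J. \<bar>\<psi> (y j)\<bar> powr r) \<le> C"
    and \<phi>: "\<phi> \<in> dual_ball sE"
  shows "(\<Sum>j\<in>J. norm (\<phi> (y j)) powr r) \<le> 2 powr r * (2 * C)"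
proof -
  define \<alpha> where "\<alpha> x = Re (to_complex (\<phi> x))" for x
  define \<beta> where "\<beta> x = Im (to_complex (\<phi> x))" for x
  have lin: "linear \<phi>" using dual_ball_bounded_linear[OF \<phi>] by (rule bounded_linear.linear)
  have "linear \<alpha>" "linear \<beta>"
    using lin by (auto intro!: linearI simp: \<alpha>_def \<beta>_def linear_add linear_scale to_complex_add to_complex_scaleR)
  moreover have "\<bar>\<alpha> x\<bar> \<le> norm x" "\<bar>\<beta> x\<bar> \<le> norm x" for x
    using abs_Re_le_cmod[of "to_complex (\<phi> x)"] abs_Im_le_cmod[of "to_complex (\<phi> x)"]
      dual_ball_norm_le[OF \<phi>, of x] by (auto simp: \<alpha>_def \<beta>_def norm_to_complex)
  ultimately have le: "(\<Sum>j\<in>J. \<bar>\<alpha> (y j)\<bar> powr r) \<le> C" "(\<Sum>j\<in>J. \<bar>\<beta> (y j)\<bar> powr r) \<le> C"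
    by (auto intro!: real)
  have "norm (\<phi> x) powr r \<le> 2 powr r * (\<bar>\<alpha> x\<bar> powr r + \<bar>\<beta> x\<bar> powr r)" for x
  proof -
    have "norm (\<phi> x) \<le> \<bar>\<alpha> x\<bar> + \<bar>\<beta> x\<bar>"
      using cmod_le[of "to_complex (\<phi> x)"] by (simp add: \<alpha>_def \<beta>_def norm_to_complex)
    also have "\<dots> \<le> 2 * max \<bar>\<alpha> x\<bar> \<bar>\<beta> x\<bar>" by simp
    finally have "norm (\<phi> x) powr r \<le> (2 * max \<bar>\<alpha> x\<bar> \<bar>\<beta> x\<bar>) powr r"
      using r by (intro powr_mono2) auto
    also have "\<dots> = 2 powr r * (max \<bar>\<alpha> x\<bar> \<bar>\<beta> x\<bar>) powr r" by (simp add: powr_mult)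
    also have "\<dots> \<le> 2 powr r * (\<bar>\<alpha> x\<bar> powr r + \<bar>\<beta> x\<bar> powr r)"
      by (intro mult_left_mono) (auto simp: max_def)
    finally show ?thesis .
  qed
  then have "(\<Sum>j\<in>J. norm (\<phi> (y j)) powr r) \<le> (\<Sum>j\<in>J. 2 powr r * (\<bar>\<alpha> (y j)\<bar> powr r + \<bar>\<beta> (y j)\<bar> powr r))"
    by (intro sum_mono)
  also have "\<dots> = 2 powr r * ((\<Sum>j\<in>J. \<bar>\<alpha> (y j)\<bar> powr r) + (\<Sum>j\<in>J. \<bar>\<beta> (y j)\<bar> powr r))"
    by (simp add: sum_distrib_left sum.distrib distrib_left)
  also have "\<dots> \<le> 2 powr r * (2 * C)" using le by (intro mult_left_mono) auto
  finally show ?thesis .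
qed

lemma cotype_weakly_summable_factor:
  assumes cotype: "has_cotype TYPE('a) q" and q: "q > 1"
    and rs: "r > 1" "1 / r + 1 / s = 1" "s > q"
  obtains L M :: real where "L > 0" "M > 0"
    "\<And>(J::nat set) x. finite J \<Longrightarrow> (\<And>\<phi>. \<phi> \<in> dual_ball sE \<Longrightarrow> (\<Sum>j\<in>J. norm (\<phi> (x j))) \<le> 1) \<Longrightarrow>
      \<exists>c y. (\<forall>j\<in>J. c j \<ge> 0 \<and> x j = c j *\<^sub>R y j) \<and> (\<Sum>j\<in>J. c j powr s) \<le> L \<and>
        (\<forall>\<phi>\<in>dual_ball sE. (\<Sum>j\<in>J. norm (\<phi> (y j)) powr r) \<le> M)"
proof -
  obtain C where C: "C \<ge> 0" "\<And>(k::nat) (x::nat \<Rightarrow> 'a).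
      (\<Sum>j=1..k. norm (x j) powr q) powr (1 / q) \<le>
      C * sqrt (LINT t:{0..1}|lborel. (norm (\<Sum>j=1..k. rademacher j t *\<^sub>R x j))\<^sup>2)"
    using cotype unfolding has_cotype_def by blast
  \<comment> \<open>\<open>L\<close> is the mass bound of the weights for the summing constant
    \<open>C powr q\<close>, \<open>B\<close> the resulting bound on L_s(\<mu>), and
    \<open>M\<close> comes from its r-th power by allowing scalar-valued functionals. All three are
    fixed before the family is.\<close>
  define L where "L = q * C powr q + 1"
  define B where "B = L powr (1 / q) + 2 / (1 - 2 powr (1 - s / q))"
  define M where "M = 2 powr r * (2 * B powr r)"
  have L: "L > 0" using q by (simp add: L_def add_nonneg_pos)
  have "(2::real) powr (1 - s / q) < 1" using rs q by (auto intro: powr_less_one)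
  then have B: "B > 0" using L by (simp add: B_def add_pos_pos)
  show ?thesis
  proof (rule that[of L M])
    show "M > 0" using B by (simp add: M_def)
    fix J :: "nat set" and x assume J: "finite J"
      and weak: "\<And>\<phi>. \<phi> \<in> dual_ball sE \<Longrightarrow> (\<Sum>j\<in>J. norm (\<phi> (x j))) \<le> 1"
    \<comment> \<open>A norming functional turns the weak bound 1 into norm at most 1 for the
      operator on bounded functions.\<close>
    have bound: "norm (\<Sum>j\<in>J. f j *\<^sub>R x j) \<le> 1" if f: "\<And>j. j \<in> J \<Longrightarrow> \<bar>f j\<bar> \<le> 1" for f
    proof -
      obtain \<phi> where \<phi>: "\<phi> \<in> dual_ball sE" and eq: "norm (\<phi> (\<Sum>j\<in>J. f j *\<^sub>R x j)) = norm (\<Sum>j\<in>J. f j *\<^sub>R x j)"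
        by (rule dual_ball_norming)
      have lin: "linear \<phi>" using dual_ball_bounded_linear[OF \<phi>] by (rule bounded_linear.linear)
      have "norm (\<phi> (\<Sum>j\<in>J. f j *\<^sub>R x j)) \<le> (\<Sum>j\<in>J. norm (f j *\<^sub>R \<phi> (x j)))"
        using lin by (simp add: linear_sum linear_scale sum_norm_le)
      also have "\<dots> \<le> (\<Sum>j\<in>J. norm (\<phi> (x j)))"
        using f by (intro sum_mono) (simp add: mult_left_le_one_le)
      also have "\<dots> \<le> 1" by (rule weak[OF \<phi>])
      finally show ?thesis by (simp add: eq)
    qed
    have summing: "(\<Sum>i<m. norm (\<Sum>j\<in>J. a i j *\<^sub>R x j) powr q) \<le> C powr q"
      if "\<And>j. j \<in> J \<Longrightarrow> (\<Sum>i<m. \<bar>a i j\<bar>) \<le> 1" for m :: nat and a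
      using q that bound by (intro cotype_summing[OF _ C]) auto
    obtain \<mu> where \<mu>: "\<And>j. j \<in> J \<Longrightarrow> \<mu> j > 0" "sum \<mu> J \<le> L"
      and block: "\<And>f A. A \<subseteq> J \<Longrightarrow> (\<And>j. j \<in> A \<Longrightarrow> \<bar>f j\<bar> \<le> 1) \<Longrightarrow>
        norm (\<Sum>j\<in>A. f j *\<^sub>R x j) powr q \<le> sum \<mu> A"
      using pisier_weights[OF J q summing] unfolding L_def by blast
    have Ls: "norm (\<Sum>j\<in>J. a j *\<^sub>R x j) \<le> B" if "(\<Sum>j\<in>J. \<mu> j * \<bar>a j\<bar> powr s) \<le> 1" for a
      unfolding B_def using q rs \<mu> block that J by (intro lorentz_to_Ls) auto
    define y where "y j = \<mu> j powr (- 1 / s) *\<^sub>R x j" for j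
    show "\<exists>c y. (\<forall>j\<in>J. c j \<ge> 0 \<and> x j = c j *\<^sub>R y j) \<and> (\<Sum>j\<in>J. c j powr s) \<le> L \<and>
        (\<forall>\<phi>\<in>dual_ball sE. (\<Sum>j\<in>J. norm (\<phi> (y j)) powr r) \<le> M)"
    proof (intro exI[of _ "\<lambda>j. \<mu> j powr (1 / s)"] exI[of _ y] conjI ballI)
      fix j assume j: "j \<in> J"
      have "\<mu> j powr (1 / s) * \<mu> j powr (- 1 / s) = 1"
        using \<mu>(1)[OF j] by (simp add: powr_add[symmetric])
      then show "x j = \<mu> j powr (1 / s) *\<^sub>R y j" by (simp add: y_def)
    next
      have "(\<Sum>j\<in>J. (\<mu> j powr (1 / s)) powr s) = sum \<mu> J"
        using \<mu>(1) rs q by (intro sum.cong) (auto simp: powr_powr less_imp_le)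
      then show "(\<Sum>j\<in>J. (\<mu> j powr (1 / s)) powr s) \<le> L" using \<mu>(2) by simp
    next
      fix \<phi> assume \<phi>: "\<phi> \<in> dual_ball sE"
      show "(\<Sum>j\<in>J. norm (\<phi> (y j)) powr r) \<le> M"
        unfolding M_def
      proof (rule dual_ball_sum_powr_le[OF rs(1) _ _ \<phi>])
        fix \<psi> :: "'a \<Rightarrow> real" assume "linear \<psi>" "\<And>y. \<bar>\<psi> y\<bar> \<le> norm y"
        then show "(\<Sum>j\<in>J. \<bar>\<psi> (y j)\<bar> powr r) \<le> B powr r"
          unfolding y_def using J rs q B \<mu>(1) Ls by (intro Ls_bound_dual) auto
      qed simp
    qed simp
  qed (rule L)
qed

text \<open>Stated for a positively homogeneous \<open>N\<close>, because it is applied both to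
  norms of operator values and to the integral seminorm of a dominating measure. Weak sums enter
  through an upper bound instead of a supremum.\<close>

lemma cotype_r_summing_imp_summing:
  fixes N :: "'a \<Rightarrow> real"
  assumes cotype: "has_cotype TYPE('a) q" and q: "q > 1"
    and rs: "r > 1" "1 / r + 1 / s = 1" "s > q"
    and N: "\<And>x. N x \<ge> 0" "\<And>c x. c \<ge> 0 \<Longrightarrow> N (c *\<^sub>R x) = c * N x"
    and D: "\<And>(k::nat) y T. (\<And>\<phi>. \<phi> \<in> dual_ball sE \<Longrightarrow> (\<Sum>j=1..k. norm (\<phi> (y j)) powr r) \<le> T) \<Longrightarrow>
      (\<Sum>j=1..k. N (y j) powr r) \<le> D * T"
  shows "\<exists>C\<ge>0. \<forall>(k::nat) x W. (\<forall>\<phi>\<in>dual_ball sE. (\<Sum>j=1..k. norm (\<phi> (x j))) \<le> W) \<longrightarrow>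
    (\<Sum>j=1..k. N (x j)) \<le> C * W"
proof -
  obtain L M where LM: "L > 0" "M > 0" and factor:
    "\<And>(J::nat set) x. finite J \<Longrightarrow> (\<And>\<phi>. \<phi> \<in> dual_ball sE \<Longrightarrow> (\<Sum>j\<in>J. norm (\<phi> (x j))) \<le> 1) \<Longrightarrow>
      \<exists>c y. (\<forall>j\<in>J. c j \<ge> 0 \<and> x j = c j *\<^sub>R y j) \<and> (\<Sum>j\<in>J. c j powr s) \<le> L \<and>
        (\<forall>\<phi>\<in>dual_ball sE. (\<Sum>j\<in>J. norm (\<phi> (y j)) powr r) \<le> M)"
    using cotype_weakly_summable_factor[OF cotype q rs] by metis
  define C where "C = L powr (1 / s) * (D * M) powr (1 / r)"
  have unit: "(\<Sum>j=1..k. N (x j)) \<le> C"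
    if x: "\<And>\<phi>. \<phi> \<in> dual_ball sE \<Longrightarrow> (\<Sum>j=1..k. norm (\<phi> (x j))) \<le> 1" for k :: nat and x
  proof -
    obtain c y where cy: "\<And>j. j \<in> {1..k} \<Longrightarrow> c j \<ge> 0" "\<And>j. j \<in> {1..k} \<Longrightarrow> x j = c j *\<^sub>R y j"
      and c: "(\<Sum>j=1..k. c j powr s) \<le> L"
      and y: "\<And>\<phi>. \<phi> \<in> dual_ball sE \<Longrightarrow> (\<Sum>j=1..k. norm (\<phi> (y j)) powr r) \<le> M"
      using factor[of "{1..k}" x, OF _ x] by (metis finite_atLeastAtMost)
    have "(\<Sum>j=1..k. N (x j)) = (\<Sum>j=1..k. c j * N (y j))"
      using cy N(2) by (intro sum.cong) auto
    also have "\<dots> \<le> (\<Sum>j=1..k. c j powr s) powr (1 / s) * (\<Sum>j=1..k. N (y j) powr r) powr (1 / r)"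
      using rs q cy(1) N(1) by (intro sum_Holder) auto
    also have "\<dots> \<le> C"
      unfolding C_def using c D[OF y] rs q
      by (intro mult_mono powr_mono2) (auto intro: sum_nonneg)
    finally show ?thesis .
  qed
  have "(\<Sum>j=1..k. N (x j)) \<le> C * W"
    if x: "\<And>\<phi>. \<phi> \<in> dual_ball sE \<Longrightarrow> (\<Sum>j=1..k. norm (\<phi> (x j))) \<le> W" for k :: nat and x W
  proof -
    have "0 \<le> W" using x[OF zero_in_dual_ball] by simp
    show ?thesis
    \<comment> \<open>For W > 0 the family is normalized by homogeneity; for W = 0 norming
      functionals force every \<open>x j\<close> to vanish.\<close>
    proof (cases "W = 0")
      case False
      with \<open>0 \<le> W\<close> have W: "W > 0" by simp
      have "(\<Sum>j=1..k. N ((1 / W) *\<^sub>R x j)) \<le> C"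
      proof (rule unit)
        fix \<phi> assume \<phi>: "\<phi> \<in> dual_ball sE"
        have lin: "linear \<phi>" using dual_ball_bounded_linear[OF \<phi>] by (rule bounded_linear.linear)
        have "(\<Sum>j=1..k. norm (\<phi> ((1 / W) *\<^sub>R x j))) = (\<Sum>j=1..k. norm (\<phi> (x j))) / W"
          using lin W by (simp add: linear_scale sum_divide_distrib)
        then show "(\<Sum>j=1..k. norm (\<phi> ((1 / W) *\<^sub>R x j))) \<le> 1"
          using x[OF \<phi>] W by simp
      qed
      moreover have "(\<Sum>j=1..k. N ((1 / W) *\<^sub>R x j)) = (\<Sum>j=1..k. N (x j)) / W"
        using N(2)[of "1 / W"] W by (simp add: sum_divide_distrib)
      ultimately have "(\<Sum>j=1..k. N (x j)) / W \<le> C" by simp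
      then show ?thesis using W by (simp add: field_simps)
    next
      case True
      have "x j = 0" if j: "j \<in> {1..k}" for j
      proof -
        obtain \<phi> where \<phi>: "\<phi> \<in> dual_ball sE" "norm (\<phi> (x j)) = norm (x j)" by (rule dual_ball_norming)
        have "norm (\<phi> (x j)) \<le> (\<Sum>j=1..k. norm (\<phi> (x j)))" using j by (intro member_le_sum) auto
        then have "norm (x j) \<le> W" using x[OF \<phi>(1)] \<phi>(2) by linarith
        then show ?thesis using True by simp
      qed
      moreover have "N 0 = 0" using N(2)[of 0 0] by simp
      ultimately have "(\<Sum>j=1..k. N (x j)) = 0" by (intro sum.neutral) auto
      then show ?thesis using True by simp
    qed
  qed
  moreover have "C \<ge> 0" by (simp add: C_def)
  ultimately show ?thesis by blast
qed

end

section \<open>Riesz representation and Pietsch domination\<close>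

lemma bcontfun_boundedI:
  fixes f :: "'b::topological_space \<Rightarrow> real"
  assumes "continuous_on UNIV f" "\<And>x. \<bar>f x\<bar> \<le> b"
  shows "f \<in> bcontfun"
  using assms by (auto simp: bcontfun_def bounded_iff)

lemma bcontfun_cont: "f \<in> bcontfun \<Longrightarrow> continuous_on UNIV f"
  by (simp add: bcontfun_def)

lemma bcontfun_add:
  fixes f g :: "'b::topological_space \<Rightarrow> real"
  shows "f \<in> bcontfun \<Longrightarrow> g \<in> bcontfun \<Longrightarrow> (\<lambda>x. f x + g x) \<in> bcontfun"
  by (auto simp: bcontfun_def intro!: continuous_intros bounded_plus_comp)

lemma bcontfun_cmult:
  fixes f :: "'b::topological_space \<Rightarrow> real"
  shows "f \<in> bcontfun \<Longrightarrow> (\<lambda>x. c * f x) \<in> bcontfun"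
  using bounded_scaleR_comp[of f UNIV c] by (auto simp: bcontfun_def intro!: continuous_intros)

lemma bcontfun_sum:
  fixes f :: "'i \<Rightarrow> 'b::topological_space \<Rightarrow> real"
  assumes "\<And>i. i \<in> I \<Longrightarrow> f i \<in> bcontfun"
  shows "(\<lambda>x. \<Sum>i\<in>I. f i x) \<in> bcontfun"
  using assms by (induction I rule: infinite_finite_induct) (auto intro: const_bcontfun bcontfun_add)

text \<open>The compact set is a subset of a type, while the functions live on the whole type. Hence
  \<open>le_const\<close> looks at values on \<open>K\<close>; it encodes positivity, total mass one
  and concentration on \<open>K\<close> together. Complete regularity takes the place of Urysohn's
  lemma.\<close>

locale normalized_positive_functional =
  fixes K :: "'b::topological_space set" and \<Lambda> :: "('b \<Rightarrow> real) \<Rightarrow> real"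
  assumes compact_K: "compact K"
    and completely_regular: "\<And>U z. open U \<Longrightarrow> z \<in> U \<Longrightarrow> \<exists>g::'b \<Rightarrow> real. continuous_on UNIV g \<and>
      (\<forall>x. 0 \<le> g x \<and> g x \<le> 1) \<and> g z = 1 \<and> (\<forall>x. x \<notin> U \<longrightarrow> g x = 0)"
    and add: "\<And>f g. f \<in> bcontfun \<Longrightarrow> g \<in> bcontfun \<Longrightarrow> \<Lambda> (\<lambda>x. f x + g x) = \<Lambda> f + \<Lambda> g"
    and scale: "\<And>f c. f \<in> bcontfun \<Longrightarrow> \<Lambda> (\<lambda>x. c * f x) = c * \<Lambda> f"
    and le_const: "\<And>f c. f \<in> bcontfun \<Longrightarrow> (\<And>x. x \<in> K \<Longrightarrow> f x \<le> c) \<Longrightarrow> \<Lambda> f \<le> c"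
begin

lemma mono:
  assumes "f \<in> bcontfun" "g \<in> bcontfun" "\<And>x. x \<in> K \<Longrightarrow> f x \<le> g x"
  shows "\<Lambda> f \<le> \<Lambda> g"
proof -
  have ng: "(\<lambda>x. (-1) * g x) \<in> bcontfun" by (rule bcontfun_cmult[OF assms(2)])
  have "\<Lambda> (\<lambda>x. f x + (-1) * g x) \<le> 0"
    using assms(3) by (intro le_const bcontfun_add assms(1) ng) auto
  moreover have "\<Lambda> (\<lambda>x. f x + (-1) * g x) = \<Lambda> f + (-1) * \<Lambda> g"
    by (simp only: add[OF assms(1) ng] scale[OF assms(2)])
  ultimately show ?thesis by simp
qed

lemma const: "\<Lambda> (\<lambda>_. c) = c"
proof (rule antisym)
  show "\<Lambda> (\<lambda>_. c) \<le> c" by (rule le_const) (auto intro: const_bcontfun)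
  have "\<Lambda> (\<lambda>_. (-1) * c) \<le> - c" by (rule le_const) (auto intro: const_bcontfun)
  then show "c \<le> \<Lambda> (\<lambda>_. c)" using scale[OF const_bcontfun, of "-1" c] by simp
qed

lemma sum:
  assumes "\<And>i. i \<in> I \<Longrightarrow> f i \<in> bcontfun"
  shows "\<Lambda> (\<lambda>x. \<Sum>i\<in>I. f i x) = (\<Sum>i\<in>I. \<Lambda> (f i))"
  using assms
proof (induction I rule: infinite_finite_induct)
  case (insert i I)
  then show ?case using add[of "f i" "\<lambda>x. \<Sum>i\<in>I. f i x"] bcontfun_sum[of I f] by simp
qed (use const in auto)

section \<open>The outer measure induced by the functional\<close>

definition bump :: "'b set \<Rightarrow> ('b \<Rightarrow> real) set"
  where "bump U = {f. continuous_on UNIV f \<and> (\<forall>x. 0 \<le> f x \<and> f x \<le> 1) \<and> (\<forall>x\<in>K - U. f x = 0)}"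

text \<open>Requiring that \<open>f\<close> vanishes off \<open>U\<close> gives the same supremum as requiring support in \<open>U\<close>, because
  the positive part of \<open>f - e\<close> has compact support in \<open>K \<inter> U\<close>.\<close>

definition content :: "'b set \<Rightarrow> real"
  where "content U = (SUP f\<in>bump U. \<Lambda> f)"

definition outer :: "'b set \<Rightarrow> real"
  where "outer A = (INF U\<in>{U. open U \<and> A \<subseteq> U}. content U)"

lemma bump_bcontfun: "f \<in> bump U \<Longrightarrow> f \<in> bcontfun"
  by (rule bcontfun_boundedI[where b = 1]) (auto simp: bump_def)

lemma bump_functional: "f \<in> bump U \<Longrightarrow> 0 \<le> \<Lambda> f \<and> \<Lambda> f \<le> 1"
  using mono[OF const_bcontfun bump_bcontfun, of f U 0] mono[OF bump_bcontfun const_bcontfun, of f U 1]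
  by (auto simp: const bump_def)

lemma zero_bump: "(\<lambda>_. 0) \<in> bump U"
  by (auto simp: bump_def)

lemma bdd_bump: "bdd_above (\<Lambda> ` bump U)"
  using bump_functional by (intro bdd_aboveI[of _ 1]) auto

lemma content_upper: "f \<in> bump U \<Longrightarrow> \<Lambda> f \<le> content U"
  unfolding content_def by (rule cSUP_upper[OF _ bdd_bump])

lemma content_least: "(\<And>f. f \<in> bump U \<Longrightarrow> \<Lambda> f \<le> c) \<Longrightarrow> content U \<le> c"
  unfolding content_def using zero_bump[of U] by (intro cSUP_least) auto

lemma content_nonneg: "0 \<le> content U"
  using content_upper[OF zero_bump] const[of 0] by simp

text \<open>Only the trace of a set on \<open>K\<close> counts, so ambient open sets can represent
  relatively open ones.\<close>

lemma content_mono: "K \<inter> U \<subseteq> V \<Longrightarrow> content U \<le> content V"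
  by (intro content_least content_upper) (auto simp: bump_def)

lemma outer_le: "open U \<Longrightarrow> A \<subseteq> U \<Longrightarrow> outer A \<le> content U"
  unfolding outer_def by (intro cINF_lower bdd_belowI[of _ 0]) (auto simp: content_nonneg)

lemma outer_greatest: "(\<And>U. open U \<Longrightarrow> A \<subseteq> U \<Longrightarrow> c \<le> content U) \<Longrightarrow> c \<le> outer A"
  unfolding outer_def by (rule cINF_greatest) auto

lemma outer_nonneg: "0 \<le> outer A"
  by (intro outer_greatest content_nonneg)

lemma outer_mono: "A \<subseteq> B \<Longrightarrow> outer A \<le> outer B"
  by (intro outer_greatest outer_le) auto

lemma outer_open: "open U \<Longrightarrow> content U \<le> outer (K \<inter> U)"
  by (intro outer_greatest content_mono)

lemma outer_approx:
  assumes "e > 0"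
  obtains U where "open U" "A \<subseteq> U" "content U < outer A + e"
  using outer_greatest[of A "outer A + e"] assms by (force simp: not_less[symmetric])

lemma outer_empty: "outer {} = 0"
proof (rule antisym)
  have "outer {} \<le> content {}" by (rule outer_le) auto
  also have "\<dots> \<le> 0"
    by (intro content_least le_const bump_bcontfun) (auto simp: bump_def)
  finally show "outer {} \<le> 0" .
qed (rule outer_nonneg)

lemma outer_K: "outer K = 1"
proof (rule antisym)
  have "outer K \<le> content UNIV" by (rule outer_le) auto
  also have "\<dots> \<le> 1" using bump_functional by (intro content_least) auto
  finally show "outer K \<le> 1" .
  show "1 \<le> outer K"
  proof (rule outer_greatest)
    fix U assume "K \<subseteq> U"
    then have "(\<lambda>_. 1) \<in> bump U" by (auto simp: bump_def)
    then show "1 \<le> content U" using content_upper const[of 1] by metis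
  qed
qed

text \<open>The part of \<open>K\<close> where f \<ge> e is compact, so finitely many bump functions
  subordinate to the cover dominate f there; the summand e takes care of the other points.\<close>

lemma bump_Union_le:
  fixes V :: "nat \<Rightarrow> 'b set"
  assumes V: "\<And>i. open (V i)" and f: "f \<in> bump (\<Union>i. V i)" and e: "e > 0"
  shows "\<exists>n. \<Lambda> f \<le> e + (\<Sum>i<n. content (V i))"
proof -
  define C where "C = K \<inter> {x. e \<le> f x}"
  have fc: "continuous_on UNIV f" using f by (simp add: bump_def)
  have "closed {x. e \<le> f x}" by (intro closed_Collect_le fc continuous_on_const)
  then have C: "compact C" unfolding C_def using compact_K by (rule compact_Int_closed[rotated])
  have "\<exists>i. z \<in> V i" if "z \<in> C" for z
  proof (rule ccontr)
    assume "\<not> ?thesis"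
    then have "f z = 0" using f that by (auto simp: C_def bump_def)
    then show False using that e by (simp add: C_def)
  qed
  then obtain \<iota> where \<iota>: "\<And>z. z \<in> C \<Longrightarrow> z \<in> V (\<iota> z)" by metis
  have "\<forall>z\<in>C. \<exists>g::'b \<Rightarrow> real. continuous_on UNIV g \<and>
      (\<forall>x. 0 \<le> g x \<and> g x \<le> 1) \<and> g z = 1 \<and> (\<forall>x. x \<notin> V (\<iota> z) \<longrightarrow> g x = 0)"
    using completely_regular[OF V \<iota>] by blast
  then obtain g :: "'b \<Rightarrow> 'b \<Rightarrow> real" where g: "\<And>z. z \<in> C \<Longrightarrow> continuous_on UNIV (g z)"
    "\<And>z x. z \<in> C \<Longrightarrow> 0 \<le> g z x" "\<And>z. z \<in> C \<Longrightarrow> g z z = 1"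
    "\<And>z x. z \<in> C \<Longrightarrow> x \<notin> V (\<iota> z) \<Longrightarrow> g z x = 0" by metis
  have "\<And>z. z \<in> C \<Longrightarrow> open {x. g z x > 1 / 2}"
    using g(1) by (intro open_Collect_less continuous_on_const) auto
  moreover have "C \<subseteq> (\<Union>z\<in>C. {x. g z x > 1 / 2})" using g(3) by force
  ultimately obtain Z where Z: "Z \<subseteq> C" "finite Z" "C \<subseteq> (\<Union>z\<in>Z. {x. g z x > 1 / 2})"
    using compactE_image[OF C] by metis
  \<comment> \<open>Near each chosen centre 2 g exceeds 1, so the truncated sums \<open>h i\<close>
    add up to at least 1 on \<open>C\<close>, while \<open>h i\<close> still vanishes off
    \<open>V i\<close>.\<close>
  define h where "h i x = min 1 (\<Sum>z\<in>{z\<in>Z. \<iota> z = i}. 2 * g z x)" for i x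
  have h: "h i \<in> bump (V i)" for i
  proof -
    have "continuous_on UNIV (h i)"
      unfolding h_def using g(1) Z(1) by (intro continuous_intros) auto
    moreover have "0 \<le> h i x \<and> h i x \<le> 1" for x
      using g(2) Z(1) by (auto simp: h_def intro!: sum_nonneg)
    moreover have "h i x = 0" if "x \<in> K - V i" for x
    proof -
      have "(\<Sum>z\<in>{z\<in>Z. \<iota> z = i}. 2 * g z x) = 0" using that g(4) Z(1) by (intro sum.neutral) auto
      then show ?thesis by (simp add: h_def)
    qed
    ultimately show ?thesis by (auto simp: bump_def)
  qed
  obtain n where n: "\<And>z. z \<in> Z \<Longrightarrow> \<iota> z < n"
    using Z(2) finite_nat_set_iff_bounded[of "\<iota> ` Z"] by auto
  have "f x \<le> e + (\<Sum>i<n. h i x)" if "x \<in> K" for x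
  proof (cases "x \<in> C")
    case True
    then obtain z where z: "z \<in> Z" "g z x > 1 / 2" using Z(3) by auto
    have "1 \<le> 2 * g z x" using z by simp
    also have "\<dots> \<le> (\<Sum>y\<in>{y\<in>Z. \<iota> y = \<iota> z}. 2 * g y x)"
      using z Z g(2) by (intro member_le_sum[where f = "\<lambda>y. 2 * g y x"]) auto
    finally have "1 \<le> h (\<iota> z) x" by (simp add: h_def)
    also have "\<dots> \<le> (\<Sum>i<n. h i x)"
      using n[OF z(1)] h by (intro member_le_sum[where f = "\<lambda>i. h i x"]) (auto simp: bump_def)
    finally have "1 \<le> (\<Sum>i<n. h i x)" .
    moreover have "f x \<le> 1" using f by (simp add: bump_def)
    ultimately show ?thesis using e by simp
  next
    case False
    then have "f x \<le> e" using that by (simp add: C_def)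
    moreover have "0 \<le> (\<Sum>i<n. h i x)" using h by (intro sum_nonneg) (auto simp: bump_def)
    ultimately show ?thesis by simp
  qed
  then have "\<Lambda> f \<le> \<Lambda> (\<lambda>x. e + (\<Sum>i<n. h i x))"
    by (intro mono bump_bcontfun[OF f] bcontfun_add const_bcontfun bcontfun_sum bump_bcontfun[OF h])
  also have "\<dots> = e + (\<Sum>i<n. \<Lambda> (h i))"
    using bump_bcontfun[OF h] by (simp add: add const_bcontfun bcontfun_sum const sum)
  also have "\<dots> \<le> e + (\<Sum>i<n. content (V i))"
    by (intro add_left_mono sum_mono content_upper h)
  finally show ?thesis by blast
qed

lemma outer_countably_subadditive:
  "countably_subadditive (Pow K) (\<lambda>A. ennreal (outer A))"
  unfolding countably_subadditive_def
proof (intro allI impI)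
  fix A :: "nat \<Rightarrow> 'b set"
  define S where "S = (\<Sum>i. ennreal (outer (A i)))"
  have main: "ennreal (outer (\<Union>i. A i)) \<le> S + ennreal e" if e: "e > 0" for e :: real
  proof -
    \<comment> \<open>Half of e is shared geometrically among the approximating open sets; the other
      half is the error allowed in \<open>bump_Union_le\<close>.\<close>
    have "\<exists>U. open U \<and> A i \<subseteq> U \<and> content U < outer (A i) + e / 2 * (1 / 2) ^ Suc i" for i
    proof -
      have "e / 2 * (1 / 2) ^ Suc i > 0" using e by simp
      then show ?thesis by (rule outer_approx) blast
    qed
    then obtain U where U: "\<And>i. open (U i)" "\<And>i. A i \<subseteq> U i"
      "\<And>i. content (U i) < outer (A i) + e / 2 * (1 / 2) ^ Suc i" by metis
    have le: "\<Lambda> f \<le> e + enn2real S" if f: "f \<in> bump (\<Union>i. U i)" and S: "S < top" for f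
    proof -
      obtain n where n: "\<Lambda> f \<le> e / 2 + (\<Sum>i<n. content (U i))"
        using bump_Union_le[OF U(1) f, of "e / 2"] e by auto
      also have "(\<Sum>i<n. content (U i)) \<le> (\<Sum>i<n. outer (A i) + e / 2 * (1 / 2) ^ Suc i)"
        using U(3) by (intro sum_mono) (auto intro: less_imp_le)
      also have "\<dots> = (\<Sum>i<n. outer (A i)) + e / 2 * (\<Sum>i<n. (1 / 2) ^ Suc i)"
        by (simp add: sum.distrib sum_distrib_left)
      also have "(\<Sum>i<n. (1 / 2 :: real) ^ Suc i) = 1 - (1 / 2) ^ n"
        by (induction n) auto
      also have "(\<Sum>i<n. outer (A i)) \<le> enn2real S"
      proof -
        have "ennreal (\<Sum>i<n. outer (A i)) = (\<Sum>i<n. ennreal (outer (A i)))"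
          by (simp add: outer_nonneg)
        also have "\<dots> \<le> S" unfolding S_def by (intro sum_le_suminf) auto
        finally have "enn2real (ennreal (\<Sum>i<n. outer (A i))) \<le> enn2real S"
          using S by (rule enn2real_mono)
        then show ?thesis by (simp add: outer_nonneg sum_nonneg)
      qed
      finally have "\<Lambda> f \<le> e / 2 + (enn2real S + e / 2 * (1 - (1 / 2) ^ n))" by simp
      also have "\<dots> \<le> e / 2 + (enn2real S + e / 2 * 1)"
        using e by (intro add_left_mono mult_left_mono) auto
      finally show ?thesis by simp
    qed
    show ?thesis
    proof (cases "S = top")
      case False
      then have S: "S < top" by (simp add: top.not_eq_extremum)
      have "outer (\<Union>i. A i) \<le> content (\<Union>i. U i)" using U by (intro outer_le) auto
      also have "\<dots> \<le> e + enn2real S" using le[OF _ S] by (rule content_least)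
      finally have "ennreal (outer (\<Union>i. A i)) \<le> ennreal (e + enn2real S)" by (rule ennreal_leI)
      also have "\<dots> = S + ennreal e"
        using e S by (simp add: ennreal_plus add.commute)
      finally show ?thesis .
    qed simp
  qed
  show "ennreal (outer (\<Union>i. A i)) \<le> (\<Sum>i. ennreal (outer (A i)))"
    unfolding S_def[symmetric] by (rule ennreal_le_epsilon) (use main in auto)
qed

text \<open>Nearly optimal bump functions for \<open>W \<inter> U\<close> and for the rest can be
  added: lowering the first by e confines it to \<open>C\<close>, where the second vanishes on
  \<open>K\<close>, so that on \<open>K\<close> the sum stays at most 1.\<close>

lemma outer_caratheodory:
  assumes U: "open U" and A: "A \<subseteq> K"
  shows "outer (A \<inter> U) + outer (A - U) \<le> outer A"
proof (rule outer_greatest)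
  fix W assume W: "open W" "A \<subseteq> W"
  have "content (W \<inter> U) \<le> content W - outer (A - U) + e" if e: "e > 0" for e
  proof (rule content_least)
    fix f assume f: "f \<in> bump (W \<inter> U)"
    have fc: "continuous_on UNIV f" using f by (simp add: bump_def)
    define C where "C = {x. e \<le> f x}"
    have "closed C" unfolding C_def by (intro closed_Collect_le fc continuous_on_const)
    then have oWC: "open (W - C)" using W by (intro open_Diff)
    define f' where "f' x = max 0 (f x - e)" for x
    have f': "f' \<in> bcontfun"
    proof (rule bcontfun_boundedI)
      show "continuous_on UNIV f'" unfolding f'_def by (intro continuous_intros fc)
      have "0 \<le> f x" "f x \<le> 1" for x using f by (auto simp: bump_def)
      then show "\<bar>f' x\<bar> \<le> 1" for x using e by (auto simp: f'_def abs_if max_def intro: order_trans[of _ "f x"])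
    qed
    \<comment> \<open>Points of \<open>A\<close> outside \<open>U\<close> lie in \<open>K\<close>
      and outside \<open>W \<inter> U\<close>, so f is 0 there and they miss
      \<open>C\<close>.\<close>
    have "outer (A - U) \<le> content (W - C)"
    proof (rule outer_le[OF oWC])
      show "A - U \<subseteq> W - C" using A W f e by (fastforce simp: C_def bump_def)
    qed
    also have "\<dots> \<le> content W - \<Lambda> f'"
    proof (rule content_least)
      fix h assume h: "h \<in> bump (W - C)"
      have "(\<lambda>x. min 1 (f' x + h x)) \<in> bump W"
      proof -
        have "f' x + h x = 0" if "x \<in> K - W" for x
        proof -
          have "f x = 0" "h x = 0" using f h that by (auto simp: bump_def)
          then show ?thesis using e by (simp add: f'_def)
        qed
        moreover have "continuous_on UNIV (\<lambda>x. min 1 (f' x + h x))"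
          using bcontfun_cont[OF f'] h by (intro continuous_intros) (auto simp: bump_def)
        ultimately show ?thesis using h by (auto simp: bump_def f'_def)
      qed
      from content_upper[OF this] have "\<Lambda> (\<lambda>x. min 1 (f' x + h x)) \<le> content W" .
      moreover have "\<Lambda> (\<lambda>x. f' x + h x) \<le> \<Lambda> (\<lambda>x. min 1 (f' x + h x))"
      proof (rule mono)
        show "(\<lambda>x. f' x + h x) \<in> bcontfun" by (rule bcontfun_add[OF f' bump_bcontfun[OF h]])
        show "(\<lambda>x. min 1 (f' x + h x)) \<in> bcontfun"
          by (rule bump_bcontfun) fact
        fix x assume x: "x \<in> K"
        show "f' x + h x \<le> min 1 (f' x + h x)"
        proof (cases "x \<in> C")
          case True
          then have "h x = 0" using h x by (auto simp: bump_def)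
          moreover have "f x \<le> 1" using f by (simp add: bump_def)
          ultimately show ?thesis using e by (simp add: f'_def)
        next
          case False
          then have "f' x = 0" by (simp add: f'_def C_def)
          then show ?thesis using h by (simp add: bump_def)
        qed
      qed
      ultimately show "\<Lambda> h \<le> content W - \<Lambda> f'"
        using add[OF f' bump_bcontfun[OF h]] by simp
    qed
    finally have "outer (A - U) \<le> content W - \<Lambda> f'" .
    moreover have "\<Lambda> f \<le> \<Lambda> (\<lambda>x. e + f' x)"
      by (intro mono bump_bcontfun[OF f] bcontfun_add const_bcontfun f') (simp add: f'_def)
    moreover have "\<Lambda> (\<lambda>x. e + f' x) = e + \<Lambda> f'"
      using add[OF const_bcontfun f', of e] const by simp
    ultimately show "\<Lambda> f \<le> content W - outer (A - U) + e" by simp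
  qed
  then have "content (W \<inter> U) \<le> content W - outer (A - U)" by (rule field_le_epsilon)
  moreover have "outer (A \<inter> U) \<le> content (W \<inter> U)" using W U by (intro outer_le) auto
  ultimately show "outer (A \<inter> U) + outer (A - U) \<le> content W" by simp
qed

section \<open>The Riesz measure and its regularity\<close>

definition riesz_measure :: "'b measure"
  where "riesz_measure = measure_of K {U. openin (top_of_set K) U} (\<lambda>A. ennreal (outer A))"

lemma open_generators: "{U. openin (top_of_set K) U} \<subseteq> Pow K"
  by (auto dest: openin_imp_subset)

lemma space_riesz [simp]: "space riesz_measure = K"
  using open_generators by (simp add: riesz_measure_def space_measure_of)

lemma sets_riesz: "sets riesz_measure = sigma_sets K {U. openin (top_of_set K) U}"
  using open_generators by (simp add: riesz_measure_def)

lemma open_in_sets_riesz: "open U \<Longrightarrow> K \<inter> U \<in> sets riesz_measure"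
  unfolding sets_riesz by (rule sigma_sets.Basic) (auto simp: openin_open)

text \<open>\<open>measure_of\<close> returns the prescribed set function once that is countably
  additive on the generated sigma-algebra. Caratheodory's theorem gives this as soon as the
  relatively open sets are measurable for the outer measure.\<close>

lemma emeasure_riesz:
  assumes "A \<in> sets riesz_measure"
  shows "emeasure riesz_measure A = ennreal (outer A)"
proof -
  define L where "L = lambda_system K (Pow K) (\<lambda>A. ennreal (outer A))"
  have "outer_measure_space (Pow K) (\<lambda>A. ennreal (outer A))"
    unfolding outer_measure_space_def
    using outer_countably_subadditive
    by (auto simp: positive_def increasing_def outer_empty intro: outer_mono ennreal_leI)
  then have ms: "measure_space K L (\<lambda>A. ennreal (outer A))"
    unfolding L_def by (rule sigma_algebra.caratheodory_lemma[OF sigma_algebra_Pow])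
  have "{U. openin (top_of_set K) U} \<subseteq> L"
  proof
    fix V assume "V \<in> {U. openin (top_of_set K) U}"
    then obtain U where U: "open U" "V = K \<inter> U" by (auto simp: openin_open)
    have "ennreal (outer (X \<inter> V)) + ennreal (outer (X - V)) = ennreal (outer X)" if X: "X \<subseteq> K" for X
    proof (rule antisym)
      have eq: "X \<inter> V = X \<inter> U" "X - V = X - U" using X U by auto
      show "ennreal (outer (X \<inter> V)) + ennreal (outer (X - V)) \<le> ennreal (outer X)"
        using outer_caratheodory[OF U(1) X]
        by (simp add: eq outer_nonneg ennreal_plus[symmetric] ennreal_leI del: ennreal_plus)
      have cs: "subadditive (Pow K) (\<lambda>A. ennreal (outer A))"
        using algebra.axioms(1)[OF algebra_Pow] _ outer_countably_subadditive
        by (rule ring_of_sets.countably_subadditive_subadditive) (simp add: positive_def outer_empty)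
      have "ennreal (outer ((X \<inter> V) \<union> (X - V))) \<le> ennreal (outer (X \<inter> V)) + ennreal (outer (X - V))"
        using X by (intro subadditiveD[OF cs]) auto
      then show "ennreal (outer X) \<le> ennreal (outer (X \<inter> V)) + ennreal (outer (X - V))"
        by (simp add: Int_Diff_Un)
    qed
    then show "V \<in> L"
      using U unfolding L_def algebra.lambda_system_eq[OF algebra_Pow] by auto
  qed
  then have sub: "sigma_sets K {U. openin (top_of_set K) U} \<subseteq> L"
    using ms by (intro sigma_algebra.sigma_sets_subset) (auto simp: measure_space_def)
  have ca: "countably_additive (sets riesz_measure) (\<lambda>A. ennreal (outer A))"
    using ms sub unfolding measure_space_def countably_additive_def sets_riesz by blast
  show ?thesis
    using assms ca
    by (intro emeasure_measure_of[OF riesz_measure_def open_generators])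
      (auto simp: positive_def outer_empty)
qed

lemma prob_space_riesz: "prob_space riesz_measure"
proof
  have "K \<in> sets riesz_measure" using sets.top[of riesz_measure] by simp
  then show "emeasure riesz_measure (space riesz_measure) = 1"
    by (simp add: emeasure_riesz outer_K)
qed

lemma measure_riesz: "A \<in> sets riesz_measure \<Longrightarrow> measure riesz_measure A = outer A"
  using emeasure_riesz[of A] by (simp add: measure_def outer_nonneg)

text \<open>Outer regularity is built into \<open>outer\<close>. Inner regularity follows by passing
  to complements: an open set around \<open>K - A\<close> leaves a compact set inside
  \<open>A\<close>.\<close>

lemma regular_riesz: "regular_borel_prob (top_of_set K) riesz_measure"
  unfolding regular_borel_prob_def
proof (intro conjI ballI)
  interpret prob_space riesz_measure by (rule prob_space_riesz)
  show "prob_space riesz_measure" by (rule prob_space_riesz)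
  show "sets riesz_measure = sigma_sets (topspace (top_of_set K)) {U. openin (top_of_set K) U}"
    by (simp add: sets_riesz)
  fix A assume A: "A \<in> sets riesz_measure"
  have AK: "A \<subseteq> K" using sets.sets_into_space[OF A] by simp
  have approx: "\<exists>U. open U \<and> B \<subseteq> K \<inter> U \<and> measure riesz_measure (K \<inter> U) \<le> measure riesz_measure B + e"
    if B: "B \<in> sets riesz_measure" and e: "e > 0" for B e
  proof -
    obtain U where U: "open U" "B \<subseteq> U" "content U < outer B + e" using outer_approx[OF e] by blast
    have "outer (K \<inter> U) \<le> content U" by (rule outer_le) (use U in auto)
    then show ?thesis
      using U sets.sets_into_space[OF B] B open_in_sets_riesz[OF U(1)]
      by (intro exI[of _ U]) (auto simp: measure_riesz)
  qed
  show "emeasure riesz_measure A = (INF U\<in>{U. openin (top_of_set K) U \<and> A \<subseteq> U}. emeasure riesz_measure U)"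
  proof (rule antisym)
    show "emeasure riesz_measure A \<le> (INF U\<in>{U. openin (top_of_set K) U \<and> A \<subseteq> U}. emeasure riesz_measure U)"
      using open_in_sets_riesz by (intro INF_greatest emeasure_mono) (auto simp: openin_open)
    show "(INF U\<in>{U. openin (top_of_set K) U \<and> A \<subseteq> U}. emeasure riesz_measure U) \<le> emeasure riesz_measure A"
    proof (rule ennreal_le_epsilon)
      fix e :: real assume "e > 0"
      from approx[OF A this] obtain U where U: "open U" "A \<subseteq> K \<inter> U"
        "measure riesz_measure (K \<inter> U) \<le> measure riesz_measure A + e" by auto
      have "(INF U\<in>{U. openin (top_of_set K) U \<and> A \<subseteq> U}. emeasure riesz_measure U)
          \<le> emeasure riesz_measure (K \<inter> U)"
        using U by (intro INF_lower) (auto simp: openin_open)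
      also have "\<dots> \<le> emeasure riesz_measure A + ennreal e"
        using U(3) \<open>e > 0\<close>
        by (simp add: emeasure_eq_measure ennreal_plus[symmetric] ennreal_leI del: ennreal_plus)
      finally show "(INF U\<in>{U. openin (top_of_set K) U \<and> A \<subseteq> U}. emeasure riesz_measure U)
          \<le> emeasure riesz_measure A + ennreal e" .
    qed
  qed
  show "emeasure riesz_measure A = (SUP S\<in>{S. compactin (top_of_set K) S \<and> S \<subseteq> A}. emeasure riesz_measure S)"
  proof (rule antisym)
    show "(SUP S\<in>{S. compactin (top_of_set K) S \<and> S \<subseteq> A}. emeasure riesz_measure S) \<le> emeasure riesz_measure A"
      by (intro SUP_least emeasure_mono A) auto
    show "emeasure riesz_measure A \<le> (SUP S\<in>{S. compactin (top_of_set K) S \<and> S \<subseteq> A}. emeasure riesz_measure S)"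
    proof (rule ennreal_le_epsilon)
      fix e :: real assume e: "e > 0"
      have KA: "K - A \<in> sets riesz_measure" using sets.compl_sets[OF A] by simp
      obtain U where U: "open U" "K - A \<subseteq> K \<inter> U"
        "measure riesz_measure (K \<inter> U) \<le> measure riesz_measure (K - A) + e" using approx[OF KA e] by auto
      have "compact (K - U)" using compact_K U(1) by (rule compact_diff)
      then have "K - U \<in> {S. compactin (top_of_set K) S \<and> S \<subseteq> A}"
        using U AK by (auto simp: compactin_subtopology)
      then have le: "emeasure riesz_measure (K - U)
          \<le> (SUP S\<in>{S. compactin (top_of_set K) S \<and> S \<subseteq> A}. emeasure riesz_measure S)"
        by (rule SUP_upper)
      have "measure riesz_measure (K - (K \<inter> U)) = 1 - measure riesz_measure (K \<inter> U)"
        using prob_compl[OF open_in_sets_riesz[OF U(1)]] by simp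
      moreover have "K - (K \<inter> U) = K - U" by auto
      moreover have "measure riesz_measure (K - A) = 1 - measure riesz_measure A"
        using prob_compl[OF A] by simp
      ultimately have "measure riesz_measure A \<le> measure riesz_measure (K - U) + e"
        using U(3) by simp
      then have "emeasure riesz_measure A \<le> emeasure riesz_measure (K - U) + ennreal e"
        using e by (simp add: emeasure_eq_measure ennreal_plus[symmetric] ennreal_leI del: ennreal_plus)
      also have "\<dots> \<le> (SUP S\<in>{S. compactin (top_of_set K) S \<and> S \<subseteq> A}. emeasure riesz_measure S) + ennreal e"
        using le by (rule add_right_mono)
      finally show "emeasure riesz_measure A
          \<le> (SUP S\<in>{S. compactin (top_of_set K) S \<and> S \<subseteq> A}. emeasure riesz_measure S) + ennreal e" .
    qed
  qed
qed

lemma borel_measurable_riesz: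
  fixes f :: "'b \<Rightarrow> real"
  assumes "continuous_on UNIV f"
  shows "f \<in> borel_measurable riesz_measure"
proof (rule borel_measurableI)
  fix S :: "real set" assume "open S"
  then have "open (f -` S)" using assms by (simp add: open_vimage)
  then show "f -` S \<inter> space riesz_measure \<in> sets riesz_measure"
    using open_in_sets_riesz[of "f -` S"] by (simp add: Int_commute)
qed

text \<open>A layer-cake argument: \<open>real N * f x\<close> is cut into N layers of height 1, the
  i-th being a bump function for the set where it exceeds i. Counting these sets overshoots by at
  most 1, an error of 1 / N after division.\<close>

lemma riesz_integral_unit:
  assumes f: "continuous_on UNIV f" "\<And>x. 0 \<le> f x" "\<And>x. f x \<le> 1"
  shows "\<Lambda> f \<le> (LINT x|riesz_measure. f x)"
proof (rule field_le_epsilon)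
  interpret prob_space riesz_measure by (rule prob_space_riesz)
  fix e :: real assume "e > 0"
  then obtain N :: nat where N: "N > 0" "1 / N < e" using nat_approx_posE by (metis zero_less_Suc)
  define h where "h i x = max 0 (min 1 (real N * f x - real i))" for i x
  define U where "U i = {x. real i < real N * f x}" for i
  have sum_clamp: "(\<Sum>i<n. max 0 (min 1 (y - real i))) = min y (real n)" if "y \<ge> 0" for y n
    using that by (induction n) (auto simp: min_def max_def)
  \<comment> \<open>Fewer than y + 1 natural numbers lie strictly below y.\<close>
  have count: "(\<Sum>i<n. of_bool (real i < y)) \<le> min (y + 1) (real n)" if "y \<ge> 0" for y n
    using that by (induction n) (auto simp: min_def split: if_splits)
  have oU: "open (U i)" for i
    unfolding U_def by (intro open_Collect_less continuous_intros f)
  have h: "h i \<in> bump (U i)" for i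
    using f by (auto simp: bump_def h_def U_def intro!: continuous_intros)
  have fb: "f \<in> bcontfun" using f by (intro bcontfun_boundedI[where b = 1]) (auto simp: abs_le_iff intro: order_trans[of _ 0])
  have fi: "integrable riesz_measure f"
    using f by (intro integrable_const_bound[where B = 1] borel_measurable_riesz) auto
  have "real N * \<Lambda> f = \<Lambda> (\<lambda>x. real N * f x)" using scale[OF fb] by simp
  also have "(\<lambda>x. real N * f x) = (\<lambda>x. \<Sum>i<N. h i x)"
    unfolding h_def using f N by (subst sum_clamp) (auto simp: min_def mult_left_le)
  also have "\<Lambda> \<dots> = (\<Sum>i<N. \<Lambda> (h i))" using bump_bcontfun[OF h] by (rule sum)
  also have "\<dots> \<le> (\<Sum>i<N. measure riesz_measure (K \<inter> U i))"
  proof (rule sum_mono)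
    fix i
    have "\<Lambda> (h i) \<le> content (U i)" by (rule content_upper[OF h])
    also have "\<dots> \<le> outer (K \<inter> U i)" by (rule outer_open[OF oU])
    finally show "\<Lambda> (h i) \<le> measure riesz_measure (K \<inter> U i)"
      by (simp add: measure_riesz open_in_sets_riesz oU)
  qed
  also have "\<dots> = (\<Sum>i<N. (LINT x|riesz_measure. indicator (K \<inter> U i) x))"
    by (intro sum.cong) (simp_all add: Int_commute[of _ K])
  also have "\<dots> = (LINT x|riesz_measure. (\<Sum>i<N. indicator (K \<inter> U i) x))"
    using open_in_sets_riesz[OF oU] by (subst Bochner_Integration.integral_sum) (auto simp: emeasure_eq_measure)
  also have "\<dots> \<le> (LINT x|riesz_measure. real N * f x + 1)"
  proof (rule integral_mono)
    show "integrable riesz_measure (\<lambda>x. \<Sum>i<N. indicator (K \<inter> U i) x :: real)"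
      using open_in_sets_riesz[OF oU] by (intro Bochner_Integration.integrable_sum) (auto simp: emeasure_eq_measure)
    show "integrable riesz_measure (\<lambda>x. real N * f x + 1)" using fi by auto
    fix x
    have "(\<Sum>i<N. indicator (K \<inter> U i) x) \<le> (\<Sum>i<N. of_bool (real i < real N * f x) :: real)"
      by (intro sum_mono) (auto simp: U_def indicator_def)
    also have "\<dots> \<le> real N * f x + 1" using count[of "real N * f x" N] f(2) by simp
    finally show "(\<Sum>i<N. indicator (K \<inter> U i) x) \<le> real N * f x + 1" .
  qed
  also have "\<dots> = real N * (LINT x|riesz_measure. f x) + 1" using fi prob_space by simp
  finally have "real N * \<Lambda> f \<le> real N * (LINT x|riesz_measure. f x) + 1" .
  then have "\<Lambda> f \<le> (LINT x|riesz_measure. f x) + 1 / N" using N(1) by (simp add: field_simps)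
  then show "\<Lambda> f \<le> (LINT x|riesz_measure. f x) + e" using N(2) by simp
qed

lemma riesz_integral:
  assumes f: "continuous_on UNIV f" "\<And>x. 0 \<le> f x" "\<And>x. f x \<le> b"
  shows "\<Lambda> f \<le> (LINT x|riesz_measure. f x)"
proof -
  define c where "c = max 1 b"
  have c: "c > 0" "\<And>x. f x \<le> c" using f(3) by (auto simp: c_def intro: le_max_iff_disj[THEN iffD2])
  have fb: "f \<in> bcontfun"
    using f by (intro bcontfun_boundedI[where b = b]) auto
  have "\<Lambda> (\<lambda>x. (1 / c) * f x) \<le> (LINT x|riesz_measure. (1 / c) * f x)"
    using f c by (intro riesz_integral_unit continuous_intros) (auto simp: field_simps)
  then have "(1 / c) * \<Lambda> f \<le> (1 / c) * (LINT x|riesz_measure. f x)" unfolding scale[OF fb] by simp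
  then show ?thesis using c(1) by (simp add: divide_le_cancel)
qed

end

text \<open>A basic neighbourhood in the product topology restricts finitely many coordinates, so a
  finite product of tent functions does the separation.\<close>

lemma completely_regular_fun_space:
  fixes U :: "('a \<Rightarrow> 'k::metric_space) set"
  assumes "open U" "z \<in> U"
  shows "\<exists>g::('a \<Rightarrow> 'k) \<Rightarrow> real. continuous_on UNIV g \<and>
      (\<forall>x. 0 \<le> g x \<and> g x \<le> 1) \<and> g z = 1 \<and> (\<forall>x. x \<notin> U \<longrightarrow> g x = 0)"
proof -
  have "openin (product_topology (\<lambda>_. euclidean) UNIV) U"
    using assms(1) by (simp add: euclidean_product_topology)
  from product_topology_open_contains_basis[OF this assms(2)]
  obtain X where X: "z \<in> (\<Pi>\<^sub>E i\<in>UNIV. X i)" "\<And>i. openin euclidean (X i)"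
    "finite {i. X i \<noteq> topspace euclidean}" "(\<Pi>\<^sub>E i\<in>UNIV. X i) \<subseteq> U" by blast
  define F where "F = {i. X i \<noteq> UNIV}"
  have F: "finite F" using X(3) by (simp add: F_def)
  have "\<exists>e>0. ball (z i) e \<subseteq> X i" for i
  proof -
    have "open (X i)" "z i \<in> X i" using X(1) X(2)[of i] by (auto simp: PiE_iff)
    then show ?thesis using open_contains_ball by blast
  qed
  then obtain e where e: "\<And>i. e i > 0" "\<And>i. ball (z i) (e i) \<subseteq> X i" by metis
  define g where "g y = (\<Prod>i\<in>F. max 0 (1 - dist (y i) (z i) / e i))" for y :: "'a \<Rightarrow> 'k"
  have "continuous_on UNIV g"
    unfolding g_def using e(1) by (intro continuous_intros) (auto simp: less_imp_neq[symmetric])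
  moreover have "0 \<le> g y \<and> g y \<le> 1" for y
    using e(1) unfolding g_def by (auto intro!: prod_nonneg prod_le_1 divide_nonneg_pos)
  moreover have "g z = 1" by (simp add: g_def)
  moreover have "g y = 0" if "y \<notin> U" for y
  proof -
    from that X(4) obtain i where i: "y i \<notin> X i" by (auto simp: PiE_def)
    then have "i \<in> F" by (auto simp: F_def)
    moreover have "dist (y i) (z i) \<ge> e i" using i e(2)[of i] by (auto simp: dist_commute not_less[symmetric])
    ultimately show ?thesis
      unfolding g_def using F e(1)[of i] by (intro prod_zero) (auto intro!: bexI[of _ i] simp: field_simps)
  qed
  ultimately show ?thesis by blast
qed

text \<open>Compactness is pulled back from the complex plane along the isometric embedding, whose
  range is closed in both cases.\<close>

lemma compact_cball_scalar: "compact (cball 0 b :: 'k::real_or_complex set)"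
proof -
  define T where "T = (to_complex :: 'k \<Rightarrow> complex)"
  have inj: "inj T" unfolding T_def by (rule inj_to_complex)
  have "T ` cball 0 b = range T \<inter> cball 0 b"
    by (auto simp: T_def norm_to_complex)
  moreover have "closed (range T)"
    using range_to_complex[where 'a = 'k] closed_complex_Reals unfolding T_def by auto
  ultimately have "compact (T ` cball 0 b)" by (simp add: closed_Int_compact)
  moreover have "continuous_on (T ` cball 0 b) (inv T)"
  proof (rule continuous_onI)
    fix x e assume "x \<in> T ` cball 0 b" "0 < (e::real)"
    then show "\<exists>d>0. \<forall>y\<in>T ` cball 0 b. dist y x < d \<longrightarrow> dist (inv T y) (inv T x) \<le> e"
      using inj by (intro exI[of _ e])
        (auto simp: inv_f_f dist_norm T_def to_complex_diff[symmetric] norm_to_complex)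
  qed
  ultimately have "compact (inv T ` (T ` cball 0 b))" by (rule compact_continuous_image[rotated])
  then show ?thesis using inj by (simp add: image_image inv_f_f)
qed

section \<open>Banach-Alaoglu and Pietsch domination\<close>

context banach_over
begin

text \<open>Inside a product of scalar balls, compact by Tychonoff, linearity is a closed
  condition.\<close>

lemma compact_dual_ball: "compact (dual_ball sE)"
proof -
  define B where "B = (\<Pi>\<^sub>E x\<in>UNIV. cball (0::'k) (norm (x::'a)))"
  have "compactin (product_topology (\<lambda>_. euclidean) UNIV) B"
    unfolding B_def by (subst compactin_PiE) (auto simp: compact_cball_scalar)
  then have B: "compact B" by (simp add: euclidean_product_topology)
  have coord: "continuous_on UNIV (\<lambda>\<phi>. \<phi> x)" for x :: 'a
    by (rule continuous_on_product_coordinates)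
  have "dual_ball sE = B \<inter> ({\<phi>. \<forall>x y. \<phi> (x + y) = \<phi> x + \<phi> y} \<inter> {\<phi>. \<forall>c x. \<phi> (sE c x) = c * \<phi> x})"
    by (auto simp: dual_ball_iff B_def PiE_def Pi_iff)
  moreover have "closed ({\<phi>::'a \<Rightarrow> 'k. \<forall>x y. \<phi> (x + y) = \<phi> x + \<phi> y} \<inter> {\<phi>. \<forall>c x. \<phi> (sE c x) = c * \<phi> x})"
    by (intro closed_Int closed_Collect_all closed_Collect_eq continuous_intros coord)
  ultimately show ?thesis using compact_Int_closed[OF B] by simp
qed

lemma weak_star_ball_eq: "weak_star_ball sE = top_of_set (dual_ball sE)"
  by (simp add: weak_star_ball_def euclidean_product_topology)

text \<open>The inequalities to be achieved are built into a sublinear functional \<open>p\<close>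
  on continuous functions, so that any linear functional below \<open>p\<close> is positive,
  normalized and dominating; the Riesz measure inherits the last property.\<close>

lemma pietsch_domination:
  fixes N :: "'a \<Rightarrow> real" and C :: real
  assumes C: "C > 0" and N: "\<And>x. N x \<ge> 0" "\<And>c x. c \<ge> 0 \<Longrightarrow> N (c *\<^sub>R x) = c * N x"
    and summing: "\<And>(k::nat) x W. (\<And>\<phi>. \<phi> \<in> dual_ball sE \<Longrightarrow> (\<Sum>j=1..k. norm (\<phi> (x j))) \<le> W) \<Longrightarrow>
      (\<Sum>j=1..k. N (x j)) \<le> C * W"
  shows "\<exists>\<nu>. regular_borel_prob (weak_star_ball sE) \<nu> \<and> (\<forall>x. N x \<le> C * (LINT \<phi>|\<nu>. norm (\<phi> x)))"
proof -
  define K where "K = dual_ball sE"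
  define h where "h xs \<phi> = C * (\<Sum>x\<leftarrow>xs. norm (\<phi> x))" for xs :: "'a list" and \<phi> :: "'a \<Rightarrow> 'k"
  define e where "e xs = (\<Sum>x\<leftarrow>xs. N x)" for xs
  have K: "K \<noteq> {}" using zero_in_dual_ball by (auto simp: K_def)
  have summing': "e xs \<le> W" if "\<And>\<phi>. \<phi> \<in> K \<Longrightarrow> h xs \<phi> \<le> W" for xs W
  proof -
    have nth: "(\<Sum>x\<leftarrow>xs. f x) = (\<Sum>j=1..length xs. f (xs ! (j - 1)))" for f :: "'a \<Rightarrow> real"
      by (simp add: sum.atLeast1_atMost_eq sum_list_sum_nth atLeast0LessThan)
    have "e xs \<le> C * (W / C)"
      unfolding e_def nth
    proof (rule summing)
      fix \<phi> assume "\<phi> \<in> dual_ball sE"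
      then show "(\<Sum>j=1..length xs. norm (\<phi> (xs ! (j - 1)))) \<le> W / C"
        using that[of \<phi>] C unfolding h_def nth K_def by (simp add: field_simps)
    qed
    then show ?thesis using C by simp
  qed
  define S where "S g xs = (SUP \<phi>\<in>K. apply_bcontfun g \<phi> + h xs \<phi>)" for g :: "('a \<Rightarrow> 'k) \<Rightarrow>\<^sub>C real" and xs
  have h_bdd: "h xs \<phi> \<le> C * (\<Sum>x\<leftarrow>xs. norm x)" if "\<phi> \<in> K" for xs \<phi>
    unfolding h_def using that C dual_ball_norm_le by (intro mult_left_mono sum_list_mono) (auto simp: K_def)
  have g_bdd: "\<bar>apply_bcontfun g \<phi>\<bar> \<le> norm g" for g :: "('a \<Rightarrow> 'k) \<Rightarrow>\<^sub>C real" and \<phi>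
    using norm_bounded[of g \<phi>] by simp
  have S_upper: "apply_bcontfun g \<phi> + h xs \<phi> \<le> S g xs" if "\<phi> \<in> K" for g xs \<phi>
    unfolding S_def
  proof (rule cSUP_upper[OF that])
    show "bdd_above ((\<lambda>\<phi>. apply_bcontfun g \<phi> + h xs \<phi>) ` K)"
      using h_bdd[of _ xs] g_bdd[of g] by (intro bdd_aboveI[of _ "norm g + C * (\<Sum>x\<leftarrow>xs. norm x)"])
        (auto simp: abs_le_iff intro: add_mono)
  qed
  have S_least: "S g xs \<le> c" if "\<And>\<phi>. \<phi> \<in> K \<Longrightarrow> apply_bcontfun g \<phi> + h xs \<phi> \<le> c" for g xs c
    unfolding S_def using K that by (rule cSUP_least)
  define p where "p g = (INF xs\<in>UNIV. S g xs - e xs)" for g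
  \<comment> \<open>Here the summing inequality is used: it keeps the infimum defining
    \<open>p\<close> finite.\<close>
  have lower: "- norm g \<le> S g xs - e xs" for g xs
  proof -
    have "e xs \<le> S g xs + norm g"
    proof (rule summing')
      fix \<phi> assume "\<phi> \<in> K"
      then show "h xs \<phi> \<le> S g xs + norm g" using S_upper[of \<phi> g xs] g_bdd[of g \<phi>] by simp
    qed
    then show ?thesis by simp
  qed
  have p_le: "p g \<le> S g xs - e xs" for g xs
    unfolding p_def using lower by (intro cINF_lower bdd_belowI2) auto
  have p_greatest: "c \<le> p g" if "\<And>xs. c \<le> S g xs - e xs" for g c
    unfolding p_def by (rule cINF_greatest) (use that in auto)
  have "sublinear_fun p"
  proof (rule sublinear_funI)
    fix f g
    have *: "p (f + g) \<le> (S f xs - e xs) + (S g ys - e ys)" for xs ys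
    proof -
      have "S (f + g) (xs @ ys) \<le> S f xs + S g ys"
      proof (rule S_least)
        fix \<phi> assume "\<phi> \<in> K"
        then show "apply_bcontfun (f + g) \<phi> + h (xs @ ys) \<phi> \<le> S f xs + S g ys"
          using S_upper[of \<phi> f xs] S_upper[of \<phi> g ys] by (simp add: h_def distrib_left)
      qed
      then show ?thesis using p_le[of "f + g" "xs @ ys"] by (simp add: e_def)
    qed
    have "p (f + g) - (S f xs - e xs) \<le> p g" for xs
      by (rule p_greatest) (use *[of xs] in \<open>simp add: algebra_simps\<close>)
    then have "p (f + g) - p g \<le> p f" by (intro p_greatest) (simp add: algebra_simps)
    then show "p (f + g) \<le> p f + p g" by simp
  next
    fix t :: real and g assume t: "t > 0"
    have "p (t *\<^sub>R g) / t \<le> S g xs - e xs" for xs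
    proof -
      let ?ys = "map ((*\<^sub>R) t) xs"
      have "S (t *\<^sub>R g) ?ys \<le> t * S g xs"
      proof (rule S_least)
        fix \<phi> assume \<phi>: "\<phi> \<in> K"
        then have lin: "linear \<phi>"
          unfolding K_def by (intro bounded_linear.linear dual_ball_bounded_linear)
        have "h ?ys \<phi> = t * h xs \<phi>"
          using lin t by (simp add: h_def o_def linear_scale sum_list_const_mult)
        then have "apply_bcontfun (t *\<^sub>R g) \<phi> + h ?ys \<phi> = t * (apply_bcontfun g \<phi> + h xs \<phi>)"
          by (simp add: distrib_left)
        also have "\<dots> \<le> t * S g xs" using S_upper[OF \<phi>] t by (intro mult_left_mono) auto
        finally show "apply_bcontfun (t *\<^sub>R g) \<phi> + h ?ys \<phi> \<le> t * S g xs" .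
      qed
      moreover have "e ?ys = t * e xs" using N(2) t by (simp add: e_def o_def sum_list_const_mult)
      ultimately have "p (t *\<^sub>R g) \<le> t * (S g xs - e xs)"
        using p_le[of "t *\<^sub>R g" ?ys] by (simp add: right_diff_distrib)
      then show ?thesis using t by (simp add: field_simps)
    qed
    then have "p (t *\<^sub>R g) / t \<le> p g" by (rule p_greatest)
    then show "p (t *\<^sub>R g) \<le> t * p g" using t by (simp add: field_simps)
  qed
  then obtain l where l: "linear l" "\<And>g. l g \<le> p g" by (rule hahn_banach_sublinear) blast
  define \<Lambda> where "\<Lambda> f = l (Bcontfun f)" for f
  have app: "apply_bcontfun (Bcontfun f) = f" if "f \<in> bcontfun" for f :: "('a \<Rightarrow> 'k) \<Rightarrow> real"
    by (rule Bcontfun_inverse[OF that])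
  have \<Lambda>_scale: "\<Lambda> (\<lambda>x. c * f x) = c * \<Lambda> f" if f: "f \<in> bcontfun" for f c
  proof -
    have "Bcontfun (\<lambda>x. c * f x) = c *\<^sub>R Bcontfun f"
      by (rule bcontfun_eqI) (simp add: app f bcontfun_cmult)
    then show ?thesis using l(1) by (simp add: \<Lambda>_def linear_scale)
  qed
  interpret normalized_positive_functional K \<Lambda>
  proof
    show "compact K" unfolding K_def by (rule compact_dual_ball)
  next
    fix U and z :: "'a \<Rightarrow> 'k" assume "open U" "z \<in> U"
    then show "\<exists>g::('a \<Rightarrow> 'k) \<Rightarrow> real. continuous_on UNIV g \<and>
      (\<forall>x. 0 \<le> g x \<and> g x \<le> 1) \<and> g z = 1 \<and> (\<forall>x. x \<notin> U \<longrightarrow> g x = 0)"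
      by (rule completely_regular_fun_space)
  next
    fix f g :: "('a \<Rightarrow> 'k) \<Rightarrow> real" assume fg: "f \<in> bcontfun" "g \<in> bcontfun"
    have "Bcontfun (\<lambda>x. f x + g x) = Bcontfun f + Bcontfun g"
      by (rule bcontfun_eqI) (simp add: app fg bcontfun_add)
    then show "\<Lambda> (\<lambda>x. f x + g x) = \<Lambda> f + \<Lambda> g" using l(1) by (simp add: \<Lambda>_def linear_add)
  next
    fix f :: "('a \<Rightarrow> 'k) \<Rightarrow> real" and c assume f: "f \<in> bcontfun" "\<And>x. x \<in> K \<Longrightarrow> f x \<le> c"
    have "p (Bcontfun f) \<le> S (Bcontfun f) [] - e []" by (rule p_le)
    also have "\<dots> \<le> c" using S_least[of "Bcontfun f" "[]" c] f by (simp add: e_def h_def app)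
    finally show "\<Lambda> f \<le> c" unfolding \<Lambda>_def using l(2) order_trans by blast
  qed (rule \<Lambda>_scale)
  show ?thesis
  proof (intro exI[of _ riesz_measure] conjI allI)
    show "regular_borel_prob (weak_star_ball sE) riesz_measure"
      using regular_riesz by (simp add: weak_star_ball_eq K_def)
    fix x :: 'a
    \<comment> \<open>On the ambient space \<open>norm (\<phi> x)\<close> is unbounded; truncating
      it at \<open>norm x\<close> changes nothing on \<open>K\<close>.\<close>
    define b where "b \<phi> = min (norm (\<phi> x)) (norm x)" for \<phi> :: "'a \<Rightarrow> 'k"
    have bc: "continuous_on UNIV b"
      unfolding b_def by (intro continuous_intros continuous_on_product_coordinates)
    have bb: "b \<in> bcontfun"
      using bc by (rule bcontfun_boundedI[where b = "norm x"]) (auto simp: b_def)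
    have bK: "b \<phi> = norm (\<phi> x)" if "\<phi> \<in> K" for \<phi>
      using dual_ball_norm_le that by (simp add: b_def K_def)
    have mb: "(\<lambda>\<phi>. (- C) * b \<phi>) \<in> bcontfun" by (rule bcontfun_cmult[OF bb])
    \<comment> \<open>With the test function - C b and the list [x] the supremum is at most 0, so
      \<open>p\<close> is at most \<open>- N x\<close>, which is the desired inequality up to
      sign.\<close>
    have "S (Bcontfun (\<lambda>\<phi>. (- C) * b \<phi>)) [x] \<le> 0"
      by (rule S_least, unfold app[OF mb]) (simp add: h_def bK)
    then have "\<Lambda> (\<lambda>\<phi>. (- C) * b \<phi>) \<le> - N x"
      using l(2)[of "Bcontfun (\<lambda>\<phi>. (- C) * b \<phi>)"] p_le[of "Bcontfun (\<lambda>\<phi>. (- C) * b \<phi>)" "[x]"]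
      by (simp add: \<Lambda>_def e_def)
    then have "N x \<le> C * \<Lambda> b" unfolding \<Lambda>_scale[OF bb] by simp
    also have "\<dots> \<le> C * (LINT \<phi>|riesz_measure. b \<phi>)"
      using C by (intro mult_left_mono riesz_integral[OF bc, of "norm x"]) (auto simp: b_def)
    also have "(LINT \<phi>|riesz_measure. b \<phi>) = (LINT \<phi>|riesz_measure. norm (\<phi> x))"
      by (rule Bochner_Integration.integral_cong) (auto simp: bK)
    finally show "N x \<le> C * (LINT \<phi>|riesz_measure. norm (\<phi> x))" .
  qed
qed

end

section \<open>Polarization\<close>

lemma sum_PiE_Suc:
  fixes g :: "(nat \<Rightarrow> 'i) \<Rightarrow> 'b::comm_monoid_add"
  shows "(\<Sum>f\<in>{..<Suc m} \<rightarrow>\<^sub>E S. g f) = (\<Sum>s\<in>S. \<Sum>f\<in>{..<m} \<rightarrow>\<^sub>E S. g (f(m := s)))"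
proof -
  have eq: "{..<Suc m} \<rightarrow>\<^sub>E S = (\<lambda>(s, f). f(m := s)) ` (S \<times> ({..<m} \<rightarrow>\<^sub>E S))"
    unfolding lessThan_Suc by (rule PiE_insert_eq)
  have inj: "inj_on (\<lambda>(s, f). f(m := s)) (S \<times> ({..<m} \<rightarrow>\<^sub>E S))"
    by (rule inj_combinator) simp
  show ?thesis
    unfolding eq sum.reindex[OF inj] by (simp add: sum.cartesian_product case_prod_beta o_def)
qed

text \<open>Sets with and without a fixed point of \<open>I - R\<close> cancel in pairs.\<close>

lemma sum_alternating_between:
  assumes I: "finite I" and R: "R \<subset> I"
  shows "(\<Sum>S\<in>{S. R \<subseteq> S \<and> S \<subseteq> I}. (- 1 :: real) ^ card S) = 0"
proof -
  obtain a where a: "a \<in> I" "a \<notin> R" using R by auto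
  define M where "M = {S. R \<subseteq> S \<and> S \<subseteq> I - {a}}"
  have fin: "finite M" unfolding M_def by (rule finite_subset[of _ "Pow I"]) (use I in auto)
  have "{S. R \<subseteq> S \<and> S \<subseteq> I} = M \<union> insert a ` M"
  proof (intro equalityI subsetI)
    fix S assume S: "S \<in> {S. R \<subseteq> S \<and> S \<subseteq> I}"
    show "S \<in> M \<union> insert a ` M"
    proof (cases "a \<in> S")
      case True
      then have "S = insert a (S - {a})" "S - {a} \<in> M" using S a by (auto simp: M_def)
      then show ?thesis by blast
    qed (use S in \<open>auto simp: M_def\<close>)
  qed (use a in \<open>auto simp: M_def\<close>)
  moreover have "M \<inter> insert a ` M = {}" by (auto simp: M_def)
  moreover have "inj_on (insert a) M" by (auto simp: inj_on_def M_def)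
  moreover have "card (insert a S) = Suc (card S)" if "S \<in> M" for S
    using that I finite_subset[of S I] by (subst card_insert_disjoint) (auto simp: M_def)
  ultimately show ?thesis
    using fin by (simp add: sum.union_disjoint sum.reindex sum_negf)
qed

section \<open>Multilinear maps and polar forms\<close>

locale banach_pair = E: banach_over sE + F: banach_over sF
  for sE :: "'k::real_or_complex \<Rightarrow> 'a::banach \<Rightarrow> 'a" and sF :: "'k \<Rightarrow> 'b::banach \<Rightarrow> 'b"
begin

lemma linear_iff:
  "Vector_Spaces.linear sE sF f \<longleftrightarrow> (\<forall>x y. f (x + y) = f x + f y) \<and> (\<forall>c x. f (sE c x) = sF c (f x))"
  using E.vector_space_axioms F.vector_space_axioms
  by (auto simp: Vector_Spaces.linear_def module_hom_def module_hom_axioms_def module_iff_vector_space)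

lemma scaleR_right_commute: "sF c (a *\<^sub>R y) = a *\<^sub>R sF c y"
  by (metis F.scale_of_real F.scale_left_commute)

lemma multilinear_cong:
  "multilinear_map sE sF n A \<Longrightarrow> (\<And>i. i < n \<Longrightarrow> x i = y i) \<Longrightarrow> A x = A y"
  by (auto simp: multilinear_map_def)

lemma multilinear_linear:
  assumes "multilinear_map sE sF n A" "i < n"
  shows "linear (\<lambda>t. A (x(i := t)))"
proof -
  have lin: "Vector_Spaces.linear sE sF (\<lambda>t. A (x(i := t)))"
    using assms by (simp add: multilinear_map_def)
  then show ?thesis
    unfolding linear_iff by (intro linearI) (simp_all add: E.scale_of_real[symmetric] F.scale_of_real[symmetric])
qed

lemma multilinear_homogeneous:
  assumes A: "multilinear_map sE sF n A"
  shows "A (\<lambda>i. c *\<^sub>R x i) = c ^ n *\<^sub>R A x"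
proof -
  have "A (\<lambda>i. if i < m then c *\<^sub>R x i else x i) = c ^ m *\<^sub>R A x" if "m \<le> n" for m
    using that
  proof (induction m)
    case (Suc m)
    let ?y = "\<lambda>i. if i < m then c *\<^sub>R x i else x i"
    have "A (\<lambda>i. if i < Suc m then c *\<^sub>R x i else x i) = A (?y(m := c *\<^sub>R x m))"
      by (rule arg_cong[where f = A]) (auto simp: less_Suc_eq)
    also have "\<dots> = c *\<^sub>R A (?y(m := x m))"
      using linear_scale[OF multilinear_linear[OF A, of m ?y], of c "x m"] Suc.prems by simp
    also have "?y(m := x m) = ?y" by auto
    finally show ?case using Suc by simp
  qed simp
  moreover have "A (\<lambda>i. c *\<^sub>R x i) = A (\<lambda>i. if i < n then c *\<^sub>R x i else x i)"
    by (rule multilinear_cong[OF A]) simp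
  ultimately show ?thesis by simp
qed

lemma multilinear_expand:
  assumes A: "multilinear_map sE sF n A"
  shows "A (\<lambda>_. \<Sum>s\<in>S. z s) = (\<Sum>f\<in>{..<n} \<rightarrow>\<^sub>E S. A (\<lambda>i. z (f i)))"
proof -
  \<comment> \<open>Entries are expanded one at a time. The tail \<open>w\<close> must vary, because
    each choice for entry m is moved into it before the induction hypothesis applies.\<close>
  have "A (\<lambda>i. if i < m then \<Sum>s\<in>S. z s else w i) =
      (\<Sum>f\<in>{..<m} \<rightarrow>\<^sub>E S. A (\<lambda>i. if i < m then z (f i) else w i))" if "m \<le> n" for m w
    using that
  proof (induction m arbitrary: w)
    case (Suc m)
    let ?y = "\<lambda>i. if i < m then \<Sum>s\<in>S. z s else w i"
    have "A (\<lambda>i. if i < Suc m then \<Sum>s\<in>S. z s else w i) = A (?y(m := \<Sum>s\<in>S. z s))"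
      by (rule arg_cong[where f = A]) (auto simp: less_Suc_eq)
    also have "\<dots> = (\<Sum>s\<in>S. A (?y(m := z s)))"
      using linear_sum[OF multilinear_linear[OF A, of m ?y], of z S] Suc.prems by simp
    also have "\<dots> = (\<Sum>s\<in>S. A (\<lambda>i. if i < m then \<Sum>s\<in>S. z s else (w(m := z s)) i))"
      by (intro sum.cong arg_cong[where f = A]) auto
    also have "\<dots> = (\<Sum>s\<in>S. \<Sum>f\<in>{..<m} \<rightarrow>\<^sub>E S. A (\<lambda>i. if i < m then z (f i) else (w(m := z s)) i))"
      using Suc.prems by (intro sum.cong refl Suc.IH) simp
    also have "\<dots> = (\<Sum>s\<in>S. \<Sum>f\<in>{..<m} \<rightarrow>\<^sub>E S. A (\<lambda>i. if i < Suc m then z ((f(m := s)) i) else w i))"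
      by (intro sum.cong refl arg_cong[where f = A] ext) (simp add: less_Suc_eq)
    also have "\<dots> = (\<Sum>f\<in>{..<Suc m} \<rightarrow>\<^sub>E S. A (\<lambda>i. if i < Suc m then z (f i) else w i))"
      by (rule sum_PiE_Suc[symmetric])
    finally show ?case .
  qed simp
  from this[of n "\<lambda>_. 0"] have "A (\<lambda>i. if i < n then \<Sum>s\<in>S. z s else 0) =
      (\<Sum>f\<in>{..<n} \<rightarrow>\<^sub>E S. A (\<lambda>i. if i < n then z (f i) else 0))" by simp
  moreover have "A (\<lambda>_. \<Sum>s\<in>S. z s) = A (\<lambda>i. if i < n then \<Sum>s\<in>S. z s else 0)"
    by (rule multilinear_cong[OF A]) simp
  moreover have "A (\<lambda>i. z (f i)) = A (\<lambda>i. if i < n then z (f i) else 0)" for f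
    by (rule multilinear_cong[OF A]) simp
  ultimately show ?thesis by simp
qed

text \<open>The polarization formula over subset sums, a variant of the one over signs. As a finite
  combination of values of \<open>P\<close> it inherits continuity and bounds from
  \<open>P\<close>.\<close>

definition polarization :: "nat \<Rightarrow> ('a \<Rightarrow> 'b) \<Rightarrow> (nat \<Rightarrow> 'a) \<Rightarrow> 'b"
  where "polarization n P x = ((- 1) ^ n / fact n) *\<^sub>R (\<Sum>S\<in>Pow {..<n}. (- 1) ^ card S *\<^sub>R P (\<Sum>i\<in>S. x i))"

text \<open>Expanding each value at a subset sum produces maps f of the index set into itself; f
  occurs, with sign, once for every S containing its image. These signs cancel unless f is onto, so
  only permutations remain.\<close>

lemma polarization_eq:
  assumes A: "multilinear_map sE sF n A" and P: "\<And>x. P x = A (\<lambda>_. x)"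
  shows "polarization n P x = (1 / fact n) *\<^sub>R (\<Sum>\<sigma> | \<sigma> permutes {..<n}. A (x \<circ> \<sigma>))"
proof -
  let ?I = "{..<n}"
  let ?\<Phi> = "?I \<rightarrow>\<^sub>E ?I"
  have fin\<Phi>: "finite ?\<Phi>" by (intro finite_PiE) auto
  have "(\<Sum>S\<in>Pow ?I. (- 1) ^ card S *\<^sub>R P (\<Sum>i\<in>S. x i)) =
      (\<Sum>S\<in>Pow ?I. \<Sum>f\<in>?\<Phi>. if f ` ?I \<subseteq> S then (- 1) ^ card S *\<^sub>R A (x \<circ> f) else 0)"
  proof (rule sum.cong)
    fix S assume S: "S \<in> Pow ?I"
    have "?I \<rightarrow>\<^sub>E S = {f\<in>?\<Phi>. f ` ?I \<subseteq> S}" using S by (auto simp: PiE_def)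
    then show "(- 1) ^ card S *\<^sub>R P (\<Sum>i\<in>S. x i) =
        (\<Sum>f\<in>?\<Phi>. if f ` ?I \<subseteq> S then (- 1) ^ card S *\<^sub>R A (x \<circ> f) else 0)"
      using fin\<Phi> unfolding P multilinear_expand[OF A]
      by (simp add: scaleR_sum_right sum.inter_filter[symmetric] o_def)
  qed simp
  also have "\<dots> = (\<Sum>f\<in>?\<Phi>. \<Sum>S\<in>Pow ?I. if f ` ?I \<subseteq> S then (- 1) ^ card S *\<^sub>R A (x \<circ> f) else 0)"
    by (rule sum.swap)
  also have "\<dots> = (\<Sum>f\<in>?\<Phi>. if f ` ?I = ?I then (- 1) ^ n *\<^sub>R A (x \<circ> f) else 0)"
  proof (rule sum.cong)
    fix f assume f: "f \<in> ?\<Phi>"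
    have "(\<Sum>S\<in>Pow ?I. if f ` ?I \<subseteq> S then (- 1) ^ card S *\<^sub>R A (x \<circ> f) else 0) =
        (\<Sum>S\<in>{S. f ` ?I \<subseteq> S \<and> S \<subseteq> ?I}. (- 1) ^ card S *\<^sub>R A (x \<circ> f))"
    proof -
      have "{S. f ` ?I \<subseteq> S \<and> S \<subseteq> ?I} = {S \<in> Pow ?I. f ` ?I \<subseteq> S}" by auto
      then show ?thesis by (simp only: sum.inter_filter finite_Pow_iff finite_lessThan)
    qed
    also have "\<dots> = (\<Sum>S\<in>{S. f ` ?I \<subseteq> S \<and> S \<subseteq> ?I}. (- 1) ^ card S) *\<^sub>R A (x \<circ> f)"
      by (simp add: scaleR_sum_left)
    also have "\<dots> = (if f ` ?I = ?I then (- 1) ^ n *\<^sub>R A (x \<circ> f) else 0)"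
    proof (cases "f ` ?I = ?I")
      case True
      then have "{S. f ` ?I \<subseteq> S \<and> S \<subseteq> ?I} = {?I}" by auto
      then show ?thesis using True by simp
    next
      case False
      then have "f ` ?I \<subset> ?I" using f by auto
      then show ?thesis using False sum_alternating_between[of ?I "f ` ?I"] by simp
    qed
    finally show "(\<Sum>S\<in>Pow ?I. if f ` ?I \<subseteq> S then (- 1) ^ card S *\<^sub>R A (x \<circ> f) else 0) =
        (if f ` ?I = ?I then (- 1) ^ n *\<^sub>R A (x \<circ> f) else 0)" .
  qed simp
  also have "\<dots> = (\<Sum>f\<in>{f\<in>?\<Phi>. f ` ?I = ?I}. (- 1) ^ n *\<^sub>R A (x \<circ> f))"
    using fin\<Phi> by (simp add: sum.inter_filter)
  also have "\<dots> = (\<Sum>\<sigma> | \<sigma> permutes ?I. (- 1) ^ n *\<^sub>R A (x \<circ> \<sigma>))"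
  \<comment> \<open>Extensional maps are undefined outside the index set, permutations are the
    identity there; \<open>A\<close> does not see those entries.\<close>
  proof (rule sum.reindex_bij_witness[where i = "\<lambda>\<sigma>. restrict \<sigma> ?I" and j = "\<lambda>f i. if i < n then f i else i"])
    fix f assume f: "f \<in> {f\<in>?\<Phi>. f ` ?I = ?I}"
    show "restrict (\<lambda>i. if i < n then f i else i) ?I = f"
      using f by (auto simp: restrict_def PiE_def extensional_def fun_eq_iff)
    have "inj_on f ?I" using f by (intro eq_card_imp_inj_on) auto
    then have "bij_betw (\<lambda>i. if i < n then f i else i) ?I ?I"
      using f by (subst bij_betw_cong[where g = f]) (auto simp: bij_betw_def)
    then have "(\<lambda>i. if i < n then f i else i) permutes ?I"
      by (rule bij_imp_permutes) simp
    then show "(\<lambda>i. if i < n then f i else i) \<in> {\<sigma>. \<sigma> permutes ?I}" by simp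
    show "(- 1) ^ n *\<^sub>R A (x \<circ> (\<lambda>i. if i < n then f i else i)) = (- 1) ^ n *\<^sub>R A (x \<circ> f)"
      by (intro arg_cong[where f = "(*\<^sub>R) _"] multilinear_cong[OF A]) simp
  next
    fix \<sigma> assume "\<sigma> \<in> {\<sigma>. \<sigma> permutes ?I}"
    then have \<sigma>: "\<sigma> permutes ?I" by simp
    show "(\<lambda>i. if i < n then restrict \<sigma> ?I i else i) = \<sigma>"
      using permutes_not_in[OF \<sigma>] by (auto simp: fun_eq_iff)
    show "restrict \<sigma> ?I \<in> {f\<in>?\<Phi>. f ` ?I = ?I}"
      using permutes_image[OF \<sigma>] permutes_in_image[OF \<sigma>] by (auto simp: image_restrict_eq)
  qed
  finally show ?thesis
    unfolding polarization_def
    by (simp add: scaleR_sum_right[symmetric] power_mult_distrib[symmetric])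
qed

text \<open>\<open>polar_form\<close> is a definite description, so existence and uniqueness are
  due. The formula symmetrizes any \<open>A\<close> representing \<open>P\<close>, and it returns a
  symmetric representing map unchanged.\<close>

lemma polar_form_eq_polarization:
  assumes P: "P \<in> cont_hom_polys sE sF n"
  shows "polar_form sE sF n P = polarization n P" "multilinear_map sE sF n (polarization n P)"
proof -
  obtain A where A: "multilinear_map sE sF n A" and PA: "\<And>x. P x = A (\<lambda>_. x)"
    and contP: "continuous_on UNIV P" using P unfolding cont_hom_polys_def by blast
  let ?B = "polarization n P"
  let ?I = "{..<n}"
  have B: "?B x = (1 / fact n) *\<^sub>R (\<Sum>\<sigma> | \<sigma> permutes ?I. A (x \<circ> \<sigma>))" for x
    using polarization_eq[OF A, of P x] PA by simp
  have perm_le: "\<sigma> i < n" if "\<sigma> permutes ?I" "i < n" for \<sigma> i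
    using permutes_in_image[OF that(1), of i] that(2) by simp
  show mult: "multilinear_map sE sF n ?B"
    unfolding multilinear_map_def
  proof (intro conjI allI impI)
    fix x y :: "nat \<Rightarrow> 'a" assume "\<forall>i<n. x i = y i"
    then show "?B x = ?B y"
      unfolding B using perm_le
      by (intro arg_cong[where f = "(*\<^sub>R) _"] sum.cong multilinear_cong[OF A]) auto
  next
    fix i and x :: "nat \<Rightarrow> 'a" assume i: "i < n"
    \<comment> \<open>Entry i of \<open>x\<close> sits at position \<open>inv \<sigma> i\<close>
      after composition with \<sigma>, and linearity of \<open>A\<close> is applied in that
      position.\<close>
    have upd: "A (x(i := t) \<circ> \<sigma>) = A ((x \<circ> \<sigma>)(inv \<sigma> i := t))" if "\<sigma> permutes ?I" for t \<sigma>
    proof -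
      have "x(i := t) \<circ> \<sigma> = (x \<circ> \<sigma>)(inv \<sigma> i := t)"
        using permutes_inverses[OF that] permutes_inj[OF that] by (auto simp: fun_eq_iff)
      then show ?thesis by simp
    qed
    have "Vector_Spaces.linear sE sF (\<lambda>t. A (x(i := t) \<circ> \<sigma>))" if "\<sigma> permutes ?I" for \<sigma>
      using A perm_le[OF permutes_inv[OF that] i] unfolding upd[OF that] multilinear_map_def by blast
    then have lin: "A (x(i := s + t) \<circ> \<sigma>) = A (x(i := s) \<circ> \<sigma>) + A (x(i := t) \<circ> \<sigma>)"
      "A (x(i := sE c t) \<circ> \<sigma>) = sF c (A (x(i := t) \<circ> \<sigma>))" if "\<sigma> permutes ?I" for \<sigma> s t c
      using that unfolding linear_iff by blast+
    show "Vector_Spaces.linear sE sF (\<lambda>t. ?B (x(i := t)))"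
      unfolding linear_iff B
      by (simp add: lin sum.distrib scaleR_add_right F.scale_sum_right scaleR_right_commute)
  qed
  \<comment> \<open>\<open>A\<close> comes without continuity; the formula in terms of
    \<open>P\<close> supplies it.\<close>
  have cont: "continuous_on UNIV ?B"
    unfolding polarization_def
    by (intro continuous_intros continuous_on_compose2[OF contP] continuous_on_product_coordinates) auto
  have sym: "?B (x \<circ> \<tau>) = ?B x" if \<tau>: "\<tau> permutes ?I" for \<tau> x
  proof -
    have "(\<Sum>\<sigma> | \<sigma> permutes ?I. A (x \<circ> \<tau> \<circ> \<sigma>)) = (\<Sum>\<sigma> | \<sigma> permutes ?I. A (x \<circ> \<sigma>))"
      using setum_permutations_compose_left[OF \<tau>, of "\<lambda>\<sigma>. A (x \<circ> \<sigma>)"] by (simp add: o_assoc)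
    then show ?thesis by (simp add: B)
  qed
  have nperm: "card {\<sigma>. \<sigma> permutes ?I} = fact n"
    by (rule card_permutations) auto
  have diag: "?B (\<lambda>_. x) = P x" for x
    unfolding B by (simp add: o_def PA[symmetric] nperm scaleR_conv_of_real[symmetric] sum_constant_scaleR)
  have uniq: "C = ?B" if C: "multilinear_map sE sF n C"
    "\<forall>\<sigma> x. \<sigma> permutes ?I \<longrightarrow> C (x \<circ> \<sigma>) = C x" "\<forall>x. P x = C (\<lambda>_. x)" for C
  proof
    fix x
    have "?B x = (1 / fact n) *\<^sub>R (\<Sum>\<sigma> | \<sigma> permutes ?I. C (x \<circ> \<sigma>))"
      using C(3) by (intro polarization_eq[OF C(1)]) auto
    also have "\<dots> = (1 / fact n) *\<^sub>R (\<Sum>\<sigma> | \<sigma> permutes ?I. C x)" using C(2) by simp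
    also have "\<dots> = C x" by (simp add: nperm sum_constant_scaleR)
    finally show "C x = ?B x" by simp
  qed
  show "polar_form sE sF n P = ?B"
    unfolding polar_form_def
  proof (rule the_equality)
    show "multilinear_map sE sF n ?B \<and> continuous_on UNIV ?B \<and>
      (\<forall>\<sigma> x. \<sigma> permutes ?I \<longrightarrow> ?B (x \<circ> \<sigma>) = ?B x) \<and> (\<forall>x. P x = ?B (\<lambda>_. x))"
      using mult cont sym diag[symmetric] by blast
  qed (use uniq in blast)
qed

text \<open>Continuity bounds \<open>P\<close> on a small ball around 0, and homogeneity transports
  the bound. The term \<open>norm (P 0)\<close> covers n = 0, where \<open>P 0\<close> may be
  nonzero.\<close>

lemma hom_poly_bounded:
  assumes P: "P \<in> cont_hom_polys sE sF n"
  shows "\<exists>M. \<forall>y. norm y \<le> b \<longrightarrow> norm (P y) \<le> M"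
proof -
  obtain A where A: "multilinear_map sE sF n A" and PA: "\<And>x. P x = A (\<lambda>_. x)"
    and contP: "continuous_on UNIV P" using P unfolding cont_hom_polys_def by blast
  have hom: "P (c *\<^sub>R y) = c ^ n *\<^sub>R P y" for c y
    using multilinear_homogeneous[OF A, of c "\<lambda>_. y"] by (simp add: PA)
  have "\<exists>d>0. \<forall>y. dist y 0 < d \<longrightarrow> dist (P y) (P 0) < 1"
    using contP[unfolded continuous_on_iff, rule_format, of 0 1] by simp
  then obtain d where d: "d > 0" "\<And>y. norm y < d \<Longrightarrow> dist (P y) (P 0) < 1" by auto
  define c where "c = 2 * (\<bar>b\<bar> + 1) / d"
  have c: "c > 0" using d(1) by (simp add: c_def add_pos_pos)
  show ?thesis
  proof (intro exI[of _ "c ^ n * (1 + norm (P 0))"] allI impI)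
    fix y :: 'a assume y: "norm y \<le> b"
    have "norm ((1 / c) *\<^sub>R y) < d"
    proof -
      have "c * d = 2 * (\<bar>b\<bar> + 1)" using d(1) by (simp add: c_def)
      moreover have "b < 2 * (\<bar>b\<bar> + 1)" by (cases "b \<ge> 0") auto
      ultimately have "norm y < c * d" using y by simp
      then have "norm y / c < d" using c by (simp add: divide_less_eq mult.commute)
      moreover have "norm ((1 / c) *\<^sub>R y) = norm y / c" using c by simp
      ultimately show ?thesis by (simp only:)
    qed
    from d(2)[OF this] have le: "norm (P ((1 / c) *\<^sub>R y)) \<le> 1 + norm (P 0)"
      using norm_triangle_sub[of "P ((1 / c) *\<^sub>R y)" "P 0"] by (simp add: dist_norm)
    have "P y = P (c *\<^sub>R ((1 / c) *\<^sub>R y))" using c by simp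
    also have "\<dots> = c ^ n *\<^sub>R P ((1 / c) *\<^sub>R y)" by (rule hom)
    finally have "norm (P y) = c ^ n * norm (P ((1 / c) *\<^sub>R y))" using c by simp
    also have "\<dots> \<le> c ^ n * (1 + norm (P 0))" using le c by (intro mult_left_mono) auto
    finally show "norm (P y) \<le> c ^ n * (1 + norm (P 0))" .
  qed
qed

text \<open>The supremum in \<open>multilinear_norm\<close> is meaningful for a slice only when its
  values on the unit ball are bounded.\<close>

lemma polarization_slice_bounded:
  assumes P: "P \<in> cont_hom_polys sE sF n" and i: "i < n"
  shows "\<exists>M. \<forall>y. (\<forall>j<n - 1. norm (y j) \<le> 1) \<longrightarrow> norm (polarization n P (insert_arg i t y)) \<le> M"
proof -
  define b where "b = real n * (1 + norm t)"
  obtain M where M: "\<And>y. norm y \<le> b \<Longrightarrow> norm (P y) \<le> M"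
    using hom_poly_bounded[OF P, of b] by blast
  show ?thesis
  proof (intro exI[of _ "1 / fact n * (\<Sum>S\<in>Pow {..<n}. M)"] allI impI)
    fix y :: "nat \<Rightarrow> 'a" assume y: "\<forall>j<n - 1. norm (y j) \<le> 1"
    let ?z = "insert_arg i t y"
    have z: "norm (?z j) \<le> 1 + norm t" if "j < n" for j
      using y that i by (auto simp: insert_arg_def intro: order_trans[of _ 1])
    have "norm (\<Sum>j\<in>S. ?z j) \<le> b" if S: "S \<in> Pow {..<n}" for S
    proof -
      have "norm (\<Sum>j\<in>S. ?z j) \<le> (\<Sum>j\<in>S. 1 + norm t)"
        using S z by (intro sum_norm_le) auto
      also have "\<dots> = real (card S) * (1 + norm t)" by simp
      also have "\<dots> \<le> b"
        unfolding b_def using S card_mono[of "{..<n}" S] by (intro mult_right_mono) auto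
      finally show ?thesis .
    qed
    then have "norm (\<Sum>S\<in>Pow {..<n}. (- 1) ^ card S *\<^sub>R P (\<Sum>i\<in>S. ?z i)) \<le> (\<Sum>S\<in>Pow {..<n}. M)"
      by (intro sum_norm_le) (simp add: M norm_power)
    then show "norm (polarization n P ?z) \<le> 1 / fact n * (\<Sum>S\<in>Pow {..<n}. M)"
      by (simp add: polarization_def norm_power divide_right_mono)
  qed
qed

end

section \<open>Coincidence of the polynomial classes\<close>

context banach_over
begin

lemma weak_norm_upper:
  fixes x :: "nat \<Rightarrow> 'a"
  assumes "p > 0" "\<phi> \<in> dual_ball sE"
  shows "(\<Sum>j=1..k. norm (\<phi> (x j)) powr p) powr (1 / p) \<le>
    (SUP \<phi>\<in>dual_ball sE. (\<Sum>j=1..k. norm (\<phi> (x j)) powr p) powr (1 / p))"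
proof (rule cSUP_upper[OF assms(2)])
  show "bdd_above ((\<lambda>\<phi>. (\<Sum>j=1..k. norm (\<phi> (x j)) powr p) powr (1 / p)) ` dual_ball sE)"
    using assms(1)
    by (intro bdd_aboveI2[where M = "(\<Sum>j=1..k. norm (x j) powr p) powr (1 / p)"] powr_mono2 sum_mono sum_nonneg)
      (auto simp: dual_ball_norm_le)
qed

text \<open>Linearity and boundedness do not involve the exponent, so only the summing inequalities
  are compared. From r to 1 the factorization is used, from 1 to r the classical inclusion argument
  through Hoelder's inequality.\<close>

lemma abs_summing_cotype_iff:
  fixes u :: "'a \<Rightarrow> 'g::ab_group_add"
  assumes cotype: "has_cotype TYPE('a) q" and q: "q > 1"
    and rs: "r > 1" "1 / r + 1 / s = 1" "s > q"
    and N: "\<And>x. N (u x) \<ge> 0" "\<And>c x. c \<ge> 0 \<Longrightarrow> N (u (c *\<^sub>R x)) = c * N (u x)"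
  shows "abs_summing sE sG N r u \<longleftrightarrow> abs_summing sE sG N 1 u"
proof -
  define w where "w p k x = (SUP \<phi>\<in>dual_ball sE. (\<Sum>j=1..k. norm (\<phi> (x j)) powr p) powr (1 / p))"
    for p :: real and k :: nat and x :: "nat \<Rightarrow> 'a"
  define Q where "Q p \<longleftrightarrow> (\<exists>C\<ge>0. \<forall>k x. (\<Sum>j=1..k. N (u (x j)) powr p) powr (1 / p) \<le> C * w p k x)" for p
  have ne: "dual_ball sE \<noteq> {}" using zero_in_dual_ball by blast
  have "Q 1" if Qr: "Q r"
  proof -
    obtain C where C: "C \<ge> 0" "\<And>k x. (\<Sum>j=1..k. N (u (x j)) powr r) powr (1 / r) \<le> C * w r k x"
      using Qr unfolding Q_def by blast
    have D: "(\<Sum>j=1..k. N (u (y j)) powr r) \<le> C powr r * T"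
      if T: "\<And>\<phi>. \<phi> \<in> dual_ball sE \<Longrightarrow> (\<Sum>j=1..k. norm (\<phi> (y j)) powr r) \<le> T" for k :: nat and y T
    proof -
      have T0: "T \<ge> 0" using T[OF zero_in_dual_ball] by simp
      have "w r k y \<le> T powr (1 / r)"
        unfolding w_def using ne rs T by (intro cSUP_least powr_mono2 sum_nonneg) auto
      then have "C * w r k y \<le> C * T powr (1 / r)" using C(1) by (rule mult_left_mono)
      with C(2)[of y k] have "((\<Sum>j=1..k. N (u (y j)) powr r) powr (1 / r)) powr r \<le> (C * T powr (1 / r)) powr r"
        using rs by (intro powr_mono2) auto
      then show ?thesis using T0 C(1) rs by (simp add: powr_powr powr_mult sum_nonneg)
    qed
    have "\<exists>C\<ge>0. \<forall>(k::nat) x W. (\<forall>\<phi>\<in>dual_ball sE. (\<Sum>j=1..k. norm (\<phi> (x j))) \<le> W) \<longrightarrow>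
        (\<Sum>j=1..k. N (u (x j))) \<le> C * W"
      using cotype q rs N(1) N(2) D by (rule cotype_r_summing_imp_summing)
    then obtain C' where C': "C' \<ge> 0" "\<And>(k::nat) x W. (\<forall>\<phi>\<in>dual_ball sE. (\<Sum>j=1..k. norm (\<phi> (x j))) \<le> W) \<Longrightarrow>
        (\<Sum>j=1..k. N (u (x j))) \<le> C' * W"
      by blast
    have "(\<Sum>j=1..k. N (u (x j)) powr 1) powr (1 / 1) \<le> C' * w 1 k x" for k x
    proof -
      have "(\<Sum>j=1..k. N (u (x j))) \<le> C' * w 1 k x"
      proof (intro C'(2) ballI)
        fix \<phi> assume "\<phi> \<in> dual_ball sE"
        from weak_norm_upper[OF _ this, where p = 1 and k = k and x = x]
        show "(\<Sum>j=1..k. norm (\<phi> (x j))) \<le> w 1 k x" by (simp add: w_def sum_nonneg)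
      qed
      then show ?thesis using N(1) by (simp add: sum_nonneg)
    qed
    with C'(1) show ?thesis unfolding Q_def by (intro exI[of _ C'] conjI allI)
  qed
  moreover have "Q r" if Q1: "Q 1"
  proof -
    obtain C where C: "C \<ge> 0" "\<And>k x. (\<Sum>j=1..k. N (u (x j)) powr 1) powr (1 / 1) \<le> C * w 1 k x"
      using Q1 unfolding Q_def by blast
    have s: "s > 1" using rs q by simp
    have "(\<Sum>j=1..k. N (u (x j)) powr r) powr (1 / r) \<le> C * w r k x" for k x
    proof -
      define T where "T = (\<Sum>j=1..k. N (u (x j)) powr r)"
      \<comment> \<open>Multiplying \<open>x j\<close> by this weight turns a first power into
        \<open>N (u (x j)) powr r\<close>. Since (r - 1) s = r, Hoelder's inequality gives back the
        factor \<open>T powr (1 / s)\<close>, which is then cancelled.\<close>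
      define c where "c j = N (u (x j)) powr (r - 1)" for j
      have T0: "T \<ge> 0" by (auto simp: T_def intro: sum_nonneg)
      have "0 \<le> (\<Sum>j=1..k. norm ((\<lambda>_. 0 :: 'k) (x j)) powr r) powr (1 / r)" by (rule powr_ge_zero)
      also have "\<dots> \<le> w r k x"
        unfolding w_def using rs by (intro weak_norm_upper zero_in_dual_ball) auto
      finally have w0: "w r k x \<ge> 0" .
      have "T = (\<Sum>j=1..k. N (u (c j *\<^sub>R x j)))"
      proof -
        have "t powr r = t powr (r - 1) * t" if "t \<ge> 0" for t :: real
          using powr_add[of t "r - 1" 1] that by simp
        then show ?thesis using N by (simp add: T_def c_def)
      qed
      also have "\<dots> \<le> C * w 1 k (\<lambda>j. c j *\<^sub>R x j)"
        using C(2)[where k = k and x = "\<lambda>j. c j *\<^sub>R x j"] N(1) by (simp add: sum_nonneg)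
      also have "w 1 k (\<lambda>j. c j *\<^sub>R x j) \<le> T powr (1 / s) * w r k x"
        unfolding w_def[of 1]
      proof (rule cSUP_least[OF ne])
        fix \<phi> assume \<phi>: "\<phi> \<in> dual_ball sE"
        have lin: "linear \<phi>" using dual_ball_bounded_linear[OF \<phi>] by (rule bounded_linear.linear)
        have "(\<Sum>j=1..k. norm (\<phi> (c j *\<^sub>R x j)) powr 1) powr (1 / 1) = (\<Sum>j=1..k. norm (\<phi> (x j)) * c j)"
          using lin by (simp add: linear_scale c_def sum_nonneg mult.commute)
        also have "\<dots> \<le> (\<Sum>j=1..k. norm (\<phi> (x j)) powr r) powr (1 / r) * (\<Sum>j=1..k. c j powr s) powr (1 / s)"
          using rs s by (intro sum_Holder) (auto simp: c_def)
        also have "(\<Sum>j=1..k. c j powr s) = T"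
        proof -
          have "(r - 1) * s = r" using rs s by (auto simp: field_simps)
          then show ?thesis by (simp add: c_def T_def powr_powr)
        qed
        also have "(\<Sum>j=1..k. norm (\<phi> (x j)) powr r) powr (1 / r) * T powr (1 / s) \<le> w r k x * T powr (1 / s)"
          unfolding w_def using rs by (intro mult_right_mono weak_norm_upper \<phi>) auto
        finally show "(\<Sum>j=1..k. norm (\<phi> (c j *\<^sub>R x j)) powr 1) powr (1 / 1) \<le> T powr (1 / s) * w r k x"
          by (simp only: mult.commute)
      qed
      finally have le: "T \<le> T powr (1 / s) * (C * w r k x)"
        using C(1) by (simp add: mult_left_mono mult.left_commute)
      show ?thesis
      proof (cases "T = 0")
        case True
        then show ?thesis using C(1) w0 by (simp add: T_def)
      next
        case False
        with T0 have T: "T > 0" by simp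
        have "T powr (1 / s) * T powr (1 / r) = T"
          using rs T by (simp add: powr_add[symmetric] add.commute)
        with le have "T powr (1 / s) * T powr (1 / r) \<le> T powr (1 / s) * (C * w r k x)" by simp
        then have "T powr (1 / r) \<le> C * w r k x" using T by simp
        then show ?thesis unfolding T_def .
      qed
    qed
    with C(1) show ?thesis unfolding Q_def by (intro exI[of _ C] conjI allI)
  qed
  moreover have "abs_summing sE sG N p u \<longleftrightarrow> Vector_Spaces.linear sE sG u \<and> (\<exists>B. \<forall>x. N (u x) \<le> B * norm x) \<and> Q p" for p
    unfolding abs_summing_def Q_def w_def by (rule refl)
  ultimately show ?thesis by blast
qed

text \<open>\<open>regular_borel_prob\<close> prescribes the measurable sets; the underlying space
  is recovered from them.\<close>

lemma regular_borel_prob_space: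
  assumes "regular_borel_prob (weak_star_ball sE) \<mu>"
  shows "space \<mu> = dual_ball sE"
proof -
  have "sets \<mu> = sigma_sets (dual_ball sE) {U. openin (top_of_set (dual_ball sE)) U}"
    using assms by (simp add: regular_borel_prob_def weak_star_ball_eq)
  also have "\<dots> = sets (measure_of (dual_ball sE) {U. openin (top_of_set (dual_ball sE)) U} (\<lambda>_. 0))"
    by (intro sets_measure_of[symmetric]) (auto dest: openin_imp_subset)
  finally have "space \<mu> = space (measure_of (dual_ball sE) {U. openin (top_of_set (dual_ball sE)) U} (\<lambda>_. 0))"
    by (rule sets_eq_imp_space_eq)
  also have "\<dots> = dual_ball sE"
    by (intro space_measure_of) (auto dest: openin_imp_subset)
  finally show ?thesis .
qed

lemma regular_borel_prob_integrable:
  assumes \<mu>: "regular_borel_prob (weak_star_ball sE) \<mu>" and p: "p > 0"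
  shows "integrable \<mu> (\<lambda>\<phi>. norm (\<phi> x) powr p)"
proof -
  interpret prob_space \<mu> using \<mu> by (simp add: regular_borel_prob_def)
  have sp: "space \<mu> = dual_ball sE" by (rule regular_borel_prob_space[OF \<mu>])
  have "(\<lambda>\<phi>. norm (\<phi> x) powr p) \<in> borel_measurable \<mu>"
  proof (rule borel_measurableI)
    fix S :: "real set" assume S: "open S"
    have "continuous_on UNIV (\<lambda>\<phi>::'a \<Rightarrow> 'k. norm (\<phi> x) powr p)"
      using p by (intro continuous_on_powr' continuous_intros continuous_on_product_coordinates) auto
    with S have "open ((\<lambda>\<phi>::'a \<Rightarrow> 'k. norm (\<phi> x) powr p) -` S)" by (rule open_vimage)
    then have "openin (top_of_set (dual_ball sE)) (dual_ball sE \<inter> (\<lambda>\<phi>. norm (\<phi> x) powr p) -` S)"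
      by (simp add: openin_open_Int)
    then show "(\<lambda>\<phi>. norm (\<phi> x) powr p) -` S \<inter> space \<mu> \<in> sets \<mu>"
      using \<mu> unfolding sp by (auto simp: regular_borel_prob_def weak_star_ball_eq Int_commute)
  qed
  then show ?thesis
    using p by (intro integrable_const_bound[where B = "norm x powr p"])
      (auto simp: sp intro!: AE_I2 powr_mono2 dual_ball_norm_le)
qed

text \<open>Hoelder's inequality against the constant 1 on a probability space, by integrating
  Young's inequality.\<close>

lemma integral_norm_le_powr:
  assumes \<mu>: "regular_borel_prob (weak_star_ball sE) \<mu>" and r: "r > 1"
  shows "(LINT \<phi>|\<mu>. norm (\<phi> x)) \<le> (LINT \<phi>|\<mu>. norm (\<phi> x) powr r) powr (1 / r)"
proof (rule field_le_epsilon)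
  interpret prob_space \<mu> using \<mu> by (simp add: regular_borel_prob_def)
  fix e :: real assume e: "e > 0"
  define I where "I = (LINT \<phi>|\<mu>. norm (\<phi> x) powr r)"
  \<comment> \<open>The summand e avoids a division by zero when the integral vanishes.\<close>
  define J where "J = I powr (1 / r) + e"
  define s where "s = r / (r - 1)"
  have s: "s > 1" "1 / r + 1 / s = 1" using r by (auto simp: s_def field_simps)
  have I0: "I \<ge> 0" by (simp add: I_def)
  have J: "J > 0" using e by (simp add: J_def add_nonneg_pos)
  have IJ: "I \<le> J powr r"
  proof -
    have "(I powr (1 / r)) powr r \<le> J powr r" using r e by (intro powr_mono2) (auto simp: J_def)
    then show ?thesis using r I0 by (simp add: powr_powr)
  qed
  have int1: "integrable \<mu> (\<lambda>\<phi>. norm (\<phi> x))"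
    using regular_borel_prob_integrable[OF \<mu>, of 1 x] by simp
  have intr: "integrable \<mu> (\<lambda>\<phi>. norm (\<phi> x) powr r)"
    using regular_borel_prob_integrable[OF \<mu>, of r x] r by simp
  have "(LINT \<phi>|\<mu>. norm (\<phi> x) / J) \<le> (LINT \<phi>|\<mu>. norm (\<phi> x) powr r / (J powr r * r) + 1 / s)"
  proof (rule integral_mono)
    show "integrable \<mu> (\<lambda>\<phi>. norm (\<phi> x) / J)" using int1 by simp
    show "integrable \<mu> (\<lambda>\<phi>. norm (\<phi> x) powr r / (J powr r * r) + 1 / s)" using intr by simp
    fix \<phi>
    have "norm (\<phi> x) / J * 1 \<le> (norm (\<phi> x) / J) powr r / r + 1 powr s / s"
      using r s J by (intro Youngs_inequality) auto
    then show "norm (\<phi> x) / J \<le> norm (\<phi> x) powr r / (J powr r * r) + 1 / s"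
      using J by (simp add: powr_divide)
  qed
  also have "\<dots> = I / (J powr r * r) + 1 / s" using intr prob_space by (simp add: I_def)
  also have "\<dots> \<le> 1 / r + 1 / s"
    using IJ J r by (intro add_right_mono) (simp add: field_simps)
  finally show "(LINT \<phi>|\<mu>. norm (\<phi> x)) \<le> (LINT \<phi>|\<mu>. norm (\<phi> x) powr r) powr (1 / r) + e"
    using J s by (simp add: J_def I_def)
qed

lemma cotype_dominating_measure:
  assumes cotype: "has_cotype TYPE('a) q" and q: "q > 1"
    and rs: "r > 1" "1 / r + 1 / s = 1" "s > q"
    and \<mu>: "regular_borel_prob (weak_star_ball sE) \<mu>"
  obtains C \<nu> where "C > 0" "regular_borel_prob (weak_star_ball sE) \<nu>"
    "\<And>x. (LINT \<phi>|\<mu>. norm (\<phi> x) powr r) powr (1 / r) \<le> C * (LINT \<phi>|\<nu>. norm (\<phi> x))"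
proof -
  interpret prob_space \<mu> using \<mu> by (simp add: regular_borel_prob_def)
  have sp: "space \<mu> = dual_ball sE" by (rule regular_borel_prob_space[OF \<mu>])
  define N where "N x = (LINT \<phi>|\<mu>. norm (\<phi> x) powr r) powr (1 / r)" for x
  have int: "integrable \<mu> (\<lambda>\<phi>. norm (\<phi> x) powr r)" for x
    using regular_borel_prob_integrable[OF \<mu>, of r x] rs by simp
  have N0: "N x \<ge> 0" for x by (simp add: N_def)
  have Nr: "N x powr r = (LINT \<phi>|\<mu>. norm (\<phi> x) powr r)" for x
    using rs by (simp add: N_def powr_powr)
  have Nc: "N (c *\<^sub>R x) = c * N x" if "c \<ge> 0" for c x
  proof -
    have "(LINT \<phi>|\<mu>. norm (\<phi> (c *\<^sub>R x)) powr r) = (LINT \<phi>|\<mu>. c powr r * norm (\<phi> x) powr r)"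
    proof (rule Bochner_Integration.integral_cong)
      fix \<phi> assume "\<phi> \<in> space \<mu>"
      then have "linear \<phi>" unfolding sp by (intro bounded_linear.linear dual_ball_bounded_linear)
      then show "norm (\<phi> (c *\<^sub>R x)) powr r = c powr r * norm (\<phi> x) powr r"
        using that by (simp add: linear_scale powr_mult)
    qed simp
    then show ?thesis using that rs by (simp add: N_def powr_mult powr_powr)
  qed
  \<comment> \<open>A bound valid for every \<phi> in the ball survives integration against a
    probability measure, so the r-summing constant is 1.\<close>
  have D: "(\<Sum>j=1..k. N (y j) powr r) \<le> 1 * T"
    if T: "\<And>\<phi>. \<phi> \<in> dual_ball sE \<Longrightarrow> (\<Sum>j=1..k. norm (\<phi> (y j)) powr r) \<le> T" for k :: nat and y T
  proof -
    have "(\<Sum>j=1..k. N (y j) powr r) = (LINT \<phi>|\<mu>. (\<Sum>j=1..k. norm (\<phi> (y j)) powr r))"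
      unfolding Nr using int by (intro Bochner_Integration.integral_sum[symmetric]) auto
    also have "\<dots> \<le> (LINT \<phi>|\<mu>. T)"
      using T int by (intro integral_mono Bochner_Integration.integrable_sum) (auto simp: sp)
    finally show ?thesis using prob_space by simp
  qed
  have "\<exists>C\<ge>0. \<forall>(k::nat) x W. (\<forall>\<phi>\<in>dual_ball sE. (\<Sum>j=1..k. norm (\<phi> (x j))) \<le> W) \<longrightarrow>
      (\<Sum>j=1..k. N (x j)) \<le> C * W"
    using cotype q rs N0 Nc D by (rule cotype_r_summing_imp_summing)
  then obtain C where C: "C \<ge> 0" "\<And>(k::nat) x W. (\<forall>\<phi>\<in>dual_ball sE. (\<Sum>j=1..k. norm (\<phi> (x j))) \<le> W) \<Longrightarrow>
      (\<Sum>j=1..k. N (x j)) \<le> C * W"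
    by blast
  \<comment> \<open>The constant is raised to C + 1 because the domination theorem asks for a
    positive one.\<close>
  have summing: "(\<Sum>j=1..k. N (x j)) \<le> (C + 1) * W"
    if W: "\<And>\<phi>. \<phi> \<in> dual_ball sE \<Longrightarrow> (\<Sum>j=1..k. norm (\<phi> (x j))) \<le> W" for k :: nat and x W
  proof -
    have "W \<ge> 0" using W[OF zero_in_dual_ball] by simp
    moreover have "(\<Sum>j=1..k. N (x j)) \<le> C * W" using W by (intro C(2)) blast
    ultimately show ?thesis by (simp add: distrib_right)
  qed
  have C1: "C + 1 > 0" using C(1) by simp
  have "\<exists>\<nu>. regular_borel_prob (weak_star_ball sE) \<nu> \<and> (\<forall>x. N x \<le> (C + 1) * (LINT \<phi>|\<nu>. norm (\<phi> x)))"
    using C1 N0 Nc summing by (rule pietsch_domination)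
  then obtain \<nu> where "regular_borel_prob (weak_star_ball sE) \<nu>" "\<And>x. N x \<le> (C + 1) * (LINT \<phi>|\<nu>. norm (\<phi> x))"
    by blast
  then show ?thesis using that[of "C + 1" \<nu>] C1 by (simp add: N_def)
qed

end

context banach_pair
begin

text \<open>These are the two properties of \<open>N\<close> that the operator result asks for, here
  for the norm of the multilinear map obtained by fixing entry i.\<close>

lemma multilinear_norm_slice:
  assumes P: "P \<in> cont_hom_polys sE sF n" and i: "i < n"
  shows "multilinear_norm (n - 1) (\<lambda>y. polar_form sE sF n P (insert_arg i t y)) \<ge> 0"
    and "c \<ge> 0 \<Longrightarrow> multilinear_norm (n - 1) (\<lambda>y. polar_form sE sF n P (insert_arg i (c *\<^sub>R t) y)) =
      c * multilinear_norm (n - 1) (\<lambda>y. polar_form sE sF n P (insert_arg i t y))"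
proof -
  define B where "B = {y::nat \<Rightarrow> 'a. \<forall>j<n - 1. norm (y j) \<le> 1}"
  define f where "f t y = polar_form sE sF n P (insert_arg i t y)" for t y
  define \<nu> where "\<nu> t = (SUP y\<in>B. norm (f t y))" for t
  have \<nu>: "multilinear_norm (n - 1) (\<lambda>y. polar_form sE sF n P (insert_arg i t y)) = \<nu> t" for t
    by (simp add: multilinear_norm_def \<nu>_def B_def f_def)
  have zero: "(\<lambda>_. 0) \<in> B" by (simp add: B_def)
  have bdd: "bdd_above ((\<lambda>y. norm (f t y)) ` B)" for t
    using polarization_slice_bounded[OF P i, of t] polar_form_eq_polarization(1)[OF P]
    by (auto simp: f_def B_def bdd_above_def)
  have upper: "norm (f t y) \<le> \<nu> t" if "y \<in> B" for t y
    unfolding \<nu>_def by (rule cSUP_upper[OF that bdd])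
  have nonneg: "\<nu> t \<ge> 0" for t using upper[OF zero, of t] norm_ge_zero order_trans by blast
  have scale: "f (c *\<^sub>R t) y = c *\<^sub>R f t y" for c t y
  proof -
    have "linear (\<lambda>t. polarization n P ((insert_arg i 0 y)(i := t)))"
      by (rule multilinear_linear[OF polar_form_eq_polarization(2)[OF P] i])
    moreover have "(insert_arg i 0 y)(i := t) = insert_arg i t y" for t
      by (auto simp: insert_arg_def)
    ultimately have "linear (\<lambda>t. polarization n P (insert_arg i t y))" by simp
    then show ?thesis
      using linear_scale[of "\<lambda>t. polarization n P (insert_arg i t y)" c t]
      by (simp add: f_def polar_form_eq_polarization(1)[OF P])
  qed
  have le: "\<nu> (c *\<^sub>R t) \<le> c * \<nu> t" if "c \<ge> 0" for c t
    unfolding \<nu>_def[of "c *\<^sub>R t"] using zero that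
    by (intro cSUP_least) (auto simp: scale intro: mult_left_mono upper)
  show "multilinear_norm (n - 1) (\<lambda>y. polar_form sE sF n P (insert_arg i t y)) \<ge> 0"
    unfolding \<nu> by (rule nonneg)
  show "multilinear_norm (n - 1) (\<lambda>y. polar_form sE sF n P (insert_arg i (c *\<^sub>R t) y)) =
      c * multilinear_norm (n - 1) (\<lambda>y. polar_form sE sF n P (insert_arg i t y))" if c: "c \<ge> 0"
    unfolding \<nu>
  proof (rule antisym)
    show "\<nu> (c *\<^sub>R t) \<le> c * \<nu> t" by (rule le[OF c])
    show "c * \<nu> t \<le> \<nu> (c *\<^sub>R t)"
    proof (cases "c = 0")
      case True
      then show ?thesis using nonneg by simp
    next
      case False
      \<comment> \<open>The reverse inequality is the one already proved, applied to 1 / c.\<close>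
      have "\<nu> (inverse c *\<^sub>R c *\<^sub>R t) \<le> inverse c * \<nu> (c *\<^sub>R t)" by (rule le) (use c in simp)
      then show ?thesis using False c by (simp add: field_simps)
    qed
  qed
qed

lemma summing_polys_cotype:
  assumes cotype: "has_cotype TYPE('a) q" and q: "q > 1"
    and rs: "r > 1" "1 / r + 1 / s = 1" "s > q"
  shows "summing_polys sE sF r n = summing_polys sE sF 1 n"
proof -
  have "(if n = 1 then abs_summing sE sF norm r P
      else \<forall>i<n. abs_summing sE (\<lambda>c A y. sF c (A y)) (multilinear_norm (n - 1)) r
        (\<lambda>t y. polar_form sE sF n P (insert_arg i t y))) \<longleftrightarrow>
    (if n = 1 then abs_summing sE sF norm 1 P
      else \<forall>i<n. abs_summing sE (\<lambda>c A y. sF c (A y)) (multilinear_norm (n - 1)) 1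
        (\<lambda>t y. polar_form sE sF n P (insert_arg i t y)))" if P: "P \<in> cont_hom_polys sE sF n" for P
  proof (cases "n = 1")
    case True
    have "P (c *\<^sub>R x) = c *\<^sub>R P x" for c x
    proof -
      obtain A where A: "multilinear_map sE sF n A" "\<And>x. P x = A (\<lambda>_. x)"
        using P unfolding cont_hom_polys_def by blast
      show ?thesis using multilinear_homogeneous[OF A(1), of c "\<lambda>_. x"] True by (simp add: A(2))
    qed
    then have "abs_summing sE sF norm r P \<longleftrightarrow> abs_summing sE sF norm 1 P"
      by (intro E.abs_summing_cotype_iff[OF cotype q rs]) auto
    then show ?thesis using True by simp
  next
    case False
    have "abs_summing sE (\<lambda>c A y. sF c (A y)) (multilinear_norm (n - 1)) r
        (\<lambda>t y. polar_form sE sF n P (insert_arg i t y)) \<longleftrightarrow>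
      abs_summing sE (\<lambda>c A y. sF c (A y)) (multilinear_norm (n - 1)) 1
        (\<lambda>t y. polar_form sE sF n P (insert_arg i t y))" if "i < n" for i
      using multilinear_norm_slice[OF P that] by (intro E.abs_summing_cotype_iff[OF cotype q rs]) auto
    then show ?thesis using False by simp
  qed
  then show ?thesis unfolding summing_polys_def by blast
qed

text \<open>Since n / p = (1 / p) n, domination compares \<open>norm (P x)\<close> with the n-th
  power of an L_p norm of the evaluation at x, so it suffices to compare these norms. Lowering the
  exponent changes the measure, raising it keeps the measure.\<close>

lemma dominated_polys_cotype:
  assumes cotype: "has_cotype TYPE('a) q" and q: "q > 1"
    and rs: "r > 1" "1 / r + 1 / s = 1" "s > q"
  shows "dominated_polys sE sF r n = dominated_polys sE sF 1 n"
proof -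
  define dom where "dom p P \<longleftrightarrow> (\<exists>C\<ge>0. \<exists>\<mu>. regular_borel_prob (weak_star_ball sE) \<mu> \<and>
      (\<forall>x. norm (P x) \<le> C * (LINT \<phi>|\<mu>. norm (\<phi> x) powr p) powr (real n / p)))"
    for p and P :: "'a \<Rightarrow> 'b"
  have root: "t powr (real n / r) = (t powr (1 / r)) powr real n" for t :: real
    by (simp add: powr_powr)
  have "dom 1 P" if "dom r P" for P
  proof -
    obtain C \<mu> where C: "C \<ge> 0" and \<mu>: "regular_borel_prob (weak_star_ball sE) \<mu>"
      and P: "\<And>x. norm (P x) \<le> C * (LINT \<phi>|\<mu>. norm (\<phi> x) powr r) powr (real n / r)"
      using \<open>dom r P\<close> unfolding dom_def by blast
    obtain D \<nu> where D: "D > 0" and \<nu>: "regular_borel_prob (weak_star_ball sE) \<nu>"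
      and le: "\<And>x. (LINT \<phi>|\<mu>. norm (\<phi> x) powr r) powr (1 / r) \<le> D * (LINT \<phi>|\<nu>. norm (\<phi> x))"
      by (rule E.cotype_dominating_measure[OF cotype q rs \<mu>]) blast
    have "norm (P x) \<le> C * D powr real n * (LINT \<phi>|\<nu>. norm (\<phi> x) powr 1) powr (real n / 1)" for x
    proof -
      have "norm (P x) \<le> C * ((LINT \<phi>|\<mu>. norm (\<phi> x) powr r) powr (1 / r)) powr real n"
        using P[of x] unfolding root .
      also have "\<dots> \<le> C * (D * (LINT \<phi>|\<nu>. norm (\<phi> x))) powr real n"
        using C le by (intro mult_left_mono powr_mono2) auto
      also have "\<dots> = C * D powr real n * (LINT \<phi>|\<nu>. norm (\<phi> x) powr 1) powr (real n / 1)"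
        using D by (simp add: powr_mult)
      finally show ?thesis .
    qed
    moreover have "C * D powr real n \<ge> 0" using C by simp
    ultimately show ?thesis unfolding dom_def using \<nu> by blast
  qed
  moreover have "dom r P" if "dom 1 P" for P
  proof -
    obtain C \<mu> where C: "C \<ge> 0" and \<mu>: "regular_borel_prob (weak_star_ball sE) \<mu>"
      and P: "\<And>x. norm (P x) \<le> C * (LINT \<phi>|\<mu>. norm (\<phi> x) powr 1) powr (real n / 1)"
      using \<open>dom 1 P\<close> unfolding dom_def by blast
    have "norm (P x) \<le> C * (LINT \<phi>|\<mu>. norm (\<phi> x) powr r) powr (real n / r)" for x
    proof -
      have "norm (P x) \<le> C * (LINT \<phi>|\<mu>. norm (\<phi> x)) powr real n" using P[of x] by simp
      also have "\<dots> \<le> C * ((LINT \<phi>|\<mu>. norm (\<phi> x) powr r) powr (1 / r)) powr real n"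
        using C E.integral_norm_le_powr[OF \<mu> rs(1)] by (intro mult_left_mono powr_mono2) auto
      finally show ?thesis unfolding root .
    qed
    then show ?thesis unfolding dom_def using C \<mu> by blast
  qed
  ultimately have "dom r P \<longleftrightarrow> dom 1 P" for P by blast
  moreover have "dominated_polys sE sF p n = {P \<in> cont_hom_polys sE sF n. dom p P}" for p
    by (simp add: dominated_polys_def dom_def)
  ultimately show ?thesis by simp
qed

end

theorem proposition3:
  fixes sE :: "'k::real_or_complex \<Rightarrow> 'e::banach \<Rightarrow> 'e"
    and sF :: "'k \<Rightarrow> 'f::banach \<Rightarrow> 'f"
    and q q' r :: real and n :: nat
  assumes "banach_over sE" and "banach_over sF"
    and "2 < q" and "has_cotype TYPE('e) q"
    and "1 / q + 1 / q' = 1"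
    and "n \<ge> 1"
    and "1 < r" and "r < q'"
  shows "summing_polys sE sF r n = summing_polys sE sF 1 n \<and>
    dominated_polys sE sF r n = dominated_polys sE sF 1 n"
proof -
  interpret banach_pair sE sF
    using assms(1,2) by (simp add: banach_pair_def)
  \<comment> \<open>The conjugate exponent of r; in terms of s, the condition r < q' reads s >
    q.\<close>
  define s where "s = r / (r - 1)"
  have s: "1 / r + 1 / s = 1" "s > 0" using \<open>1 < r\<close> by (auto simp: s_def field_simps)
  have "1 / q' < 1 / r" using \<open>1 < r\<close> \<open>r < q'\<close> by (simp add: frac_less2)
  then have "1 / s < 1 / q" using s(1) \<open>1 / q + 1 / q' = 1\<close> by linarith
  then have "q < s" using s(2) \<open>2 < q\<close> by (simp add: field_simps)
  then show ?thesis
    using summing_polys_cotype[of q r s n] dominated_polys_cotype[of q r s n] assms s by auto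
qed

end
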